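(* Let $1<p<\infty$, $n\ge2$, let $\Omega\subseteq\mathbb{R}^n$ be a domain, let $a=(a_1,\dots,a_n)$ be a weight vector and $V\in M^q_{\mathrm{loc}}(p;\Omega)$ as in the context, and suppose that $Q_{p,p,a,V}\ge0$ on $C_c^\infty(\Omega)$. Fix a positive solution $u\in W^{1,p}_{\mathrm{loc}}(\Omega)\cap C(\Omega)$ of $Q'_{p,p,a,V}[v]=0$ in $\Omega$. Then there are constants $0<c\le C<\infty$ depending only on $p$ such that for all nonnegative $\psi\in W^{1,p}(\Omega)\cap C_c(\Omega)$, $$c\,E(\psi)\le Q_{p,p,a,V}[u\psi]\le C\,E(\psi),\qquad E(\psi)=\int_{\Omega}\sum_{i=1}^{n}u^{2}|(\partial_{i}\psi)'|^{2}\left(\psi|(\partial_{i}u)'|+u|(\partial_{i}\psi)'|\right)^{p-2}\,dx.$$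
   Context: $\omega\Subset\Omega$ means that the closure of $\omega$ is a compact subset of $\Omega$. $C_c(\Omega)$: continuous functions with compact support in $\Omega$. Weights: $a_1,\dots,a_n:\Omega\to(0,\infty)$ are Lebesgue measurable and for every domain $\omega\Subset\Omega$ there are constants $0<c_\omega\le C_\omega<\infty$ with $c_\omega\le a_i\le C_\omega$ a.e. in $\omega$. $|\xi|_{p,a}=(\sum_i a_i(x)|\xi_i|^p)^{1/p}$ and $(\partial_i\psi)'=a_i(x)^{1/p}\partial_i\psi$, similarly for $u$. Morrey space: for a domain $\omega\Subset\Omega$ and measurable $f$ on $\omega$: if $p<n$ and $q>n/p$, $\|f\|_{M^q(p;\omega)}=\sup_{y\in\omega,\,0<r<\mathrm{diam}(\omega)}r^{-n/q'}\int_{\omega\cap B_r(y)}|f|\,dx$ with $q'=q/(q-1)$; if $p=n$ and $q>n$, $\|f\|_{M^q(n;\omega)}=\sup_{y\in\omega,\,0<r<\mathrm{diam}(\omega)}(\log(\mathrm{diam}(\omega)/r))^{q/n'}\int_{\omega\cap B_r(y)}|f|\,dx$ with $n'=n/(n-1)$; in these cases $M^q(p;\omega)$ is the set of $f\in L^1_{\mathrm{loc}}(\omega)$ with finite norm. If $p>n$, $q=1$ and $M^q(p;\omega)=L^1(\omega)$. $M^q_{\mathrm{loc}}(p;\Omega)$ consists of functions lying in $M^q(p;\omega)$ for all domains $\omega\Subset\Omega$. Functional: $Q_{p,p,a,V}[\phi]=\int_\Omega(|\nabla\phi|_{p,a}^p+V|\phi|^p)\,dx$. A positive solution of $Q'_{p,p,a,V}[v]=0$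 in $\Omega$ is a positive $v\in W^{1,p}_{\mathrm{loc}}(\Omega)$ with $\int_\Omega\sum_i a_i|\partial_iv|^{p-2}\partial_iv\,\partial_i\phi\,dx+\int_\Omega V|v|^{p-2}v\phi\,dx=0$ for all $\phi\in C_c^\infty(\Omega)$. Conventions: $|t|^{p-2}t=0$ for $t=0$; $t^2(t+\tau)^{p-2}=0$ when $t=\tau=0$. *)

theory Defs
  imports "HOL-Analysis.Analysis"
begin

text \<open>
  The constants of the theorem depend on \<open>p\<close> alone, so the dimension \<open>n\<close> has to be a number that can
  be quantified inside the statement, not an index type. Points of \<open>\<real>\<^sup>n\<close> are the extensional functions
  on \<open>{..<n}\<close>: this is both the carrier of the product topology and the space of the product measure
  below. Coordinates are numbered \<open>0, \<dots>, n - 1\<close>. A function on \<open>\<Omega>\<close> is a total function of which only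
  the values on \<open>\<Omega>\<close> matter. The class-based \<open>dist\<close>, \<open>ball\<close> and \<open>diameter\<close> on \<open>nat \<Rightarrow> real\<close>
  refer to a different metric and are not used.
\<close>

type_synonym point = "nat \<Rightarrow> real"

abbreviation Rn :: "nat \<Rightarrow> point topology" where
  "Rn n \<equiv> product_topology (\<lambda>_. euclideanreal) {..<n}"

definition leb :: "nat \<Rightarrow> point measure" where
  "leb n = completion (\<Pi>\<^sub>M i\<in>{..<n}. lborel)"

definition edist :: "nat \<Rightarrow> point \<Rightarrow> point \<Rightarrow> real" where
  "edist n x y = L2_set (\<lambda>i. x i - y i) {..<n}"

definition eball :: "nat \<Rightarrow> point \<Rightarrow> real \<Rightarrow> point set" where
  "eball n y r = {x \<in> topspace (Rn n). edist n y x < r}"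

text \<open>Only meaningful for bounded nonempty sets.\<close>

definition ediam :: "nat \<Rightarrow> point set \<Rightarrow> real" where
  "ediam n S = (SUP (x, y) \<in> S \<times> S. edist n x y)"

definition is_domain :: "nat \<Rightarrow> point set \<Rightarrow> bool" where
  "is_domain n \<Omega> \<longleftrightarrow> openin (Rn n) \<Omega> \<and> connectedin (Rn n) \<Omega> \<and> \<Omega> \<noteq> {}"

definition compactly_contained :: "nat \<Rightarrow> point set \<Rightarrow> point set \<Rightarrow> bool" where
  "compactly_contained n \<omega> \<Omega> \<longleftrightarrow>
     compactin (Rn n) (Rn n closure_of \<omega>) \<and> Rn n closure_of \<omega> \<subseteq> \<Omega>"

definition C_on :: "nat \<Rightarrow> point set \<Rightarrow> (point \<Rightarrow> real) set" where
  "C_on n \<Omega> = {f. continuous_map (subtopology (Rn n) \<Omega>) euclideanreal f}"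

definition C_c :: "nat \<Rightarrow> point set \<Rightarrow> (point \<Rightarrow> real) set" where
  "C_c n \<Omega> = {f \<in> C_on n \<Omega>. compactly_contained n {x \<in> \<Omega>. f x \<noteq> 0} \<Omega>}"

definition pderiv_at :: "nat \<Rightarrow> (point \<Rightarrow> real) \<Rightarrow> point \<Rightarrow> real" where
  "pderiv_at i f x = deriv (\<lambda>t. f (x(i := t))) (x i)"

primrec C_k :: "nat \<Rightarrow> nat \<Rightarrow> point set \<Rightarrow> (point \<Rightarrow> real) set" where
  "C_k n 0 \<Omega> = C_on n \<Omega>"
| "C_k n (Suc k) \<Omega> = {f \<in> C_on n \<Omega>. \<forall>i<n.
     (\<forall>x\<in>\<Omega>. (\<lambda>t. f (x(i := t))) differentiable (at (x i))) \<and> pderiv_at i f \<in> C_k n k \<Omega>}"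

definition C_c_inf :: "nat \<Rightarrow> point set \<Rightarrow> (point \<Rightarrow> real) set" where
  "C_c_inf n \<Omega> = C_c n \<Omega> \<inter> (\<Inter>k. C_k n k \<Omega>)"

definition Lp :: "nat \<Rightarrow> real \<Rightarrow> point set \<Rightarrow> (point \<Rightarrow> real) set" where
  "Lp n p \<Omega> = {f \<in> borel_measurable (restrict_space (leb n) \<Omega>).
     set_integrable (leb n) \<Omega> (\<lambda>x. \<bar>f x\<bar> powr p)}"

definition Lp_loc :: "nat \<Rightarrow> real \<Rightarrow> point set \<Rightarrow> (point \<Rightarrow> real) set" where
  "Lp_loc n p \<Omega> = {f \<in> borel_measurable (restrict_space (leb n) \<Omega>).
     \<forall>K. compactin (Rn n) K \<and> K \<subseteq> \<Omega> \<longrightarrow> set_integrable (leb n) K (\<lambda>x. \<bar>f x\<bar> powr p)}"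

definition is_weak_pderiv :: "nat \<Rightarrow> point set \<Rightarrow> nat \<Rightarrow> (point \<Rightarrow> real) \<Rightarrow> (point \<Rightarrow> real) \<Rightarrow> bool" where
  "is_weak_pderiv n \<Omega> i f g \<longleftrightarrow> f \<in> Lp_loc n 1 \<Omega> \<and> g \<in> Lp_loc n 1 \<Omega> \<and>
     (\<forall>\<phi>\<in>C_c_inf n \<Omega>. (LINT x:\<Omega>|leb n. f x * pderiv_at i \<phi> x) = - (LINT x:\<Omega>|leb n. g x * \<phi> x))"

text \<open>A representative of the weak derivative, which is unique up to null sets when it exists.\<close>

definition weak_pderiv :: "nat \<Rightarrow> point set \<Rightarrow> nat \<Rightarrow> (point \<Rightarrow> real) \<Rightarrow> point \<Rightarrow> real" where
  "weak_pderiv n \<Omega> i f = (SOME g. is_weak_pderiv n \<Omega> i f g)"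

definition W1p :: "nat \<Rightarrow> real \<Rightarrow> point set \<Rightarrow> (point \<Rightarrow> real) set" where
  "W1p n p \<Omega> = {f \<in> Lp n p \<Omega>. \<forall>i<n. \<exists>g \<in> Lp n p \<Omega>. is_weak_pderiv n \<Omega> i f g}"

definition W1p_loc :: "nat \<Rightarrow> real \<Rightarrow> point set \<Rightarrow> (point \<Rightarrow> real) set" where
  "W1p_loc n p \<Omega> = {f \<in> Lp_loc n p \<Omega>. \<forall>i<n. \<exists>g \<in> Lp_loc n p \<Omega>. is_weak_pderiv n \<Omega> i f g}"

definition weight_vector :: "nat \<Rightarrow> point set \<Rightarrow> (nat \<Rightarrow> point \<Rightarrow> real) \<Rightarrow> bool" where
  "weight_vector n \<Omega> a \<longleftrightarrow>
     (\<forall>i<n. a i \<in> borel_measurable (restrict_space (leb n) \<Omega>) \<and> (\<forall>x\<in>\<Omega>. 0 < a i x)) \<and>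
     (\<forall>\<omega>. is_domain n \<omega> \<and> compactly_contained n \<omega> \<Omega> \<longrightarrow>
       (\<exists>c C. 0 < c \<and> c \<le> C \<and>
         (\<forall>i<n. AE x in leb n. x \<in> \<omega> \<longrightarrow> c \<le> a i x \<and> a i x \<le> C)))"

definition morrey_exponent :: "nat \<Rightarrow> real \<Rightarrow> real \<Rightarrow> bool" where
  "morrey_exponent n p q \<longleftrightarrow>
     (p < real n \<and> real n / p < q) \<or> (p = real n \<and> real n < q) \<or> (real n < p \<and> q = 1)"

text \<open>
  The factor in front of the integral is \<open>r powr (- n / q')\<close> for \<open>p < n\<close> and
  \<open>ln (diam \<omega> / r) powr (q / n')\<close> for \<open>p = n\<close>, with \<open>q' = q / (q - 1)\<close> and \<open>n' = n / (n - 1)\<close>.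
\<close>

definition morrey_factor :: "nat \<Rightarrow> real \<Rightarrow> real \<Rightarrow> point set \<Rightarrow> real \<Rightarrow> real" where
  "morrey_factor n p q \<omega> r =
     (if p < real n then r powr (- real n / (q / (q - 1)))
      else ln (ediam n \<omega> / r) powr (q / (real n / (real n - 1))))"

definition morrey_norm :: "nat \<Rightarrow> real \<Rightarrow> real \<Rightarrow> point set \<Rightarrow> (point \<Rightarrow> real) \<Rightarrow> ennreal" where
  "morrey_norm n p q \<omega> f = (SUP y\<in>\<omega>. SUP r\<in>{0<..<ediam n \<omega>}.
     ennreal (morrey_factor n p q \<omega> r) *
     (\<integral>\<^sup>+x\<in>\<omega> \<inter> eball n y r. ennreal \<bar>f x\<bar> \<partial>leb n))"

definition morrey :: "nat \<Rightarrow> real \<Rightarrow> real \<Rightarrow> point set \<Rightarrow> (point \<Rightarrow> real) set" where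
  "morrey n p q \<omega> =
     (if p \<le> real n then {f \<in> Lp_loc n 1 \<omega>. morrey_norm n p q \<omega> f < \<infinity>} else Lp n 1 \<omega>)"

definition morrey_loc :: "nat \<Rightarrow> real \<Rightarrow> real \<Rightarrow> point set \<Rightarrow> (point \<Rightarrow> real) set" where
  "morrey_loc n p q \<Omega> =
     {f. \<forall>\<omega>. is_domain n \<omega> \<and> compactly_contained n \<omega> \<Omega> \<longrightarrow> f \<in> morrey n p q \<omega>}"

definition weighted_norm :: "nat \<Rightarrow> real \<Rightarrow> (nat \<Rightarrow> point \<Rightarrow> real) \<Rightarrow> point \<Rightarrow> (nat \<Rightarrow> real) \<Rightarrow> real" where
  "weighted_norm n p a x \<xi> = (\<Sum>i<n. a i x * \<bar>\<xi> i\<bar> powr p) powr (1 / p)"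

definition Q_fun :: "nat \<Rightarrow> point set \<Rightarrow> real \<Rightarrow> (nat \<Rightarrow> point \<Rightarrow> real) \<Rightarrow> (point \<Rightarrow> real) \<Rightarrow>
    (point \<Rightarrow> real) \<Rightarrow> real" where
  "Q_fun n \<Omega> p a V \<phi> = (LINT x:\<Omega>|leb n.
     weighted_norm n p a x (\<lambda>i. weak_pderiv n \<Omega> i \<phi> x) powr p + V x * \<bar>\<phi> x\<bar> powr p)"

text \<open>
  Here and in \<open>E_fun\<close>, \<open>0 powr s = 0\<close> for every \<open>s\<close> yields the conventions \<open>\<bar>t\<bar>\<^bsup>p-2\<^esup>t = 0\<close> at \<open>t = 0\<close> and
  \<open>t\<^sup>2(t + \<tau>)\<^bsup>p-2\<^esup> = 0\<close> at \<open>t = \<tau> = 0\<close>.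
\<close>

definition positive_solution :: "nat \<Rightarrow> point set \<Rightarrow> real \<Rightarrow> (nat \<Rightarrow> point \<Rightarrow> real) \<Rightarrow>
    (point \<Rightarrow> real) \<Rightarrow> (point \<Rightarrow> real) \<Rightarrow> bool" where
  "positive_solution n \<Omega> p a V v \<longleftrightarrow> v \<in> W1p_loc n p \<Omega> \<and> (\<forall>x\<in>\<Omega>. 0 < v x) \<and>
     (\<forall>\<phi>\<in>C_c_inf n \<Omega>.
       (LINT x:\<Omega>|leb n. \<Sum>i<n. a i x * \<bar>weak_pderiv n \<Omega> i v x\<bar> powr (p - 2)
                                 * weak_pderiv n \<Omega> i v x * pderiv_at i \<phi> x) +
       (LINT x:\<Omega>|leb n. V x * \<bar>v x\<bar> powr (p - 2) * v x * \<phi> x) = 0)"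

text \<open>The primed derivative \<open>(\<partial>\<^sub>i f)'\<close>.\<close>

definition weighted_pderiv :: "nat \<Rightarrow> point set \<Rightarrow> real \<Rightarrow> (nat \<Rightarrow> point \<Rightarrow> real) \<Rightarrow> nat \<Rightarrow>
    (point \<Rightarrow> real) \<Rightarrow> point \<Rightarrow> real" where
  "weighted_pderiv n \<Omega> p a i f x = a i x powr (1 / p) * weak_pderiv n \<Omega> i f x"

definition E_fun :: "nat \<Rightarrow> point set \<Rightarrow> real \<Rightarrow> (nat \<Rightarrow> point \<Rightarrow> real) \<Rightarrow> (point \<Rightarrow> real) \<Rightarrow>
    (point \<Rightarrow> real) \<Rightarrow> real" where
  "E_fun n \<Omega> p a u \<psi> = (LINT x:\<Omega>|leb n. \<Sum>i<n.
     (u x)\<^sup>2 * \<bar>weighted_pderiv n \<Omega> p a i \<psi> x\<bar>\<^sup>2 *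
     (\<psi> x * \<bar>weighted_pderiv n \<Omega> p a i u x\<bar> + u x * \<bar>weighted_pderiv n \<Omega> p a i \<psi> x\<bar>) powr (p - 2))"

end

(*
  With the test function u psi^p in the weak equation for u, Picone's identity turns Q[u psi] into
  the integral of the sum over i of

    |A + B|^p - |A|^p - p |A|^(p-2) A B,   A = psi (d_i u)',   B = u (d_i psi)',

  and this remainder is comparable to B^2 (|A| + |B|)^(p-2), with constants depending on p only:
  by homogeneity it is a function of s = B / A whose quotient by s^2 (1 + |s|)^(p-2) is positive and
  has positive limits at 0 and at infinity.

  The equation only admits smooth test functions. The Sobolev function u psi^p is approximated by
  convolution with products of one-dimensional bumps: uniformly, because it is continuous with compact
  support, and with weak derivatives bounded in L^p and convergent in L^1, which is enough against the
  L^(p/(p-1)) flux.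
*)
theory Submission
  imports Defs "HOL-Real_Asymp.Real_Asymp"
begin

text \<open>The test function is |u \<psi>|^p / u^(p-1), written without a quotient: multiplied by
  u^(p-1) it gives back |u \<psi>|^p, so the potential terms cancel exactly. The rest splits by
  coordinates, and once a_i^(1/p) is absorbed into A and B only an inequality between two real
  numbers remains; hence constants free of n, a, V and u.

  The obstacle is regularity. Neither gradient is bounded, so u \<psi>^p first needs a product and
  chain rule for weak derivatives, itself proved by mollification. The two terms of the equation
  also ask for different limits: V u^(p-1) is only locally integrable, which forces uniform
  convergence of the test functions, while the flux pairs with gradients that are not continuous.
  L^1 convergence of mollified functions comes from boxes by a Dynkin argument, the L^p bound from
  Jensen's inequality.

  Weak derivatives are arbitrary representatives and the integral of a non-integrable function is 0
  by convention, so almost everywhere identities and integrability have to be tracked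
  throughout.\<close>

subsection \<open>The elementary inequality\<close>

text \<open>Near 0 and near both infinities the positive limits give the bounds; what remains is a
  compact set, on which a positive continuous function attains its extrema. The origin is excluded
  because \<open>f\<close> will be a quotient that degenerates there.\<close>

lemma ratio_bounds_from_limits:
  fixes f :: "real \<Rightarrow> real"
  assumes cont: "continuous_on (- {0}) f" and pos: "\<And>s. s \<noteq> 0 \<Longrightarrow> 0 < f s"
    and l0: "(f \<longlongrightarrow> l0) (at 0)" "0 < l0"
    and lt: "(f \<longlongrightarrow> lt) at_top" "0 < lt"
    and lb: "(f \<longlongrightarrow> lb) at_bot" "0 < lb"
  obtains c C where "0 < c" "c \<le> C" "\<And>s. s \<noteq> 0 \<Longrightarrow> c \<le> f s \<and> f s \<le> C"
proof -
  have *: "\<forall>\<^sub>F s in F. l / 2 \<le> f s \<and> f s \<le> 2 * l" if "(f \<longlongrightarrow> l) F" "0 < l" for F l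
  proof -
    have "\<forall>\<^sub>F s in F. l / 2 < f s" "\<forall>\<^sub>F s in F. f s < 2 * l"
      using order_tendstoD(1)[OF that(1), of "l/2"] order_tendstoD(2)[OF that(1), of "2*l"] that(2) by auto
    then show ?thesis by eventually_elim auto
  qed
  obtain d where d: "0 < d" "\<And>s. s \<noteq> 0 \<Longrightarrow> dist s 0 < d \<Longrightarrow> l0 / 2 \<le> f s \<and> f s \<le> 2 * l0"
    using *[OF l0] unfolding eventually_at by auto
  obtain M where M: "\<And>s. M \<le> s \<Longrightarrow> lt / 2 \<le> f s \<and> f s \<le> 2 * lt"
    using *[OF lt] unfolding eventually_at_top_linorder by auto
  obtain N where N: "\<And>s. s \<le> N \<Longrightarrow> lb / 2 \<le> f s \<and> f s \<le> 2 * lb"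
    using *[OF lb] unfolding eventually_at_bot_linorder by auto
  \<comment> \<open>Inserting \<open>d\<close> keeps the compact set nonempty, so that extrema exist
    even if the limits already take care of all other points.\<close>
  define K where "K = insert d ({N..M} - ball 0 d)"
  have K: "compact K" "K \<noteq> {}" "K \<subseteq> - {0}"
    using d(1) compact_insert[OF compact_diff[OF compact_Icc open_ball]] unfolding K_def
    by (auto simp: dist_real_def)
  have ck: "continuous_on K f" using cont K(3) by (rule continuous_on_subset)
  obtain a where a: "a \<in> K" "\<And>s. s \<in> K \<Longrightarrow> f a \<le> f s"
    using continuous_attains_inf[OF K(1,2) ck] by auto
  obtain b where b: "b \<in> K" "\<And>s. s \<in> K \<Longrightarrow> f s \<le> f b"
    using continuous_attains_sup[OF K(1,2) ck] by auto
  define c where "c = min (min (l0/2) (lt/2)) (min (lb/2) (f a))"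
  define C where "C = max (max (2*l0) (2*lt)) (max (2*lb) (f b))"
  have "a \<noteq> 0" using a(1) K(3) by auto
  then have fa: "0 < f a" by (rule pos)
  show thesis
  proof
    show "0 < c" using assms fa by (auto simp: c_def)
    have "c \<le> l0/2" "2*l0 \<le> C" by (auto simp: c_def C_def)
    then show "c \<le> C" using l0 by linarith
    fix s :: real assume s: "s \<noteq> 0"
    consider "dist s 0 < d" | "M \<le> s" | "s \<le> N" | "s \<in> K"
      unfolding K_def by (cases "dist s 0 < d") (auto simp: dist_commute, force)
    then show "c \<le> f s \<and> f s \<le> C"
    proof cases
      case 1 then show ?thesis using d(2)[OF s] by (auto simp: c_def C_def)
    next
      case 2 then show ?thesis using M[of s] by (auto simp: c_def C_def)
    next
      case 3 then show ?thesis using N[of s] by (auto simp: c_def C_def)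
    next
      case 4 then show ?thesis using a(2)[of s] b(2)[of s] by (auto simp: c_def C_def)
    qed
  qed
qed

text \<open>The delicate point is t = 0: for p < 2 the factor |t|^(p-2) is singular there, but the
  difference quotient |t|^p / t still tends to 0 because p > 1.\<close>

lemma has_real_derivative_abs_powr:
  fixes p t :: real
  assumes "1 < p"
  shows "((\<lambda>t. \<bar>t\<bar> powr p) has_real_derivative p * \<bar>t\<bar> powr (p - 2) * t) (at t)"
proof (cases "t = 0")
  case True
  have "((\<lambda>y. \<bar>y\<bar> powr p / y) \<longlongrightarrow> 0) (at 0)"
    using assms by (intro filterlim_split_at; real_asymp)
  then show ?thesis using True by (simp add: has_field_derivative_iff)
next
  case False
  have "(abs has_real_derivative sgn t) (at t)"
  proof (cases "0 < t")
    case True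
    show ?thesis
      by (rule has_field_derivative_transform_within_open[of "\<lambda>x. x" _ _ "{0<..}"])
        (use True in auto)
  next
    case neg: False
    show ?thesis
      by (rule has_field_derivative_transform_within_open[of "\<lambda>x. - x" _ _ "{..<0}"])
        (use neg False in \<open>auto intro!: derivative_eq_intros\<close>)
  qed
  then have "((\<lambda>t. \<bar>t\<bar> powr p) has_real_derivative p * \<bar>t\<bar> powr (p - 1) * sgn t) (at t)"
    using False by (auto intro!: derivative_eq_intros)
  moreover have "\<bar>t\<bar> powr (p - 1) * sgn t = \<bar>t\<bar> powr (p - 2) * t"
    using False powr_mult_base[of "\<bar>t\<bar>" "p-2"] by (auto simp: sgn_if abs_if mult.commute)
  ultimately show ?thesis by (simp add: mult.assoc)
qed

text \<open>Strict convexity of |t|^p at the point 1. For s \<le> -1 the linear part alone is at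
  least p - 1 > 0; for s > -1 the base 1 + s is positive and the mean value theorem applies on
  either side of 0.\<close>

lemma powr_tangent_pos:
  fixes p s :: real
  assumes "1 < p" "s \<noteq> 0"
  shows "0 < \<bar>1 + s\<bar> powr p - 1 - p * s"
proof (cases "s \<le> -1")
  case True
  then have "p * s \<le> -p" using assms(1) by (simp add: mult_le_cancel_left_pos[of p s "-1", simplified])
  then show ?thesis using assms(1) powr_ge_zero[of "\<bar>1+s\<bar>" p] by linarith
next
  case False
  define r where "r t = (1 + t) powr p - 1 - p * t" for t
  have d: "(r has_real_derivative p * ((1 + t) powr (p-1) - 1)) (at t)" if "-1 < t" for t
    unfolding r_def using that by (auto intro!: derivative_eq_intros simp: algebra_simps)
  have r0: "r 0 = 0" by (simp add: r_def)
  have "0 < r s"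
  proof (cases "0 < s")
    case True
    have "\<exists>l z. 0 < z \<and> z < s \<and> (r has_real_derivative l) (at z) \<and> r s - r 0 = (s - 0) * l"
      using True by (intro MVT continuous_at_imp_continuous_on ballI DERIV_isCont[OF d]) (auto simp: real_differentiable_def intro!: exI d)
    then obtain l z where z: "0 < z" "z < s" "(r has_real_derivative l) (at z)" "r s - r 0 = (s - 0) * l"
      by auto
    have "l = p * ((1 + z) powr (p-1) - 1)" using DERIV_unique[OF z(3) d] z by auto
    moreover have "1 < (1 + z) powr (p-1)" using z assms(1) by (intro gr_one_powr) auto
    ultimately show ?thesis using z r0 True assms(1) by auto
  next
    case s: False
    have "\<exists>l z. s < z \<and> z < 0 \<and> (r has_real_derivative l) (at z) \<and> r 0 - r s = (0 - s) * l"
      using s assms(2) False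
      by (intro MVT continuous_at_imp_continuous_on ballI DERIV_isCont[OF d]) (auto simp: real_differentiable_def intro!: exI d)
    then obtain l z where z: "s < z" "z < 0" "(r has_real_derivative l) (at z)" "r 0 - r s = (0 - s) * l"
      by auto
    have "l = p * ((1 + z) powr (p-1) - 1)" using DERIV_unique[OF z(3) d] z False by auto
    moreover have "(1 + z) powr (p-1) < 1 powr (p-1)"
      using z assms(1) False by (intro powr_less_mono2) auto
    ultimately have "l < 0" using assms(1) by (simp add: mult_pos_neg)
    then show ?thesis using z r0 by (simp add: mult_neg_neg)
  qed
  then show ?thesis using False by (simp add: r_def)
qed

text \<open>At 0 the remainder is asymptotic to p (p - 1) s^2 / 2 by Taylor expansion; at both
  infinities remainder and comparison term grow like |s|^p. All three limits of the quotient are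
  thus positive, and strict convexity gives positivity elsewhere.\<close>

lemma convex_remainder_bounds_normalised:
  fixes p :: real
  assumes "1 < p"
  obtains c C where "0 < c" "c \<le> C"
    "\<And>s. s \<noteq> 0 \<Longrightarrow> c * (s\<^sup>2 * (1 + \<bar>s\<bar>) powr (p - 2)) \<le> \<bar>1 + s\<bar> powr p - 1 - p * s \<and>
      \<bar>1 + s\<bar> powr p - 1 - p * s \<le> C * (s\<^sup>2 * (1 + \<bar>s\<bar>) powr (p - 2))"
proof -
  define f where "f s = (\<bar>1 + s\<bar> powr p - 1 - p * s) / (s\<^sup>2 * (1 + \<bar>s\<bar>) powr (p - 2))" for s
  have den: "0 < s\<^sup>2 * (1 + \<bar>s\<bar>) powr (p - 2)" if "s \<noteq> 0" for s
    using that by auto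
  have "continuous_on (- {0}) f"
    unfolding f_def using assms
    by (intro continuous_on_divide continuous_on_mult continuous_on_diff continuous_on_powr' continuous_on_add
        continuous_on_rabs continuous_on_power continuous_on_const continuous_on_id ballI) auto
  moreover have "0 < f s" if "s \<noteq> 0" for s
    unfolding f_def using powr_tangent_pos[OF assms that] den[OF that] by (rule divide_pos_pos)
  moreover have "(f \<longlongrightarrow> p * (p - 1) / 2) (at 0)"
    unfolding f_def using assms
    by (intro filterlim_split_at; real_asymp simp: field_simps)
  moreover have "(f \<longlongrightarrow> 1) at_top"
    unfolding f_def using assms by real_asymp
  moreover have "(f \<longlongrightarrow> 1) at_bot"
    unfolding f_def using assms by real_asymp
  ultimately obtain c C where c: "0 < c" "c \<le> C" "\<And>s. s \<noteq> 0 \<Longrightarrow> c \<le> f s \<and> f s \<le> C"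
    using assms by (elim ratio_bounds_from_limits) auto
  show thesis
  proof (rule that[OF c(1,2)])
    fix s :: real assume "s \<noteq> 0"
    then show "c * (s\<^sup>2 * (1 + \<bar>s\<bar>) powr (p - 2)) \<le> \<bar>1 + s\<bar> powr p - 1 - p * s \<and>
      \<bar>1 + s\<bar> powr p - 1 - p * s \<le> C * (s\<^sup>2 * (1 + \<bar>s\<bar>) powr (p - 2))"
      using c(3)[of s] den[of s] unfolding f_def by (simp add: field_simps)
  qed
qed

text \<open>Both sides are homogeneous of degree p in (A, B), so for nonzero A the normalised form
  with s = B / A suffices. For A = 0 both sides equal |B|^p up to the constant, which is why 1 is
  merged into the two constants.\<close>

lemma convex_remainder_bounds:
  fixes p :: real
  assumes "1 < p"
  obtains c C where "0 < c" "c \<le> C"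
    "\<And>A B. c * (B\<^sup>2 * (\<bar>A\<bar> + \<bar>B\<bar>) powr (p - 2)) \<le>
      \<bar>A + B\<bar> powr p - \<bar>A\<bar> powr p - p * \<bar>A\<bar> powr (p - 2) * A * B"
    "\<And>A B. \<bar>A + B\<bar> powr p - \<bar>A\<bar> powr p - p * \<bar>A\<bar> powr (p - 2) * A * B \<le>
      C * (B\<^sup>2 * (\<bar>A\<bar> + \<bar>B\<bar>) powr (p - 2))"
proof -
  obtain c C where c: "0 < c" "c \<le> C"
    "\<And>s. s \<noteq> 0 \<Longrightarrow> c * (s\<^sup>2 * (1 + \<bar>s\<bar>) powr (p - 2)) \<le> \<bar>1 + s\<bar> powr p - 1 - p * s \<and>
      \<bar>1 + s\<bar> powr p - 1 - p * s \<le> C * (s\<^sup>2 * (1 + \<bar>s\<bar>) powr (p - 2))"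
    by (rule convex_remainder_bounds_normalised[OF assms]) blast
  have sq: "x\<^sup>2 * x powr (p - 2) = x powr p" if "0 < x" for x :: real
    using that by (simp add: powr_diff)
  have main: "min c 1 * (B\<^sup>2 * (\<bar>A\<bar> + \<bar>B\<bar>) powr (p - 2)) \<le>
      \<bar>A + B\<bar> powr p - \<bar>A\<bar> powr p - p * \<bar>A\<bar> powr (p - 2) * A * B \<and>
      \<bar>A + B\<bar> powr p - \<bar>A\<bar> powr p - p * \<bar>A\<bar> powr (p - 2) * A * B \<le>
      max C 1 * (B\<^sup>2 * (\<bar>A\<bar> + \<bar>B\<bar>) powr (p - 2))" for A B
  proof -
    consider "B = 0" | "A = 0" "B \<noteq> 0" | "A \<noteq> 0" "B \<noteq> 0" by blast
    then show ?thesis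
    proof cases
      case 1 then show ?thesis by simp
    next
      case 2
      have "min c 1 * \<bar>B\<bar> powr p \<le> 1 * \<bar>B\<bar> powr p" "1 * \<bar>B\<bar> powr p \<le> max C 1 * \<bar>B\<bar> powr p"
        by (intro mult_right_mono; simp)+
      then show ?thesis using 2 sq[of "\<bar>B\<bar>"] assms by simp
    next
      case 3
      define s where "s = B / A"
      have s: "s \<noteq> 0" "B = A * s" using 3 by (auto simp: s_def)
      have 1: "\<bar>A + B\<bar> = \<bar>A\<bar> * \<bar>1 + s\<bar>" using s by (simp add: abs_mult[symmetric] algebra_simps)
      have 2: "\<bar>A\<bar> + \<bar>B\<bar> = \<bar>A\<bar> * (1 + \<bar>s\<bar>)" using s by (simp add: abs_mult algebra_simps)
      have 4: "p * \<bar>A\<bar> powr (p - 2) * A * B = \<bar>A\<bar> powr p * (p * s)"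
        using sq[of "\<bar>A\<bar>"] 3 s by (simp add: power2_eq_square algebra_simps)
      have R: "\<bar>A + B\<bar> powr p - \<bar>A\<bar> powr p - p * \<bar>A\<bar> powr (p - 2) * A * B =
          \<bar>A\<bar> powr p * (\<bar>1 + s\<bar> powr p - 1 - p * s)"
        unfolding 4 1 by (simp add: powr_mult algebra_simps)
      have E: "B\<^sup>2 * (\<bar>A\<bar> + \<bar>B\<bar>) powr (p - 2) = \<bar>A\<bar> powr p * (s\<^sup>2 * (1 + \<bar>s\<bar>) powr (p - 2))"
        unfolding 2 powr_mult using sq[of "\<bar>A\<bar>"] 3 s by (simp add: power_mult_distrib mult_ac)
      define e where "e = s\<^sup>2 * (1 + \<bar>s\<bar>) powr (p - 2)"
      have e: "0 \<le> e" by (simp add: e_def)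
      have "min c 1 * e \<le> c * e" "C * e \<le> max C 1 * e" using e by (auto intro!: mult_right_mono)
      then have "min c 1 * e \<le> \<bar>1 + s\<bar> powr p - 1 - p * s" "\<bar>1 + s\<bar> powr p - 1 - p * s \<le> max C 1 * e"
        using c(3)[OF s(1)] unfolding e_def by linarith+
      then have "\<bar>A\<bar> powr p * (min c 1 * e) \<le> \<bar>A\<bar> powr p * (\<bar>1 + s\<bar> powr p - 1 - p * s)"
        "\<bar>A\<bar> powr p * (\<bar>1 + s\<bar> powr p - 1 - p * s) \<le> \<bar>A\<bar> powr p * (max C 1 * e)"
        by (intro mult_left_mono; simp)+
      then show ?thesis unfolding R E e_def by (simp add: mult.left_commute)
    qed
  qed
  show thesis
    by (rule that[of "min c 1" "max C 1"]) (use c main in auto)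
qed

text \<open>The remainder with A = s and B = t - s is nonnegative. This is the supporting line
  needed for Jensen's inequality.\<close>

lemma abs_powr_tangent:
  fixes p s t :: real
  assumes "1 < p"
  shows "\<bar>s\<bar> powr p + p * \<bar>s\<bar> powr (p - 2) * s * (t - s) \<le> \<bar>t\<bar> powr p"
proof -
  obtain c C where "0 < c" "c \<le> C"
    and *: "\<And>A B. c * (B\<^sup>2 * (\<bar>A\<bar> + \<bar>B\<bar>) powr (p - 2)) \<le>
      \<bar>A + B\<bar> powr p - \<bar>A\<bar> powr p - p * \<bar>A\<bar> powr (p - 2) * A * B"
    by (rule convex_remainder_bounds[OF assms]) blast
  have "0 \<le> c * ((t-s)\<^sup>2 * (\<bar>s\<bar> + \<bar>t-s\<bar>) powr (p - 2))" using \<open>0 < c\<close> by simp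
  with *[where A=s and B="t-s"] show ?thesis by simp
qed

subsection \<open>Mollifiers on the line\<close>

text \<open>The classical flat function exp(-1/t), multiplied by a polynomial in 1/t so that the
  family is closed under differentiation.\<close>

definition exp_inverse :: "real poly \<Rightarrow> real \<Rightarrow> real" where
  "exp_inverse P t = (if 0 < t then poly P (1 / t) * exp (- (1 / t)) else 0)"

lemma tendsto_poly_times_exp_minus: "((\<lambda>x::real. poly P x * exp (- x)) \<longlongrightarrow> 0) at_top"
proof -
  have "((\<lambda>x::real. \<Sum>i\<le>degree P. coeff P i * (x ^ i / exp x)) \<longlongrightarrow> (\<Sum>i\<le>degree P. coeff P i * 0)) at_top"
    by (intro tendsto_intros tendsto_power_div_exp_0)
  then show ?thesis by (simp add: poly_altdef exp_minus field_simps sum_divide_distrib)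
qed

text \<open>Differentiating P(1/t) exp(-1/t) produces t^(-2) (P - P')(1/t) exp(-1/t), and
  \<open>monom 1 2\<close> is the factor t^(-2). At 0 the exponential beats every polynomial in
  1/t.\<close>

lemma has_real_derivative_exp_inverse:
  "(exp_inverse P has_real_derivative exp_inverse (monom 1 2 * (P - pderiv P)) t) (at t)"
proof -
  consider "0 < t" | "t < 0" | "t = 0" by linarith
  then show ?thesis
  proof cases
    case 1
    have "((\<lambda>t. poly P (1 / t) * exp (- (1 / t))) has_real_derivative
        exp_inverse (monom 1 2 * (P - pderiv P)) t) (at t)"
      using 1 by (auto intro!: derivative_eq_intros simp: exp_inverse_def poly_monom power2_eq_square field_simps)
    then show ?thesis
      by (rule has_field_derivative_transform_within_open[of _ _ _ "{0<..}"])
        (use 1 in \<open>auto simp: exp_inverse_def\<close>)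
  next
    case 2
    show ?thesis
      by (rule has_field_derivative_transform_within_open[of "\<lambda>_. 0" _ _ "{..<0}"])
        (use 2 in \<open>auto simp: exp_inverse_def\<close>)
  next
    case 3
    have "((\<lambda>h. exp_inverse P h / h) \<longlongrightarrow> 0) (at_right 0)"
    proof -
      have "((\<lambda>h. poly (monom 1 1 * P) (inverse h) * exp (- inverse h)) \<longlongrightarrow> 0) (at_right (0::real))"
        by (rule filterlim_compose[OF tendsto_poly_times_exp_minus filterlim_inverse_at_top_right])
      moreover have "\<forall>\<^sub>F h in at_right (0::real).
          poly (monom 1 1 * P) (inverse h) * exp (- inverse h) = exp_inverse P h / h"
        by (auto simp: eventually_at_filter exp_inverse_def poly_monom field_simps)
      ultimately show ?thesis by (rule Lim_transform_eventually)
    qed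
    moreover have "((\<lambda>h. exp_inverse P h / h) \<longlongrightarrow> 0) (at_left 0)"
    proof (rule Lim_transform_eventually[OF tendsto_const])
      show "\<forall>\<^sub>F h in at_left (0::real). 0 = exp_inverse P h / h"
        by (auto simp: eventually_at_filter exp_inverse_def)
    qed
    ultimately have "((\<lambda>h. exp_inverse P h / h) \<longlongrightarrow> 0) (at 0)"
      by (intro filterlim_split_at)
    then show ?thesis using 3
      by (simp add: has_field_derivative_iff exp_inverse_def)
  qed
qed

text \<open>The derivatives are only asserted to exist, so closure under sums, products and affine
  substitutions is a plain induction in which no higher derivative has to be computed.\<close>

primrec differentiable_times :: "nat \<Rightarrow> (real \<Rightarrow> real) \<Rightarrow> bool" where
  "differentiable_times 0 f = True"
| "differentiable_times (Suc k) f =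
    (\<exists>f'. (\<forall>t. (f has_real_derivative f' t) (at t)) \<and> differentiable_times k f')"

lemma differentiable_times_Suc: "differentiable_times (Suc k) f \<Longrightarrow> differentiable_times k f"
proof (induction k arbitrary: f)
  case (Suc k)
  then obtain f' where "\<forall>t. (f has_real_derivative f' t) (at t)" "differentiable_times (Suc k) f'"
    by auto
  then have "\<forall>t. (f has_real_derivative f' t) (at t)" "differentiable_times k f'"
    using Suc.IH by blast+
  then show ?case by auto
qed simp

lemma differentiable_times_add:
  "differentiable_times k f \<Longrightarrow> differentiable_times k g \<Longrightarrow> differentiable_times k (\<lambda>t. f t + g t)"
proof (induction k arbitrary: f g)
  case (Suc k)
  then obtain f' g' where f': "\<And>t. (f has_real_derivative f' t) (at t)" "differentiable_times k f'"
    and g': "\<And>t. (g has_real_derivative g' t) (at t)" "differentiable_times k g'" by auto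
  have "((\<lambda>t. f t + g t) has_real_derivative f' t + g' t) (at t)" for t
    using f' g' by (auto intro: DERIV_add)
  moreover have "differentiable_times k (\<lambda>t. f' t + g' t)" using Suc.IH f' g' by auto
  ultimately show ?case by (auto intro!: exI[of _ "\<lambda>t. f' t + g' t"])
qed simp

lemma differentiable_times_mult:
  "differentiable_times k f \<Longrightarrow> differentiable_times k g \<Longrightarrow> differentiable_times k (\<lambda>t. f t * g t)"
proof (induction k arbitrary: f g)
  case (Suc k)
  then obtain f' g' where f': "\<And>t. (f has_real_derivative f' t) (at t)" "differentiable_times k f'"
    and g': "\<And>t. (g has_real_derivative g' t) (at t)" "differentiable_times k g'" by auto
  have "((\<lambda>t. f t * g t) has_real_derivative f' t * g t + g' t * f t) (at t)" for t
    using f' g' by (auto intro: DERIV_mult)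
  moreover have "differentiable_times k (\<lambda>t. f' t * g t + g' t * f t)"
    using f' g' differentiable_times_Suc[OF Suc.prems(1)] differentiable_times_Suc[OF Suc.prems(2)]
    by (intro differentiable_times_add Suc.IH) auto
  ultimately show ?case by (auto intro!: exI[of _ "\<lambda>t. f' t * g t + g' t * f t"])
qed simp

lemma differentiable_times_affine:
  "differentiable_times k f \<Longrightarrow> differentiable_times k (\<lambda>t. d * f (b + c * t))"
proof (induction k arbitrary: f d)
  case (Suc k)
  then obtain f' where f': "\<And>t. (f has_real_derivative f' t) (at t)" "differentiable_times k f'" by auto
  have "((\<lambda>t. d * f (b + c * t)) has_real_derivative (d * c) * f' (b + c * t)) (at t)" for t
    by (auto intro!: derivative_eq_intros DERIV_chain'[OF _ f'(1)])
  then show ?case using Suc.IH[OF f'(2), of "d * c"] by (auto intro!: exI[of _ "\<lambda>t. (d * c) * f' (b + c * t)"])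
qed simp

lemma differentiable_times_exp_inverse: "differentiable_times k (exp_inverse P)"
  using has_real_derivative_exp_inverse by (induction k arbitrary: P) auto

text \<open>Uniqueness of derivatives identifies the anonymous witnesses with the concrete sequence
  \<open>deriv ^^ m\<close>, which a mollifier has to list.\<close>

lemma iterated_deriv:
  assumes "\<And>k. differentiable_times k f"
  shows "((deriv ^^ m) f has_real_derivative (deriv ^^ Suc m) f t) (at t)"
proof -
  have "\<forall>k. differentiable_times k ((deriv ^^ m) f)"
  proof (induction m)
    case (Suc m)
    show ?case
    proof
      fix k
      have "differentiable_times (Suc k) ((deriv ^^ m) f)" using Suc by blast
      then obtain f' where f': "\<forall>t. ((deriv ^^ m) f has_real_derivative f' t) (at t)" "differentiable_times k f'"
        by auto
      then have "deriv ((deriv ^^ m) f) = f'" by (auto intro: DERIV_imp_deriv)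
      then show "differentiable_times k ((deriv ^^ Suc m) f)" using f' by simp
    qed
  qed (use assms in simp)
  then have "differentiable_times (Suc 0) ((deriv ^^ m) f)" by blast
  then obtain f' where f': "\<forall>t. ((deriv ^^ m) f has_real_derivative f' t) (at t)" by auto
  then have "deriv ((deriv ^^ m) f) = f'" by (auto intro: DERIV_imp_deriv)
  then show ?thesis using f' by simp
qed

text \<open>The sequence \<open>g\<close> lists a function on the line together with all its derivatives.\<close>

definition mollifier :: "real \<Rightarrow> (nat \<Rightarrow> real \<Rightarrow> real) \<Rightarrow> bool" where
  "mollifier \<epsilon> g \<longleftrightarrow> (\<forall>m t. (g m has_real_derivative g (Suc m) t) (at t)) \<and>
     (\<forall>t. 0 \<le> g 0 t) \<and> (\<forall>t. g 0 (- t) = g 0 t) \<and> (\<forall>m t. \<epsilon> \<le> \<bar>t\<bar> \<longrightarrow> g m t = 0) \<and>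
     (LBINT t. g 0 t) = 1"

lemma integrable_continuous_compact_support:
  fixes f :: "real \<Rightarrow> real"
  assumes "continuous_on UNIV f" "\<And>t. \<epsilon> \<le> \<bar>t\<bar> \<Longrightarrow> f t = 0"
  shows "integrable lborel f"
proof -
  have "f = (\<lambda>t. indicator {-\<epsilon>..\<epsilon>} t *\<^sub>R f t)"
  proof
    fix t
    show "f t = indicator {-\<epsilon>..\<epsilon>} t *\<^sub>R f t"
      using assms(2)[of t] by (cases "t \<in> {-\<epsilon>..\<epsilon>}") auto
  qed
  moreover have "set_integrable lborel {-\<epsilon>..\<epsilon>} f"
    by (intro borel_integrable_atLeastAtMost' continuous_on_subset[OF assms(1)]) auto
  ultimately show ?thesis unfolding set_integrable_def by simp
qed

lemma mollifier_exists:
  assumes "0 < \<epsilon>"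
  shows "\<exists>g. mollifier \<epsilon> g"
proof -
  define b where "b t = exp_inverse 1 (1 + t) * exp_inverse 1 (1 - t)" for t
  have b0: "0 \<le> b t" "b (- t) = b t" for t by (auto simp: b_def exp_inverse_def)
  have bz: "b t = 0" if "1 \<le> \<bar>t\<bar>" for t using that by (auto simp: b_def exp_inverse_def)
  have db: "differentiable_times k b" for k
    unfolding b_def
    using differentiable_times_affine[OF differentiable_times_exp_inverse, of k 1 1 1 1]
      differentiable_times_affine[OF differentiable_times_exp_inverse, of k 1 1 1 "-1"]
    by (intro differentiable_times_mult) auto
  have cb: "continuous_on UNIV b"
  proof -
    obtain b' where "\<forall>t. (b has_real_derivative b' t) (at t)" using db[of "Suc 0"] by auto
    then show ?thesis by (intro continuous_at_imp_continuous_on ballI DERIV_isCont) auto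
  qed
  have ib: "integrable lborel b" by (rule integrable_continuous_compact_support[OF cb bz])
  define I where "I = (LBINT t. b t)"
  have "0 < I"
  proof -
    \<comment> \<open>For |t| \<le> 1/2 both 1 + t and 1 - t are at least 1/2, so \<open>b\<close>
      stays above a positive constant on an interval of length 1. This makes the normalising
      integral positive.\<close>
    have e: "exp (-2) \<le> exp_inverse 1 s" if "1/2 \<le> s" for s
      using that by (auto simp: exp_inverse_def field_simps)
    have "(LBINT t. indicator {-1/2..1/2::real} t * (exp (-2) * exp (-2))) \<le> I"
      unfolding I_def
    proof (rule integral_mono)
      fix t :: real
      show "indicator {-1/2..1/2} t * (exp (-2) * exp (-2)) \<le> b t"
      proof (cases "t \<in> {-1/2..1/2}")
        case True
        then have "exp (-2) * exp (-2) \<le> b t"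
          unfolding b_def by (intro mult_mono e) (auto simp: exp_inverse_def)
        then show ?thesis using True by simp
      qed (use b0 in simp)
    qed (use ib in auto)
    moreover have "(LBINT t. indicator {-1/2..1/2::real} t * (exp (-2) * exp (-2))) = exp (-2) * exp (-2 :: real)"
      by simp
    moreover have "0 < exp (-2) * exp (-2 :: real)" by simp
    ultimately show ?thesis by linarith
  qed
  \<comment> \<open>Shrinking the support to \<epsilon> / 2 instead of \<epsilon> makes every t with
    |t| \<ge> \<epsilon> an interior point of the zero set, so that all derivatives vanish there as
    well. The factor 2 / (\<epsilon> I) normalises the integral.\<close>
  define r where "r t = (2 / (\<epsilon> * I)) * b (0 + (2 / \<epsilon>) * t)" for t
  define g where "g m = (deriv ^^ m) r" for m
  have dr: "differentiable_times k r" for k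
    unfolding r_def by (rule differentiable_times_affine[OF db])
  have dg: "(g m has_real_derivative g (Suc m) t) (at t)" for m t
    unfolding g_def by (rule iterated_deriv[OF dr])
  have gz: "g m t = 0" if "\<epsilon> / 2 < \<bar>t\<bar>" for m t
    using that
  proof (induction m arbitrary: t)
    case 0
    then have "1 \<le> \<bar>2 / \<epsilon> * t\<bar>" using assms by (auto simp: abs_mult field_simps)
    then show ?case using bz by (simp add: g_def r_def)
  next
    case (Suc m)
    have "open {t::real. \<epsilon> / 2 < \<bar>t\<bar>}" by (intro open_Collect_less continuous_intros)
    then have "(g m has_real_derivative 0) (at t)"
      by (rule has_field_derivative_transform_within_open[OF DERIV_const]) (use Suc in auto)
    then show ?case by (rule DERIV_unique[OF dg])
  qed
  have "(LBINT t. g 0 t) = 1"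
  proof -
    have "I = \<bar>2 / \<epsilon>\<bar> *\<^sub>R (LBINT t. b (0 + (2 / \<epsilon>) * t))"
      unfolding I_def using assms by (intro lborel_integral_real_affine) auto
    then have "I = 2 / \<epsilon> * (LBINT t. b (0 + (2 / \<epsilon>) * t))" using assms by simp
    moreover have "(LBINT t. g 0 t) = 2 / \<epsilon> * (LBINT t. b (0 + (2 / \<epsilon>) * t)) / I"
      by (simp add: g_def r_def)
    ultimately show ?thesis using \<open>0 < I\<close> by (metis divide_self less_irrefl)
  qed
  then have "mollifier \<epsilon> g"
    unfolding mollifier_def
  proof (intro conjI allI impI)
    fix t
    show "0 \<le> g 0 t" using assms \<open>0 < I\<close> b0(1) by (simp add: g_def r_def)
    show "g 0 (- t) = g 0 t" using b0(2)[of "2 / \<epsilon> * t"] by (simp add: g_def r_def)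
  next
    fix m t assume "\<epsilon> \<le> \<bar>t\<bar>"
    then show "g m t = 0" using assms by (intro gz) linarith
  qed (rule dg)
  then show ?thesis by (intro exI[of _ g])
qed

definition moll_ker :: "nat \<Rightarrow> nat \<Rightarrow> real \<Rightarrow> real" where
  "moll_ker k = (SOME g. mollifier (1 / (real k + 1)) g)"

lemma mollifier_moll_ker: "mollifier (1 / (real k + 1)) (moll_ker k)"
  unfolding moll_ker_def by (rule someI_ex[OF mollifier_exists]) simp

lemma
  shows moll_ker_deriv: "(moll_ker k m has_real_derivative moll_ker k (Suc m) t) (at t)"
    and moll_ker_nonneg: "0 \<le> moll_ker k 0 t"
    and moll_ker_even: "moll_ker k 0 (- t) = moll_ker k 0 t"
    and moll_ker_zero: "1 / (real k + 1) \<le> \<bar>t\<bar> \<Longrightarrow> moll_ker k m t = 0"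
    and moll_ker_integral: "(LBINT t. moll_ker k 0 t) = 1"
  using mollifier_moll_ker unfolding mollifier_def by blast+

lemma moll_ker_continuous: "continuous_on UNIV (moll_ker k m)"
  by (intro continuous_at_imp_continuous_on ballI DERIV_isCont[OF moll_ker_deriv])

lemma moll_ker_measurable [measurable]: "moll_ker k m \<in> borel_measurable borel"
  by (rule borel_measurable_continuous_onI[OF moll_ker_continuous])

lemma moll_ker_integrable: "integrable lborel (moll_ker k m)"
  by (rule integrable_continuous_compact_support[OF moll_ker_continuous moll_ker_zero])

lemma moll_ker_odd: "moll_ker k 1 (- t) = - moll_ker k 1 t"
proof -
  have "((\<lambda>t. moll_ker k 0 (- t)) has_real_derivative moll_ker k 1 (- t) * (-1)) (at t)"
    using moll_ker_deriv[of k 0 "- t"] by (intro DERIV_chain2[where g="\<lambda>t. - t"]) (auto intro!: derivative_eq_intros)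
  then have "(moll_ker k 0 has_real_derivative - moll_ker k 1 (- t)) (at t)"
    by (simp add: moll_ker_even)
  then have "- moll_ker k 1 (- t) = moll_ker k 1 t"
    using DERIV_unique[OF _ moll_ker_deriv[of k 0 t]] by simp
  then show ?thesis by simp
qed

lemma moll_ker_bounded: obtains B where "0 \<le> B" "\<And>t. \<bar>moll_ker k m t\<bar> \<le> B"
proof -
  have "compact (moll_ker k m ` {-1..1})"
    by (intro compact_continuous_image continuous_on_subset[OF moll_ker_continuous]) auto
  then have "bounded (moll_ker k m ` {-1..1})" by (rule compact_imp_bounded)
  then obtain B where B: "\<forall>x\<in>{-1..1}. \<bar>moll_ker k m x\<bar> \<le> B"
    unfolding bounded_iff by auto
  have "0 \<le> B" using bspec[OF B, of 0] by auto
  have "\<bar>moll_ker k m t\<bar> \<le> B" for t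
  proof (cases "t \<in> {-1..1}")
    case False
    then have "1 < \<bar>t\<bar>" by auto
    moreover have "1 / (real k + 1) \<le> 1" by simp
    ultimately have "moll_ker k m t = 0" by (intro moll_ker_zero) linarith
    then show ?thesis using \<open>0 \<le> B\<close> by simp
  qed (use B in auto)
  then show thesis using \<open>0 \<le> B\<close> that by blast
qed

subsection \<open>Cubes, compact sets and Lebesgue measure\<close>

abbreviation PL :: "nat \<Rightarrow> point measure" where
  "PL n \<equiv> \<Pi>\<^sub>M i\<in>{..<n}. (lborel :: real measure)"

text \<open>Cubes take the place of Euclidean balls: as products of intervals they fit the product
  topology, the product measure and the supports of product kernels.\<close>

definition ccube :: "nat \<Rightarrow> point \<Rightarrow> real \<Rightarrow> point set" where
  "ccube n x r = (\<Pi>\<^sub>E i\<in>{..<n}. {x i - r..x i + r})"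

definition ocube :: "nat \<Rightarrow> point \<Rightarrow> real \<Rightarrow> point set" where
  "ocube n x r = (\<Pi>\<^sub>E i\<in>{..<n}. {x i - r<..<x i + r})"

lemma space_leb: "space (leb n) = topspace (Rn n)"
  by (simp add: leb_def space_PiM)

lemma space_PL: "space (PL n) = topspace (Rn n)"
  by (simp add: space_PiM)

lemma sets_PL_leb: "A \<in> sets (PL n) \<Longrightarrow> A \<in> sets (leb n)"
  by (simp add: leb_def)

lemma mem_ccube: "y \<in> ccube n x r \<longleftrightarrow> y \<in> topspace (Rn n) \<and> (\<forall>i<n. \<bar>y i - x i\<bar> \<le> r)"
  by (auto simp: ccube_def PiE_iff abs_diff_le_iff)

lemma mem_ocube: "y \<in> ocube n x r \<longleftrightarrow> y \<in> topspace (Rn n) \<and> (\<forall>i<n. \<bar>y i - x i\<bar> < r)"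
  by (auto simp: ocube_def PiE_iff abs_diff_less_iff)

lemma ccube_subset_topspace: "ccube n x r \<subseteq> topspace (Rn n)"
  by (auto simp: mem_ccube simp del: topspace_product_topology)

lemma centre_mem_cube: "x \<in> topspace (Rn n) \<Longrightarrow> 0 < r \<Longrightarrow> x \<in> ccube n x r \<and> x \<in> ocube n x r"
  by (simp add: mem_ccube mem_ocube del: topspace_product_topology)

lemma ocube_subset_ccube: "ocube n x r \<subseteq> ccube n x r"
  by (auto simp: mem_ccube mem_ocube less_imp_le simp del: topspace_product_topology)

lemma ccube_mono: "r \<le> s \<Longrightarrow> ccube n x r \<subseteq> ccube n x s"
  by (auto simp: mem_ccube simp del: topspace_product_topology) (meson order_trans)

lemma ccube_subset_ocube: "r < s \<Longrightarrow> ccube n x r \<subseteq> ocube n x s"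
  by (auto simp: mem_ccube mem_ocube simp del: topspace_product_topology) (meson le_less_trans)

lemma ccube_sym: "y \<in> ccube n x r \<Longrightarrow> x \<in> topspace (Rn n) \<Longrightarrow> x \<in> ccube n y r"
  by (simp add: mem_ccube abs_minus_commute del: topspace_product_topology)

lemma ccube_triangle: "y \<in> ccube n x r \<Longrightarrow> ccube n y s \<subseteq> ccube n x (r + s)"
proof
  fix z assume y: "y \<in> ccube n x r" and z: "z \<in> ccube n y s"
  have "\<bar>z i - x i\<bar> \<le> r + s" if "i < n" for i
  proof -
    have "\<bar>y i - x i\<bar> \<le> r" "\<bar>z i - y i\<bar> \<le> s" using y z that by (simp_all add: mem_ccube)
    then show ?thesis by linarith
  qed
  then show "z \<in> ccube n x (r + s)" using z by (simp add: mem_ccube)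
qed

lemma openin_ocube: "openin (Rn n) (ocube n x r)"
  unfolding ocube_def by (auto simp: openin_PiE_gen intro!: openin_PiE)

lemma compactin_ccube: "compactin (Rn n) (ccube n x r)"
  unfolding ccube_def by (auto simp: compactin_PiE)

lemma connectedin_ocube: "connectedin (Rn n) (ocube n x r)"
  unfolding ocube_def by (auto simp: connectedin_PiE)

lemma openin_contains_ccube:
  assumes "openin (Rn n) U" "x \<in> U"
  obtains r where "0 < r" "ccube n x r \<subseteq> U"
proof -
  have x: "x \<in> topspace (Rn n)" using openin_subset[OF assms(1)] assms(2) by blast
  obtain V where V: "\<And>i. i < n \<Longrightarrow> open (V i)" "x \<in> PiE {..<n} V" "PiE {..<n} V \<subseteq> U"
  proof -
    have "\<exists>V. (\<forall>i\<in>{..<n}. open (V i)) \<and> x \<in> PiE {..<n} V \<and> PiE {..<n} V \<subseteq> U"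
      using assms unfolding openin_product_topology_alt by auto
    then show thesis using that by auto
  qed
  have "\<exists>r>0. \<forall>t. \<bar>t - x i\<bar> \<le> r \<longrightarrow> t \<in> V i" if i: "i < n" for i
  proof -
    have "x i \<in> V i" using V(2) i by (auto simp: PiE_iff)
    then obtain e where "0 < e" "cball (x i) e \<subseteq> V i" using V(1)[OF i] open_contains_cball by blast
    then show ?thesis by (intro exI[of _ e]) (auto simp: subset_iff dist_real_def abs_minus_commute)
  qed
  then obtain r where r: "\<And>i. i < n \<Longrightarrow> 0 < r i" "\<And>i t. i < n \<Longrightarrow> \<bar>t - x i\<bar> \<le> r i \<Longrightarrow> t \<in> V i"
    by metis
  define e where "e = Min (insert 1 (r ` {..<n}))"
  have e: "0 < e" "\<And>i. i < n \<Longrightarrow> e \<le> r i"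
    using r(1) by (auto simp: e_def)
  show thesis
  proof
    show "0 < e" by fact
    have "ccube n x e \<subseteq> PiE {..<n} V"
    proof
      fix y assume y: "y \<in> ccube n x e"
      have "y i \<in> V i" if "i < n" for i
        using y e(2)[OF that] that by (intro r(2)) (auto simp: mem_ccube intro: order_trans)
      then show "y \<in> PiE {..<n} V" using y by (simp add: mem_ccube PiE_iff)
    qed
    then show "ccube n x e \<subseteq> U" using V(3) by blast
  qed
qed

text \<open>A Lebesgue number argument: cubes of half the given size cover \<open>K\<close>, and a
  finite subcover leaves room for one common \<epsilon>. It turns bounds known near each point into
  bounds on all of \<open>K\<close>.\<close>

lemma finite_ccube_cover:
  assumes K: "compactin (Rn n) K" and r: "\<And>x. x \<in> K \<Longrightarrow> 0 < r x"
  obtains S \<epsilon> where "finite S" "S \<subseteq> K" "0 < \<epsilon>"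
    "\<And>y. y \<in> K \<Longrightarrow> \<exists>x\<in>S. ccube n y \<epsilon> \<subseteq> ccube n x (r x)"
proof -
  have Ks: "K \<subseteq> topspace (Rn n)" using K compactin_subset_topspace by blast
  let ?C = "(\<lambda>x. ocube n x (r x / 2)) ` K"
  have "K \<subseteq> \<Union> ?C"
  proof
    fix x assume "x \<in> K"
    then have "x \<in> ocube n x (r x / 2)" using centre_mem_cube[of x n "r x / 2"] r Ks by auto
    then show "x \<in> \<Union> ?C" using \<open>x \<in> K\<close> by blast
  qed
  then have "\<exists>\<F>. finite \<F> \<and> \<F> \<subseteq> ?C \<and> K \<subseteq> \<Union> \<F>"
    using openin_ocube by (intro compactinD[OF K]) auto
  then obtain \<F> where \<F>: "finite \<F>" "\<F> \<subseteq> ?C" "K \<subseteq> \<Union> \<F>" by blast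
  obtain S where S: "finite S" "S \<subseteq> K" "K \<subseteq> (\<Union>x\<in>S. ocube n x (r x / 2))"
    using finite_subset_image[OF \<F>(1,2)] \<F>(3) by auto
  define e where "e = Min (insert 1 ((\<lambda>x. r x / 2) ` S))"
  have e: "0 < e" using S(1,2) r by (auto simp: e_def)
  have er: "e \<le> r x / 2" if "x \<in> S" for x
    unfolding e_def using S(1) that by (intro Min_le) auto
  show thesis
  proof (rule that[OF S(1,2) e])
    fix y assume "y \<in> K"
    then obtain x where x: "x \<in> S" "y \<in> ocube n x (r x / 2)" using S(3) by blast
    then have "ccube n y e \<subseteq> ccube n x (r x / 2 + e)"
      using ccube_triangle ocube_subset_ccube by blast
    also have "\<dots> \<subseteq> ccube n x (r x)" using er[OF x(1)] by (intro ccube_mono) simp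
    finally show "\<exists>x\<in>S. ccube n y e \<subseteq> ccube n x (r x)" using x(1) by blast
  qed
qed

text \<open>This is the room for mollification: with kernels narrower than \<epsilon>, values of a
  convolution on \<open>K\<close> depend on the function on \<open>L\<close> only.\<close>

lemma compact_neighbourhood:
  assumes K: "compactin (Rn n) K" and U: "openin (Rn n) U" "K \<subseteq> U"
  obtains L \<epsilon> where "compactin (Rn n) L" "L \<subseteq> U" "0 < \<epsilon>" "\<And>y. y \<in> K \<Longrightarrow> ccube n y \<epsilon> \<subseteq> L"
proof -
  have "\<exists>r>0. ccube n x r \<subseteq> U" if "x \<in> K" for x
    using openin_contains_ccube[OF U(1)] U(2) that by blast
  then obtain r where r: "\<And>x. x \<in> K \<Longrightarrow> 0 < r x" "\<And>x. x \<in> K \<Longrightarrow> ccube n x (r x) \<subseteq> U" by metis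
  obtain S \<epsilon> where S: "finite S" "S \<subseteq> K" "0 < \<epsilon>"
    "\<And>y. y \<in> K \<Longrightarrow> \<exists>x\<in>S. ccube n y \<epsilon> \<subseteq> ccube n x (r x)"
    by (rule finite_ccube_cover[OF K, of r]) (use r(1) in auto)
  show thesis
  proof (rule that[of "\<Union>x\<in>S. ccube n x (r x)" \<epsilon>])
    show "compactin (Rn n) (\<Union>x\<in>S. ccube n x (r x))"
      using S(1) compactin_ccube by (intro compactin_Union) auto
    show "(\<Union>x\<in>S. ccube n x (r x)) \<subseteq> U" using S(2) r(2) by blast
    show "0 < \<epsilon>" by fact
    fix y assume "y \<in> K"
    then show "ccube n y \<epsilon> \<subseteq> (\<Union>x\<in>S. ccube n x (r x))" using S(4) by blast
  qed
qed

lemma compact_subset_ccube: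
  assumes K: "compactin (Rn n) K"
  obtains R where "0 < R" "K \<subseteq> ccube n (\<lambda>_. 0) R"
proof -
  obtain S \<epsilon> where S: "finite S" "S \<subseteq> K" "0 < \<epsilon>"
    "\<And>y. y \<in> K \<Longrightarrow> \<exists>x\<in>S. ccube n y \<epsilon> \<subseteq> ccube n x 1"
    by (rule finite_ccube_cover[OF K, of "\<lambda>_. 1"]) auto
  define R where "R = (\<Sum>x\<in>S. \<Sum>i<n. \<bar>x i\<bar>) + 1"
  have "\<bar>y i\<bar> \<le> R" if y: "y \<in> K" and i: "i < n" for y i
  proof -
    obtain x where x: "x \<in> S" "ccube n y \<epsilon> \<subseteq> ccube n x 1" using S(4)[OF y] by blast
    have "y \<in> ccube n y \<epsilon>"
      using centre_mem_cube S(3) compactin_subset_topspace[OF K] y by blast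
    then have "y \<in> ccube n x 1" using x(2) by blast
    then have "\<bar>y i - x i\<bar> \<le> 1" using i by (simp add: mem_ccube)
    moreover have "\<bar>x i\<bar> \<le> (\<Sum>i<n. \<bar>x i\<bar>)" using i by (intro member_le_sum) auto
    moreover have "(\<Sum>i<n. \<bar>x i\<bar>) \<le> (\<Sum>x\<in>S. \<Sum>i<n. \<bar>x i\<bar>)"
      using x(1) S(1) by (intro member_le_sum[of x S "\<lambda>x. \<Sum>i<n. \<bar>x i\<bar>"]) (auto intro: sum_nonneg)
    ultimately show ?thesis unfolding R_def by linarith
  qed
  then have "K \<subseteq> ccube n (\<lambda>_. 0) R"
    using compactin_subset_topspace[OF K] by (auto simp: mem_ccube simp del: topspace_product_topology)
  moreover have "0 < R" unfolding R_def by (intro add_nonneg_pos sum_nonneg) auto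
  ultimately show thesis using that by blast
qed

lemma ccube_sets: "ccube n x r \<in> sets (PL n)"
  unfolding ccube_def by (intro sets_PiM_I_finite) auto

text \<open>Cubes with rational centres and radii 1 / (m + 1) are countably many. The exhaustion
  serves twice: open sets become measurable for the product measure, and null set statements pass
  from compact sets to \<Omega>.\<close>

lemma open_countable_compact_union:
  assumes U: "openin (Rn n) U"
  obtains K :: "nat \<Rightarrow> point set" where "\<And>m. compactin (Rn n) (K m)" "\<And>m. K m \<subseteq> U"
    "\<And>m. K m \<in> sets (PL n)" "U = (\<Union>m. K m)"
proof -
  \<comment> \<open>The empty set is added so that the family can be enumerated even when
    \<open>U\<close> is empty.\<close>
  define \<F> where "\<F> = insert {} ((\<lambda>(c, m::nat). ccube n c (1 / (real m + 1))) `
    {(c, m). c \<in> (\<Pi>\<^sub>E i\<in>{..<n}. \<rat>) \<and> ccube n c (1 / (real m + 1)) \<subseteq> U})"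
  have "countable ((\<Pi>\<^sub>E i\<in>{..<n}. \<rat>) \<times> (UNIV :: nat set) :: (point \<times> nat) set)"
    by (intro countable_SIGMA countable_PiE countable_rat) auto
  then have "countable {(c::point, m::nat). c \<in> (\<Pi>\<^sub>E i\<in>{..<n}. \<rat>) \<and> ccube n c (1 / (real m + 1)) \<subseteq> U}"
    by (rule countable_subset[rotated]) auto
  then have \<F>: "countable \<F>" "\<F> \<noteq> {}" unfolding \<F>_def by auto
  have mem: "compactin (Rn n) A \<and> A \<subseteq> U \<and> A \<in> sets (PL n)" if "A \<in> \<F>" for A
    using that unfolding \<F>_def by (auto simp: compactin_ccube ccube_sets)
  have "U \<subseteq> \<Union> \<F>"
  proof
    fix x assume x: "x \<in> U"
    then have xt: "x \<in> topspace (Rn n)" using openin_subset[OF U] by blast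
    obtain r where r: "0 < r" "ccube n x r \<subseteq> U" using openin_contains_ccube[OF U x] .
    obtain m :: nat where m: "1 / (real m + 1) < r / 2"
      using reals_Archimedean[of "r/2"] r(1) by (auto simp: inverse_eq_divide add.commute)
    have "\<exists>q\<in>\<rat>. \<bar>x i - q\<bar> \<le> 1 / (real m + 1)" for i
    proof -
      obtain q where "q \<in> \<rat>" "x i < q" "q < x i + 1 / (real m + 1)"
        using Rats_dense_in_real[of "x i" "x i + 1 / (real m + 1)"] by auto
      then show ?thesis by (intro bexI[of _ q]) auto
    qed
    then obtain q where q: "\<And>i. q i \<in> \<rat>" "\<And>i. \<bar>x i - q i\<bar> \<le> 1 / (real m + 1)" by metis
    define c where "c = restrict q {..<n}"
    have xc: "x \<in> ccube n c (1 / (real m + 1))" and ct: "c \<in> topspace (Rn n)"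
      using q xt by (auto simp: mem_ccube c_def)
    have "ccube n c (1 / (real m + 1)) \<subseteq> ccube n x (1 / (real m + 1) + 1 / (real m + 1))"
      using ccube_triangle[OF ccube_sym[OF xc ct]] .
    also have "\<dots> \<subseteq> ccube n x r" using m by (intro ccube_mono) simp
    finally have "ccube n c (1 / (real m + 1)) \<subseteq> U" using r by blast
    moreover have "c \<in> (\<Pi>\<^sub>E i\<in>{..<n}. \<rat>)" using q by (auto simp: c_def)
    ultimately have "ccube n c (1 / (real m + 1)) \<in> \<F>" unfolding \<F>_def by auto
    then show "x \<in> \<Union> \<F>" using xc by blast
  qed
  moreover have "\<Union> \<F> \<subseteq> U" using mem by (intro Union_least) simp
  ultimately have "U = (\<Union>m. from_nat_into \<F> m)"
    unfolding range_from_nat_into[OF \<F>(2,1)] by (rule subset_antisym)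
  then show thesis
    using mem[OF from_nat_into[OF \<F>(2)]] by (intro that[of "from_nat_into \<F>"]) simp_all
qed

lemma openin_sets: "openin (Rn n) U \<Longrightarrow> U \<in> sets (PL n)"
  by (rule open_countable_compact_union[of n U]) auto

lemma compactin_sets:
  assumes "compactin (Rn n) K"
  shows "K \<in> sets (PL n)"
proof -
  have "Hausdorff_space (Rn n)" by (simp add: Hausdorff_space_product_topology)
  then have "closedin (Rn n) K" using assms compactin_imp_closedin by blast
  then have "topspace (Rn n) - K \<in> sets (PL n)" by (intro openin_sets) blast
  then have "space (PL n) - (space (PL n) - K) \<in> sets (PL n)"
    unfolding space_PL[symmetric] by (rule sets.compl_sets)
  moreover have "space (PL n) - (space (PL n) - K) = K"
    using compactin_subset_topspace[OF assms] unfolding space_PL by blast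
  ultimately show ?thesis by simp
qed

section \<open>Lebesgue measure of cubes and compact sets\<close>

interpretation lborel_product: product_sigma_finite "\<lambda>_::nat. lborel :: real measure"
  by standard

lemma sigma_finite_PL: "sigma_finite_measure (PL n)"
  by (intro lborel_product.sigma_finite) simp

lemma emeasure_ccube_finite: "emeasure (PL n) (ccube n x r) < \<infinity>"
  unfolding ccube_def
  by (subst lborel_product.emeasure_PiM) (auto simp: ennreal_prod_eq_top less_top[symmetric] emeasure_lborel_Icc_eq)

lemma emeasure_leb: "A \<in> sets (PL n) \<Longrightarrow> emeasure (leb n) A = emeasure (PL n) A"
  by (simp add: leb_def)

lemma emeasure_compact_finite:
  assumes "compactin (Rn n) K"
  shows "emeasure (leb n) K < \<infinity>"
proof -
  obtain R where "K \<subseteq> ccube n (\<lambda>_. 0) R" using compact_subset_ccube[OF assms] by blast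
  then have "emeasure (PL n) K \<le> emeasure (PL n) (ccube n (\<lambda>_. 0) R)"
    by (intro emeasure_mono ccube_sets)
  then show ?thesis using emeasure_ccube_finite[of n "\<lambda>_. 0" R] compactin_sets[OF assms]
    by (simp add: emeasure_leb)
qed

section \<open>Continuous functions on open sets\<close>

lemma C_on_preimage_open:
  assumes "f \<in> C_on n \<Omega>" "openin (Rn n) \<Omega>" "open S"
  shows "openin (Rn n) {x \<in> \<Omega>. f x \<in> S}"
proof -
  have "topspace (subtopology (Rn n) \<Omega>) = \<Omega>" using openin_subset[OF assms(2)] by auto
  then have "openin (subtopology (Rn n) \<Omega>) {x \<in> \<Omega>. f x \<in> S}"
    using assms(1,3) unfolding C_on_def continuous_map_def by fastforce
  then show ?thesis using assms(2) openin_open_subtopology by blast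
qed

lemma C_on_measurable:
  assumes "f \<in> C_on n \<Omega>" "openin (Rn n) \<Omega>"
  shows "f \<in> borel_measurable (restrict_space (PL n) \<Omega>)"
proof (rule borel_measurableI)
  fix S :: "real set" assume "open S"
  have sp: "space (restrict_space (PL n) \<Omega>) = \<Omega>"
    using openin_subset[OF assms(2)] by (auto simp: space_restrict_space space_PiM)
  have "f -` S \<inter> \<Omega> = {x \<in> \<Omega>. f x \<in> S}" by auto
  then have "f -` S \<inter> \<Omega> \<in> sets (PL n)"
    using openin_sets[OF C_on_preimage_open[OF assms \<open>open S\<close>]] by simp
  then show "f -` S \<inter> space (restrict_space (PL n) \<Omega>) \<in> sets (restrict_space (PL n) \<Omega>)"
    unfolding sp using openin_sets[OF assms(2)] sets.sets_into_space[OF openin_sets[OF assms(2)]]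
    by (subst sets_restrict_space_iff) (auto simp: inf.absorb1)
qed

lemma C_on_bounded_on_compact:
  assumes "f \<in> C_on n \<Omega>" "compactin (Rn n) K" "K \<subseteq> \<Omega>"
  obtains B where "0 \<le> B" "\<And>x. x \<in> K \<Longrightarrow> \<bar>f x\<bar> \<le> B"
proof -
  have "compactin (subtopology (Rn n) \<Omega>) K" using assms by (simp add: compactin_subtopology)
  then have "compact (f ` K)"
    using image_compactin assms(1) unfolding C_on_def by fastforce
  then have "bounded (f ` K)" by (rule compact_imp_bounded)
  then obtain B where B: "\<forall>x\<in>K. \<bar>f x\<bar> \<le> B" unfolding bounded_iff by auto
  show thesis by (rule that[of "max B 0"]) (use B in \<open>auto simp: le_max_iff_disj\<close>)
qed

text \<open>The second point may leave \<open>K\<close>, since mollifying at a point of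
  \<open>K\<close> samples the function on a whole cube around it. The cube is kept inside \<Omega>,
  where the values are meaningful.\<close>

lemma C_on_uniformly_continuous:
  assumes f: "f \<in> C_on n \<Omega>" and \<Omega>: "openin (Rn n) \<Omega>" and K: "compactin (Rn n) K" "K \<subseteq> \<Omega>" and e: "0 < e"
  obtains \<epsilon> where "0 < \<epsilon>"
    "\<And>x y. x \<in> K \<Longrightarrow> y \<in> ccube n x \<epsilon> \<Longrightarrow> y \<in> \<Omega> \<and> \<bar>f y - f x\<bar> < e"
proof -
  have "\<exists>r>0. ccube n x r \<subseteq> {y \<in> \<Omega>. f y \<in> ball (f x) (e/2)}" if "x \<in> K" for x
    by (rule openin_contains_ccube[OF C_on_preimage_open[OF f \<Omega>, of "ball (f x) (e/2)"]])
      (use that K e in auto)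
  then obtain r where r: "\<And>x. x \<in> K \<Longrightarrow> 0 < r x"
    "\<And>x. x \<in> K \<Longrightarrow> ccube n x (r x) \<subseteq> {y \<in> \<Omega>. f y \<in> ball (f x) (e/2)}" by metis
  obtain S \<epsilon> where S: "finite S" "S \<subseteq> K" "0 < \<epsilon>"
    "\<And>y. y \<in> K \<Longrightarrow> \<exists>x\<in>S. ccube n y \<epsilon> \<subseteq> ccube n x (r x)"
    using finite_ccube_cover[OF K(1), of r] r(1) by blast
  show thesis
  proof (rule that[OF S(3)])
    fix x y assume x: "x \<in> K" and y: "y \<in> ccube n x \<epsilon>"
    obtain z where z: "z \<in> S" "ccube n x \<epsilon> \<subseteq> ccube n z (r z)" using S(4)[OF x] by blast
    have "x \<in> ccube n x \<epsilon>"
      using centre_mem_cube S(3) compactin_subset_topspace[OF K(1)] x by blast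
    then have "x \<in> {y \<in> \<Omega>. f y \<in> ball (f z) (e/2)}" "y \<in> {y \<in> \<Omega>. f y \<in> ball (f z) (e/2)}"
      using z r(2)[of z] S(2) y by blast+
    then have "y \<in> \<Omega>" "\<bar>f z - f x\<bar> < e / 2" "\<bar>f z - f y\<bar> < e / 2" by (auto simp: dist_real_def)
    then show "y \<in> \<Omega> \<and> \<bar>f y - f x\<bar> < e" by linarith
  qed
qed

subsection \<open>Smoothness of convolutions\<close>

text \<open>Integrals of a kernel with bounded derivatives satisfy such a Lipschitz bound, so their
  continuity needs no limit theorem.\<close>

lemma C_on_if_coordinatewise_Lipschitz:
  assumes C: "\<And>x y. x \<in> topspace (Rn n) \<Longrightarrow> y \<in> topspace (Rn n) \<Longrightarrow>
    \<bar>f y - f x\<bar> \<le> C * (\<Sum>j<n. \<bar>y j - x j\<bar>)"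
  shows "f \<in> C_on n \<Omega>"
proof -
  have "openin (Rn n) {x \<in> topspace (Rn n). f x \<in> S}" if "open S" for S
  proof (subst openin_subopen, intro ballI)
    fix x assume "x \<in> {x \<in> topspace (Rn n). f x \<in> S}"
    then have x: "x \<in> topspace (Rn n)" "f x \<in> S" by auto
    obtain e where e: "0 < e" "ball (f x) e \<subseteq> S" using \<open>open S\<close> x(2) openE by blast
    define r where "r = e / (\<bar>C\<bar> * real n + 1)"
    have r: "0 < r" using e(1) by (auto simp: r_def intro!: divide_pos_pos add_nonneg_pos)
    have re: "\<bar>C\<bar> * (real n * r) < e"
    proof -
      have "r * (\<bar>C\<bar> * real n + 1) = e" unfolding r_def
        by (simp add: add_nonneg_eq_0_iff)
      then have "\<bar>C\<bar> * (real n * r) + r = e" by (simp add: algebra_simps)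
      then show ?thesis using r by linarith
    qed
    have "ocube n x r \<subseteq> {x \<in> topspace (Rn n). f x \<in> S}"
    proof
      fix y assume y: "y \<in> ocube n x r"
      then have yt: "y \<in> topspace (Rn n)" and yr: "\<And>j. j < n \<Longrightarrow> \<bar>y j - x j\<bar> \<le> r"
        by (auto simp: mem_ocube less_imp_le)
      have "(\<Sum>j<n. \<bar>y j - x j\<bar>) \<le> real n * r" using sum_bounded_above[of "{..<n}" "\<lambda>j. \<bar>y j - x j\<bar>" r] yr by simp
      then have "C * (\<Sum>j<n. \<bar>y j - x j\<bar>) \<le> \<bar>C\<bar> * (real n * r)"
        by (intro mult_mono) (auto intro: sum_nonneg)
      then have "\<bar>f y - f x\<bar> < e" using C[OF x(1) yt] re by linarith
      then show "y \<in> {x \<in> topspace (Rn n). f x \<in> S}"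
        using yt e(2) by (auto simp: subset_iff dist_real_def abs_minus_commute simp del: topspace_product_topology)
    qed
    then show "\<exists>T. openin (Rn n) T \<and> x \<in> T \<and> T \<subseteq> {x \<in> topspace (Rn n). f x \<in> S}"
      by (intro exI[of _ "ocube n x r"] conjI openin_ocube conjunct2[OF centre_mem_cube[OF x(1) r]])
  qed
  then have "continuous_map (Rn n) euclideanreal f"
    unfolding continuous_map_def by auto
  then show ?thesis unfolding C_on_def by (auto intro: continuous_map_from_subtopology)
qed

text \<open>A product of one-dimensional kernels: a partial derivative merely raises one index, and
  the kernel vanishes off a cube.\<close>

definition mker :: "nat \<Rightarrow> nat \<Rightarrow> (nat \<Rightarrow> nat) \<Rightarrow> point \<Rightarrow> point \<Rightarrow> real" where
  "mker n k \<alpha> x y = (\<Prod>j<n. moll_ker k (\<alpha> j) (x j - y j))"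

lemma mker_bounds:
  obtains B where "0 \<le> B" "\<And>x y. \<bar>mker n k \<alpha> x y\<bar> \<le> B"
    "\<And>x x' y. \<bar>mker n k \<alpha> x' y - mker n k \<alpha> x y\<bar> \<le> B * (\<Sum>j<n. \<bar>x' j - x j\<bar>)"
proof -
  have "\<exists>B\<ge>0. \<forall>t. \<bar>moll_ker k m t\<bar> \<le> B" for m
    by (rule moll_ker_bounded[of k m]) auto
  then obtain b where b: "\<And>m. 0 \<le> b m" "\<And>m t. \<bar>moll_ker k m t\<bar> \<le> b m" by metis
  define B where "B = 1 + (\<Sum>j<n. b (\<alpha> j)) + (\<Sum>j<n. b (Suc (\<alpha> j)))"
  have s0: "0 \<le> (\<Sum>j<n. b (\<alpha> j))" "0 \<le> (\<Sum>j<n. b (Suc (\<alpha> j)))" using b(1) by (auto intro: sum_nonneg)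
  have B1: "1 \<le> B" unfolding B_def using s0 by linarith
  have bB: "b (\<alpha> j) \<le> B" "b (Suc (\<alpha> j)) \<le> B" if "j < n" for j
    using member_le_sum[of j "{..<n}" "\<lambda>j. b (\<alpha> j)"] member_le_sum[of j "{..<n}" "\<lambda>j. b (Suc (\<alpha> j))"] b(1) that s0
    unfolding B_def by auto
  have gB: "\<bar>moll_ker k (\<alpha> j) t\<bar> \<le> B" if "j < n" for j t using b(2) bB(1)[OF that] order_trans by blast
  have lip: "\<bar>moll_ker k (\<alpha> j) s - moll_ker k (\<alpha> j) t\<bar> \<le> B * \<bar>s - t\<bar>" if "j < n" for j s t
    using field_differentiable_bound[of UNIV "moll_ker k (\<alpha> j)" "moll_ker k (Suc (\<alpha> j))" B s t]
      moll_ker_deriv order_trans[OF b(2) bB(2)[OF that]] by simp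
  have Bn: "0 \<le> B ^ n" using B1 by simp
  show thesis
  proof (rule that[OF Bn])
    fix x y
    have "\<bar>mker n k \<alpha> x y\<bar> \<le> (\<Prod>j<n. B)"
      unfolding mker_def abs_prod using gB by (intro prod_mono) auto
    then show "\<bar>mker n k \<alpha> x y\<bar> \<le> B ^ n" by simp
    fix x'
    \<comment> \<open>Dividing by \<open>B\<close> brings all factors into the unit interval, where
      the difference of two products is at most the sum of the differences of their factors. The
      choice of \<open>B\<close> \<ge> 1 allows the division.\<close>
    define z where "z x j = moll_ker k (\<alpha> j) (x j - y j) / B" for x j
    have eq: "mker n k \<alpha> x y = B ^ n * (\<Prod>j<n. z x j)" for x
      using B1 by (simp add: mker_def z_def prod_dividef)
    have z1: "norm (z x j) \<le> 1" if "j \<in> {..<n}" for x j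
      using gB[of j] that B1 by (simp add: z_def)
    have "\<bar>(\<Prod>j<n. z x' j) - (\<Prod>j<n. z x j)\<bar> \<le> (\<Sum>j<n. \<bar>z x' j - z x j\<bar>)"
      using norm_prod_diff[of "{..<n}" "z x'" "z x"] z1 by simp
    also have "\<dots> \<le> (\<Sum>j<n. \<bar>x' j - x j\<bar>)"
    proof (intro sum_mono)
      fix j assume "j \<in> {..<n}"
      then have "\<bar>moll_ker k (\<alpha> j) (x' j - y j) - moll_ker k (\<alpha> j) (x j - y j)\<bar> \<le> B * \<bar>x' j - x j\<bar>"
        using lip[of j "x' j - y j" "x j - y j"] by simp
      moreover have "z x' j - z x j = (moll_ker k (\<alpha> j) (x' j - y j) - moll_ker k (\<alpha> j) (x j - y j)) / B"
        by (simp add: z_def diff_divide_distrib)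
      ultimately show "\<bar>z x' j - z x j\<bar> \<le> \<bar>x' j - x j\<bar>"
        using B1 by (simp only: abs_divide) (simp add: divide_le_eq mult.commute)
    qed
    finally have "B ^ n * \<bar>(\<Prod>j<n. z x' j) - (\<Prod>j<n. z x j)\<bar> \<le> B ^ n * (\<Sum>j<n. \<bar>x' j - x j\<bar>)"
      by (rule mult_left_mono[OF _ Bn])
    then show "\<bar>mker n k \<alpha> x' y - mker n k \<alpha> x y\<bar> \<le> B ^ n * (\<Sum>j<n. \<bar>x' j - x j\<bar>)"
      unfolding eq right_diff_distrib[symmetric] abs_mult using Bn by simp
  qed
qed

lemma mker_deriv:
  assumes "i < n"
  shows "((\<lambda>t. mker n k \<alpha> (x(i := t)) y) has_real_derivative mker n k (\<alpha>(i := Suc (\<alpha> i))) x y) (at (x i))"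
proof -
  have split: "mker n k \<beta> z y = moll_ker k (\<beta> i) (z i - y i) * (\<Prod>j\<in>{..<n}-{i}. moll_ker k (\<beta> j) (z j - y j))" for \<beta> z
    unfolding mker_def using assms by (intro prod.remove) auto
  have "(\<Prod>j\<in>{..<n}-{i}. moll_ker k (\<alpha> j) ((x(i := t)) j - y j)) = (\<Prod>j\<in>{..<n}-{i}. moll_ker k (\<alpha> j) (x j - y j))" for t
    by (intro prod.cong) auto
  moreover have "(\<Prod>j\<in>{..<n}-{i}. moll_ker k ((\<alpha>(i := Suc (\<alpha> i))) j) (x j - y j)) = (\<Prod>j\<in>{..<n}-{i}. moll_ker k (\<alpha> j) (x j - y j))"
    by (intro prod.cong) auto
  moreover have "((\<lambda>t. moll_ker k (\<alpha> i) (t - y i)) has_real_derivative moll_ker k (Suc (\<alpha> i)) (x i - y i) * 1) (at (x i))"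
    by (rule DERIV_chain2[OF moll_ker_deriv]) (auto intro!: derivative_eq_intros)
  ultimately show ?thesis unfolding split
    by (auto intro!: DERIV_cmult_right)
qed

lemma mker_measurable:
  assumes "\<And>j. j < n \<Longrightarrow> (\<lambda>y. y j) \<in> borel_measurable M"
  shows "mker n k \<alpha> x \<in> borel_measurable M"
proof -
  have "(\<lambda>y. \<Prod>j<n. moll_ker k (\<alpha> j) (x j - y j)) \<in> borel_measurable M"
    using assms by (intro borel_measurable_prod measurable_compose[OF _ moll_ker_measurable] borel_measurable_diff) auto
  then show ?thesis by (simp add: mker_def[abs_def])
qed

lemma coordinate_measurable_PL: "j < n \<Longrightarrow> (\<lambda>y. y j) \<in> borel_measurable (PL n)"
  using measurable_component_singleton[of j "{..<n}" "\<lambda>_. lborel :: real measure"] by simp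

lemma coordinate_measurable_leb: "j < n \<Longrightarrow> (\<lambda>y. y j) \<in> borel_measurable (leb n)"
  unfolding leb_def by (intro measurable_completion coordinate_measurable_PL)

text \<open>
  With Lebesgue measure for \<open>M\<close> this is a convolution, with counting measure on one point a translate of
  the kernel. The multi-index \<open>\<alpha>\<close> counts the derivatives taken in each coordinate.
\<close>

definition smooth_int :: "nat \<Rightarrow> nat \<Rightarrow> point measure \<Rightarrow> (point \<Rightarrow> real) \<Rightarrow> (nat \<Rightarrow> nat) \<Rightarrow> point \<Rightarrow> real" where
  "smooth_int n k M f \<alpha> x = (\<integral>y. f y * mker n k \<alpha> x y \<partial>M)"

context
  fixes n :: nat and M :: "point measure" and f :: "point \<Rightarrow> real"
  assumes coord: "\<And>j. j < n \<Longrightarrow> (\<lambda>y. y j) \<in> borel_measurable M"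
    and f: "integrable M f"
begin

lemma integrable_times_mker: "integrable M (\<lambda>y. f y * mker n k \<alpha> x y)"
proof -
  obtain B where B: "0 \<le> B" "\<And>x y. \<bar>mker n k \<alpha> x y\<bar> \<le> B" using mker_bounds by metis
  show ?thesis
  proof (rule Bochner_Integration.integrable_bound[of M "\<lambda>y. B * f y"])
    show "integrable M (\<lambda>y. B * f y)" using f by simp
    show "(\<lambda>y. f y * mker n k \<alpha> x y) \<in> borel_measurable M"
      using borel_measurable_integrable[OF f] mker_measurable[OF coord] by (rule borel_measurable_times)
    show "AE y in M. norm (f y * mker n k \<alpha> x y) \<le> norm (B * f y)"
    proof (rule AE_I2)
      fix y
      have "\<bar>f y\<bar> * \<bar>mker n k \<alpha> x y\<bar> \<le> \<bar>f y\<bar> * B" using B(2) by (intro mult_left_mono) auto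
      then show "norm (f y * mker n k \<alpha> x y) \<le> norm (B * f y)"
        using B(1) by (simp add: abs_mult mult.commute)
    qed
  qed
qed

lemma smooth_int_C_on: "smooth_int n k M f \<alpha> \<in> C_on n \<Omega>"
proof -
  obtain B where B: "0 \<le> B" "\<And>x y. \<bar>mker n k \<alpha> x y\<bar> \<le> B"
    "\<And>x x' y. \<bar>mker n k \<alpha> x' y - mker n k \<alpha> x y\<bar> \<le> B * (\<Sum>j<n. \<bar>x' j - x j\<bar>)"
    using mker_bounds[of n k \<alpha>] by metis
  show ?thesis
  proof (rule C_on_if_coordinatewise_Lipschitz)
    fix x x' :: point
    let ?d = "\<Sum>j<n. \<bar>x' j - x j\<bar>"
    have "\<bar>smooth_int n k M f \<alpha> x' - smooth_int n k M f \<alpha> x\<bar> =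
        \<bar>\<integral>y. f y * mker n k \<alpha> x' y - f y * mker n k \<alpha> x y \<partial>M\<bar>"
      unfolding smooth_int_def
      by (subst Bochner_Integration.integral_diff[OF integrable_times_mker integrable_times_mker]) simp
    also have "\<dots> \<le> (\<integral>y. \<bar>f y * mker n k \<alpha> x' y - f y * mker n k \<alpha> x y\<bar> \<partial>M)"
      by (rule integral_abs_bound)
    also have "\<dots> \<le> (\<integral>y. \<bar>f y\<bar> * (B * ?d) \<partial>M)"
    proof (rule integral_mono)
      show "integrable M (\<lambda>y. \<bar>f y * mker n k \<alpha> x' y - f y * mker n k \<alpha> x y\<bar>)"
        by (intro integrable_abs Bochner_Integration.integrable_diff integrable_times_mker)
      show "integrable M (\<lambda>y. \<bar>f y\<bar> * (B * ?d))" using f by simp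
      show "\<bar>f y * mker n k \<alpha> x' y - f y * mker n k \<alpha> x y\<bar> \<le> \<bar>f y\<bar> * (B * ?d)" for y
        unfolding right_diff_distrib[symmetric] abs_mult using B(3) by (intro mult_left_mono) auto
    qed
    also have "\<dots> = (\<integral>y. \<bar>f y\<bar> \<partial>M) * B * ?d" by simp
    finally show "\<bar>smooth_int n k M f \<alpha> x' - smooth_int n k M f \<alpha> x\<bar> \<le> (\<integral>y. \<bar>f y\<bar> \<partial>M) * B * ?d" .
  qed
qed

text \<open>Differentiation under the integral sign: along any null sequence the Lipschitz bound on
  the kernel dominates the difference quotients by a multiple of |f|.\<close>

lemma smooth_int_deriv:
  assumes i: "i < n"
  shows "((\<lambda>t. smooth_int n k M f \<alpha> (x(i := t))) has_real_derivative
    smooth_int n k M f (\<alpha>(i := Suc (\<alpha> i))) x) (at (x i))"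
  unfolding DERIV_def tendsto_at_iff_sequentially
proof (intro allI impI)
  fix h :: "nat \<Rightarrow> real" assume h: "\<forall>m. h m \<in> UNIV - {0}" "h \<longlonglongrightarrow> 0"
  let ?q = "\<lambda>m y. (mker n k \<alpha> (x(i := x i + h m)) y - mker n k \<alpha> x y) / h m"
  obtain B where B: "0 \<le> B" "\<And>x y. \<bar>mker n k \<alpha> x y\<bar> \<le> B"
    "\<And>x x' y. \<bar>mker n k \<alpha> x' y - mker n k \<alpha> x y\<bar> \<le> B * (\<Sum>j<n. \<bar>x' j - x j\<bar>)"
    using mker_bounds[of n k \<alpha>] by metis
  have meas: "(\<lambda>y. f y * mker n k \<beta> z y) \<in> borel_measurable M" for \<beta> z
    using integrable_times_mker by (rule borel_measurable_integrable)
  have "(\<lambda>m. \<integral>y. (f y * mker n k \<alpha> (x(i := x i + h m)) y - f y * mker n k \<alpha> x y) / h m \<partial>M) \<longlonglongrightarrow>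
      (\<integral>y. f y * mker n k (\<alpha>(i := Suc (\<alpha> i))) x y \<partial>M)"
  proof (rule integral_dominated_convergence[where w="\<lambda>y. \<bar>f y\<bar> * B"])
    show "integrable M (\<lambda>y. \<bar>f y\<bar> * B)" using f by simp
    show "AE y in M. (\<lambda>m. (f y * mker n k \<alpha> (x(i := x i + h m)) y - f y * mker n k \<alpha> x y) / h m) \<longlonglongrightarrow>
        f y * mker n k (\<alpha>(i := Suc (\<alpha> i))) x y"
    proof (rule AE_I2)
      fix y
      have "(\<lambda>m. ?q m y) \<longlonglongrightarrow> mker n k (\<alpha>(i := Suc (\<alpha> i))) x y"
        using mker_deriv[OF i, of k \<alpha> x y] h
        unfolding DERIV_def tendsto_at_iff_sequentially by (auto simp: comp_def)
      then have "(\<lambda>m. f y * ?q m y) \<longlonglongrightarrow> f y * mker n k (\<alpha>(i := Suc (\<alpha> i))) x y"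
        by (intro tendsto_intros)
      then show "(\<lambda>m. (f y * mker n k \<alpha> (x(i := x i + h m)) y - f y * mker n k \<alpha> x y) / h m) \<longlonglongrightarrow>
        f y * mker n k (\<alpha>(i := Suc (\<alpha> i))) x y"
        by (simp add: right_diff_distrib)
    qed
    fix m
    show "AE y in M. norm ((f y * mker n k \<alpha> (x(i := x i + h m)) y - f y * mker n k \<alpha> x y) / h m) \<le> \<bar>f y\<bar> * B"
    proof (rule AE_I2)
      fix y
      have hm: "h m \<noteq> 0" using h(1) by auto
      have "(\<Sum>j<n. \<bar>(x(i := x i + h m)) j - x j\<bar>) = (\<Sum>j<n. if j = i then \<bar>h m\<bar> else 0)"
        by (intro sum.cong) auto
      also have "\<dots> = \<bar>h m\<bar>" using i by simp
      finally have "\<bar>mker n k \<alpha> (x(i := x i + h m)) y - mker n k \<alpha> x y\<bar> \<le> B * \<bar>h m\<bar>"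
        using B(3)[of "x(i := x i + h m)" y x] by simp
      then have "\<bar>?q m y\<bar> \<le> B" using hm by (simp add: field_simps)
      then have "\<bar>f y\<bar> * \<bar>?q m y\<bar> \<le> \<bar>f y\<bar> * B" by (intro mult_left_mono) auto
      moreover have "norm ((f y * mker n k \<alpha> (x(i := x i + h m)) y - f y * mker n k \<alpha> x y) / h m) = \<bar>f y\<bar> * \<bar>?q m y\<bar>"
        by (simp add: right_diff_distrib[symmetric] abs_mult abs_divide del: right_diff_distrib')
      ultimately show "norm ((f y * mker n k \<alpha> (x(i := x i + h m)) y - f y * mker n k \<alpha> x y) / h m) \<le> \<bar>f y\<bar> * B"
        using hm by simp
    qed
  qed (intro borel_measurable_divide borel_measurable_diff meas borel_measurable_const)+
  moreover have "(\<integral>y. (f y * mker n k \<alpha> (x(i := x i + h m)) y - f y * mker n k \<alpha> x y) / h m \<partial>M) =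
      (smooth_int n k M f \<alpha> (x(i := x i + h m)) - smooth_int n k M f \<alpha> (x(i := x i))) / h m" for m
    unfolding smooth_int_def
    by (simp add: Bochner_Integration.integral_diff[OF integrable_times_mker integrable_times_mker])
  ultimately have "(\<lambda>m. (smooth_int n k M f \<alpha> (x(i := x i + h m)) - smooth_int n k M f \<alpha> (x(i := x i))) / h m) \<longlonglongrightarrow>
      (\<integral>y. f y * mker n k (\<alpha>(i := Suc (\<alpha> i))) x y \<partial>M)" by (simp only:)
  then show "((\<lambda>h. (smooth_int n k M f \<alpha> (x(i := x i + h)) - smooth_int n k M f \<alpha> (x(i := x i))) / h) \<circ> h) \<longlonglongrightarrow>
      smooth_int n k M f (\<alpha>(i := Suc (\<alpha> i))) x"
    by (simp only: comp_def smooth_int_def)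
qed

lemma pderiv_at_smooth_int:
  "i < n \<Longrightarrow> pderiv_at i (smooth_int n k M f \<alpha>) = smooth_int n k M f (\<alpha>(i := Suc (\<alpha> i)))"
  unfolding pderiv_at_def by (intro ext DERIV_imp_deriv smooth_int_deriv)

lemma smooth_int_C_k: "smooth_int n k M f \<alpha> \<in> C_k n m \<Omega>"
proof (induction m arbitrary: \<alpha>)
  case (Suc m)
  then show ?case
    using smooth_int_C_on pderiv_at_smooth_int smooth_int_deriv
    by (auto simp: real_differentiable_def intro!: exI)
qed (simp add: smooth_int_C_on)

end

section \<open>Translated kernels as test functions\<close>

lemma compactly_containedI:
  assumes "compactin (Rn n) K" "K \<subseteq> \<Omega>" "S \<subseteq> K"
  shows "compactly_contained n S \<Omega>"
proof -
  have "Hausdorff_space (Rn n)" by (simp add: Hausdorff_space_product_topology)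
  then have "closedin (Rn n) K" using assms compactin_imp_closedin by blast
  then have sub: "Rn n closure_of S \<subseteq> K" using assms(3) by (intro closure_of_minimal)
  then have "compactin (Rn n) (Rn n closure_of S)"
    by (rule closed_compactin[OF assms(1)]) simp
  then show ?thesis unfolding compactly_contained_def using sub assms(2) by blast
qed

lemma mker_zero_outside:
  assumes "y \<in> topspace (Rn n)" "y \<notin> ccube n x (1 / (real k + 1))"
  shows "mker n k \<alpha> x y = 0"
proof -
  obtain j where "j < n" "1 / (real k + 1) < \<bar>y j - x j\<bar>"
    using assms by (auto simp: mem_ccube simp del: topspace_product_topology)
  then have "moll_ker k (\<alpha> j) (x j - y j) = 0" by (intro moll_ker_zero) (simp add: abs_minus_commute)
  then show ?thesis unfolding mker_def using \<open>j < n\<close> by (intro prod_zero) auto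
qed

lemma mker_nonneg: "0 \<le> mker n k (\<lambda>_. 0) x y"
  unfolding mker_def by (intro prod_nonneg moll_ker_nonneg ballI)

lemma mker_sym: "mker n k (\<lambda>_. 0) x y = mker n k (\<lambda>_. 0) y x"
  unfolding mker_def by (intro prod.cong refl) (metis minus_diff_eq moll_ker_even)

lemma mker_antisym:
  assumes "i < n"
  shows "mker n k ((\<lambda>_. 0)(i := Suc 0)) x y = - mker n k ((\<lambda>_. 0)(i := Suc 0)) y x"
proof -
  have split: "mker n k \<beta> z w = moll_ker k (\<beta> i) (z i - w i) * (\<Prod>j\<in>{..<n}-{i}. moll_ker k (\<beta> j) (z j - w j))" for \<beta> z w
    unfolding mker_def using assms by (intro prod.remove) auto
  have "(\<Prod>j\<in>{..<n}-{i}. moll_ker k (((\<lambda>_. 0)(i := Suc 0)) j) (x j - y j)) =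
      (\<Prod>j\<in>{..<n}-{i}. moll_ker k (((\<lambda>_. 0)(i := Suc 0)) j) (y j - x j))"
    by (intro prod.cong refl) (auto, metis minus_diff_eq moll_ker_even)
  moreover have "moll_ker k (Suc 0) (x i - y i) = - moll_ker k (Suc 0) (y i - x i)"
    using moll_ker_odd[of k "y i - x i"] by simp
  ultimately show ?thesis unfolding split by simp
qed

text \<open>By symmetry the kernel in its second variable is \<open>smooth_int\<close> for counting
  measure on {x} and so inherits smoothness. The derivative now falls on the other variable, and the
  odd derivative of the even kernel produces the minus sign.\<close>

lemma mker_test_function:
  assumes x: "x \<in> topspace (Rn n)" and sub: "ccube n x (1 / (real k + 1)) \<subseteq> \<Omega>" and \<Omega>: "openin (Rn n) \<Omega>"
  shows "mker n k (\<lambda>_. 0) x \<in> C_c_inf n \<Omega>"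
    and "i < n \<Longrightarrow> pderiv_at i (mker n k (\<lambda>_. 0) x) y = - mker n k ((\<lambda>_. 0)(i := Suc 0)) x y"
proof -
  let ?M = "count_space {x}"
  have eq: "smooth_int n k ?M (\<lambda>_. 1) \<alpha> = (\<lambda>y. mker n k \<alpha> y x)" for \<alpha>
    by (auto simp: smooth_int_def lebesgue_integral_count_space_finite)
  have c: "\<And>j. (\<lambda>y. y j) \<in> borel_measurable ?M" "integrable ?M (\<lambda>_. 1 :: real)"
    by (auto simp: integrable_count_space)
  have e0: "mker n k (\<lambda>_. 0) x = smooth_int n k ?M (\<lambda>_. 1) (\<lambda>_. 0)"
    unfolding eq by (intro ext mker_sym)
  have "mker n k (\<lambda>_. 0) x \<in> C_k n m \<Omega>" for m
    unfolding e0 by (rule smooth_int_C_k[OF c])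
  moreover have "mker n k (\<lambda>_. 0) x \<in> C_c n \<Omega>"
    unfolding C_c_def
  proof safe
    show "mker n k (\<lambda>_. 0) x \<in> C_on n \<Omega>" unfolding e0 by (rule smooth_int_C_on[OF c])
    show "compactly_contained n {y \<in> \<Omega>. mker n k (\<lambda>_. 0) x y \<noteq> 0} \<Omega>"
      by (rule compactly_containedI[OF compactin_ccube sub])
        (use mker_zero_outside openin_subset[OF \<Omega>] in blast)
  qed
  ultimately show "mker n k (\<lambda>_. 0) x \<in> C_c_inf n \<Omega>" unfolding C_c_inf_def by blast
  assume i: "i < n"
  have "pderiv_at i (mker n k (\<lambda>_. 0) x) = smooth_int n k ?M (\<lambda>_. 1) ((\<lambda>_. 0)(i := Suc 0))"
    unfolding e0 using pderiv_at_smooth_int[OF c i, of k "\<lambda>_. 0"] by simp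
  then show "pderiv_at i (mker n k (\<lambda>_. 0) x) y = - mker n k ((\<lambda>_. 0)(i := Suc 0)) x y"
    unfolding eq using mker_antisym[OF i, of k y x] by simp
qed

subsection \<open>Mollification\<close>

abbreviation cv :: "nat \<Rightarrow> nat \<Rightarrow> (point \<Rightarrow> real) \<Rightarrow> point \<Rightarrow> real" where
  "cv n k f \<equiv> smooth_int n k (leb n) f (\<lambda>_. 0)"

text \<open>Tonelli's theorem and the generation by boxes concern the product measure before
  completion. Functions measurable for \<open>leb\<close> are therefore first changed on a null set,
  which no integral notices.\<close>

lemma ex_Borel_representative:
  fixes f :: "point \<Rightarrow> real"
  assumes "f \<in> borel_measurable (leb n)"
  obtains f' where "f' \<in> borel_measurable (PL n)" "AE x in leb n. f x = f' x"
proof -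
  obtain f' where "f' \<in> borel_measurable (PL n)" "AE x in PL n. f x = f' x"
    using completion_ex_borel_measurable_real assms unfolding leb_def by blast
  then show thesis using that unfolding leb_def by (blast intro: AE_completion)
qed

lemma measurable_leb: "f \<in> measurable (PL n) N \<Longrightarrow> f \<in> measurable (leb n) N"
  unfolding leb_def by (rule measurable_completion)

lemma integrable_leb_iff:
  fixes f :: "point \<Rightarrow> real"
  shows "f \<in> borel_measurable (PL n) \<Longrightarrow> integrable (leb n) f \<longleftrightarrow> integrable (PL n) f"
  unfolding leb_def by (rule integrable_completion)

lemma integral_leb:
  fixes f :: "point \<Rightarrow> real"
  shows "f \<in> borel_measurable (PL n) \<Longrightarrow> integral\<^sup>L (leb n) f = integral\<^sup>L (PL n) f"
  unfolding leb_def by (rule integral_completion)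

lemma times_mker_measurable: 
  "f \<in> borel_measurable (leb n) \<Longrightarrow> (\<lambda>y. f y * mker n k \<alpha> x y) \<in> borel_measurable (leb n)"
  by (intro borel_measurable_times mker_measurable coordinate_measurable_leb)

lemma smooth_int_cong_AE:
  assumes "f \<in> borel_measurable (leb n)" "g \<in> borel_measurable (leb n)" "AE x in leb n. f x = g x"
  shows "smooth_int n k (leb n) f \<alpha> = smooth_int n k (leb n) g \<alpha>"
  unfolding smooth_int_def
  using assms by (intro ext integral_cong_AE times_mker_measurable) auto

lemma mker_pair_measurable:
  "(\<lambda>(x, y). mker n k (\<lambda>_. 0) x y) \<in> borel_measurable (PL n \<Otimes>\<^sub>M PL n)"
proof -
  have "(\<lambda>z. \<Prod>j<n. moll_ker k 0 (fst z j - snd z j)) \<in> borel_measurable (PL n \<Otimes>\<^sub>M PL n)"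
    by (intro borel_measurable_prod measurable_compose[OF _ moll_ker_measurable] borel_measurable_diff
        measurable_compose[OF measurable_fst coordinate_measurable_PL]
        measurable_compose[OF measurable_snd coordinate_measurable_PL]) auto
  then show ?thesis by (simp add: mker_def case_prod_beta)
qed

lemma nn_integral_mker: "(\<integral>\<^sup>+y. ennreal (mker n k (\<lambda>_. 0) x y) \<partial>PL n) = 1"
proof -
  have 1: "(\<integral>\<^sup>+t. ennreal (moll_ker k 0 (s - t)) \<partial>lborel) = 1" for s
  proof -
    have "(\<integral>\<^sup>+t. ennreal (moll_ker k 0 t) \<partial>lborel) = ennreal (LBINT t. moll_ker k 0 t)"
      by (intro nn_integral_eq_integral moll_ker_integrable AE_I2 moll_ker_nonneg)
    then have "(\<integral>\<^sup>+t. ennreal (moll_ker k 0 t) \<partial>lborel) = 1" by (simp add: moll_ker_integral)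
    moreover have "(\<integral>\<^sup>+t. ennreal (moll_ker k 0 t) \<partial>lborel) =
        ennreal \<bar>-1\<bar> * (\<integral>\<^sup>+t. ennreal (moll_ker k 0 (s + (-1) * t)) \<partial>lborel)"
      by (rule nn_integral_real_affine) auto
    ultimately show ?thesis by simp
  qed
  have "(\<integral>\<^sup>+y. ennreal (mker n k (\<lambda>_. 0) x y) \<partial>PL n) = (\<integral>\<^sup>+y. (\<Prod>j<n. ennreal (moll_ker k 0 (x j - y j))) \<partial>PL n)"
    unfolding mker_def by (intro nn_integral_cong prod_ennreal[symmetric] moll_ker_nonneg)
  also have "\<dots> = (\<Prod>j<n. (\<integral>\<^sup>+t. ennreal (moll_ker k 0 (x j - t)) \<partial>lborel))"
    by (intro lborel_product.product_nn_integral_prod) auto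
  finally show ?thesis by (simp add: 1)
qed

lemma
  shows integrable_mker: "integrable (leb n) (mker n k (\<lambda>_. 0) x)"
    and integral_mker: "(\<integral>y. mker n k (\<lambda>_. 0) x y \<partial>leb n) = 1"
proof -
  have m: "mker n k (\<lambda>_. 0) x \<in> borel_measurable (PL n)"
    by (intro mker_measurable coordinate_measurable_PL)
  have i: "integrable (PL n) (mker n k (\<lambda>_. 0) x)"
    by (rule integrableI_nonneg) (use m nn_integral_mker in \<open>auto simp: mker_nonneg\<close>)
  then show "integrable (leb n) (mker n k (\<lambda>_. 0) x)" using m by (simp add: integrable_leb_iff)
  have "ennreal (\<integral>y. mker n k (\<lambda>_. 0) x y \<partial>PL n) = 1"
    using nn_integral_eq_integral[OF i] nn_integral_mker by (simp add: mker_nonneg)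
  then show "(\<integral>y. mker n k (\<lambda>_. 0) x y \<partial>leb n) = 1"
    using m by (simp add: integral_leb)
qed

text \<open>Mollification contracts L^1: Tonelli exchanges the integrals, and by symmetry of the
  kernel the integral over x is again 1.\<close>

lemma
  assumes f: "integrable (leb n) f"
  shows integrable_cv: "integrable (leb n) (cv n k f)"
    and integral_abs_cv_le: "(\<integral>x. \<bar>cv n k f x\<bar> \<partial>leb n) \<le> (\<integral>x. \<bar>f x\<bar> \<partial>leb n)"
proof -
  interpret P: sigma_finite_measure "PL n" by (rule sigma_finite_PL)
  interpret PP: pair_sigma_finite "PL n" "PL n" ..
  obtain g where g[measurable]: "g \<in> borel_measurable (PL n)" and fg: "AE x in leb n. f x = g x"
    using ex_Borel_representative[OF borel_measurable_integrable[OF f]] .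
  have gl: "g \<in> borel_measurable (leb n)" using g by (rule measurable_leb)
  have ig: "integrable (PL n) g"
    using integrable_cong_AE[OF borel_measurable_integrable[OF f] gl fg] f g by (simp add: integrable_leb_iff)
  have cg: "cv n k f = cv n k g"
    using borel_measurable_integrable[OF f] gl fg by (rule smooth_int_cong_AE)
  have m0: "(\<lambda>y. g y * mker n k (\<lambda>_. 0) x y) \<in> borel_measurable (PL n)" for x
    using g by (intro borel_measurable_times mker_measurable coordinate_measurable_PL)
  have eq: "cv n k g = (\<lambda>x. \<integral>y. g y * mker n k (\<lambda>_. 0) x y \<partial>PL n)"
    unfolding smooth_int_def using m0 by (simp add: integral_leb)
  note [measurable] = mker_pair_measurable
  have cm: "cv n k g \<in> borel_measurable (PL n)"
    unfolding eq by measurable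
  have "(\<integral>\<^sup>+x. ennreal (norm (cv n k g x)) \<partial>PL n) \<le>
      (\<integral>\<^sup>+x. (\<integral>\<^sup>+y. ennreal (norm (g y * mker n k (\<lambda>_. 0) x y)) \<partial>PL n) \<partial>PL n)"
    unfolding eq
  proof (intro nn_integral_mono integral_norm_bound_ennreal)
    fix x
    have "integrable (leb n) (\<lambda>y. g y * mker n k (\<lambda>_. 0) x y)"
      using ig g by (intro integrable_times_mker coordinate_measurable_leb) (auto simp: integrable_leb_iff)
    then show "integrable (PL n) (\<lambda>y. g y * mker n k (\<lambda>_. 0) x y)"
      using m0 by (simp add: integrable_leb_iff)
  qed
  also have "\<dots> = (\<integral>\<^sup>+y. (\<integral>\<^sup>+x. ennreal \<bar>g y\<bar> * ennreal (mker n k (\<lambda>_. 0) x y) \<partial>PL n) \<partial>PL n)"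
    by (subst PP.Fubini') (auto simp: abs_mult mker_nonneg ennreal_mult')
  also have "\<dots> = (\<integral>\<^sup>+y. ennreal \<bar>g y\<bar> * (\<integral>\<^sup>+x. ennreal (mker n k (\<lambda>_. 0) y x) \<partial>PL n) \<partial>PL n)"
  proof (intro nn_integral_cong)
    fix y
    have "mker n k (\<lambda>_. 0) y \<in> borel_measurable (PL n)"
      by (intro mker_measurable coordinate_measurable_PL)
    then show "(\<integral>\<^sup>+x. ennreal \<bar>g y\<bar> * ennreal (mker n k (\<lambda>_. 0) x y) \<partial>PL n) =
        ennreal \<bar>g y\<bar> * (\<integral>\<^sup>+x. ennreal (mker n k (\<lambda>_. 0) y x) \<partial>PL n)"
      by (subst mker_sym) (simp add: nn_integral_cmult)
  qed
  also have "\<dots> = (\<integral>\<^sup>+y. ennreal (norm (g y)) \<partial>PL n)" by (simp add: nn_integral_mker)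
  finally have le: "(\<integral>\<^sup>+x. ennreal (norm (cv n k g x)) \<partial>PL n) \<le> (\<integral>\<^sup>+y. ennreal (norm (g y)) \<partial>PL n)" .
  moreover have "(\<integral>\<^sup>+y. ennreal (norm (g y)) \<partial>PL n) < \<infinity>"
    using ig unfolding integrable_iff_bounded by simp
  ultimately have ic: "integrable (PL n) (cv n k g)"
    using cm unfolding integrable_iff_bounded by simp
  then show "integrable (leb n) (cv n k f)" unfolding cg using cm by (simp add: integrable_leb_iff)
  have "ennreal (\<integral>x. \<bar>cv n k g x\<bar> \<partial>PL n) \<le> ennreal (\<integral>x. \<bar>g x\<bar> \<partial>PL n)"
    using le nn_integral_eq_integral[OF integrable_norm[OF ic]] nn_integral_eq_integral[OF integrable_norm[OF ig]] by simp
  then have "(\<integral>x. \<bar>cv n k g x\<bar> \<partial>PL n) \<le> (\<integral>x. \<bar>g x\<bar> \<partial>PL n)"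
    by (simp add: integral_nonneg_AE)
  also have "\<dots> = (\<integral>x. \<bar>g x\<bar> \<partial>leb n)" by (rule integral_leb[symmetric]) measurable
  also have "\<dots> = (\<integral>x. \<bar>f x\<bar> \<partial>leb n)"
    by (rule integral_cong_AE) (use fg gl f in auto)
  also have "(\<integral>x. \<bar>cv n k g x\<bar> \<partial>PL n) = (\<integral>x. \<bar>cv n k g x\<bar> \<partial>leb n)"
    by (rule integral_leb[symmetric]) (use cm in measurable)
  finally show "(\<integral>x. \<bar>cv n k f x\<bar> \<partial>leb n) \<le> (\<integral>x. \<bar>f x\<bar> \<partial>leb n)" unfolding cg .
qed

lemma integrable_leb_times_mker:
  "integrable (leb n) f \<Longrightarrow> integrable (leb n) (\<lambda>y. f y * mker n k \<alpha> x y)"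
  by (intro integrable_times_mker coordinate_measurable_leb)

lemma cv_add:
  "integrable (leb n) f \<Longrightarrow> integrable (leb n) g \<Longrightarrow> cv n k (\<lambda>x. f x + g x) x = cv n k f x + cv n k g x"
  unfolding smooth_int_def distrib_right
  by (intro Bochner_Integration.integral_add integrable_leb_times_mker)

lemma cv_diff:
  "integrable (leb n) f \<Longrightarrow> integrable (leb n) g \<Longrightarrow> cv n k (\<lambda>x. f x - g x) x = cv n k f x - cv n k g x"
  unfolding smooth_int_def left_diff_distrib
  by (intro Bochner_Integration.integral_diff integrable_leb_times_mker)

lemma cv_cmult: "cv n k (\<lambda>x. c * f x) x = c * cv n k f x"
  unfolding smooth_int_def by (simp add: mult.assoc)

text \<open>Jensen's inequality, by integrating the tangent inequality against the kernel.\<close>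

lemma abs_cv_powr_le:
  assumes p: "1 < p" and f: "integrable (leb n) f" "integrable (leb n) (\<lambda>x. \<bar>f x\<bar> powr p)"
  shows "\<bar>cv n k f x\<bar> powr p \<le> cv n k (\<lambda>x. \<bar>f x\<bar> powr p) x"
proof -
  define s where "s = cv n k f x"
  define d where "d = p * \<bar>s\<bar> powr (p - 2) * s"
  let ?m = "mker n k (\<lambda>_. 0) x"
  have i: "integrable (leb n) (\<lambda>y. \<bar>s\<bar> powr p * ?m y + d * (f y * ?m y - s * ?m y))"
    by (intro Bochner_Integration.integrable_add Bochner_Integration.integrable_diff
        Bochner_Integration.integrable_mult_right integrable_mker integrable_leb_times_mker f)
  have "(\<integral>y. \<bar>s\<bar> powr p * ?m y + d * (f y * ?m y - s * ?m y) \<partial>leb n) \<le> (\<integral>y. \<bar>f y\<bar> powr p * ?m y \<partial>leb n)"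
  proof (rule integral_mono[OF i integrable_leb_times_mker[OF f(2)]])
    fix y
    have "(\<bar>s\<bar> powr p + d * (f y - s)) * ?m y \<le> \<bar>f y\<bar> powr p * ?m y"
      unfolding d_def by (intro mult_right_mono abs_powr_tangent[OF p] mker_nonneg)
    then show "\<bar>s\<bar> powr p * ?m y + d * (f y * ?m y - s * ?m y) \<le> \<bar>f y\<bar> powr p * ?m y"
      by (simp add: algebra_simps)
  qed
  moreover have "(\<integral>y. \<bar>s\<bar> powr p * ?m y + d * (f y * ?m y - s * ?m y) \<partial>leb n) =
      \<bar>s\<bar> powr p * 1 + d * (s - s * 1)"
    by (subst Bochner_Integration.integral_add Bochner_Integration.integral_diff,
        (intro Bochner_Integration.integrable_diff Bochner_Integration.integrable_mult_right
          integrable_mker integrable_leb_times_mker f)+)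
      (simp add: integral_mker s_def smooth_int_def
        Bochner_Integration.integral_diff integrable_mker integrable_leb_times_mker f)
  ultimately show ?thesis by (simp add: s_def smooth_int_def)
qed

text \<open>\<open>F\<close> is a cut-off of \<open>f\<close>, made integrable on the whole space.
  Once the kernel is narrower than \<delta> the cut-off is invisible from \<open>K\<close>, and
  since the kernel is a probability density the error is at most the oscillation of \<open>f\<close>
  over one kernel cube.\<close>

lemma cv_uniform_limit:
  assumes f: "f \<in> C_on n \<Omega>" and \<Omega>: "openin (Rn n) \<Omega>" and K: "compactin (Rn n) K" "K \<subseteq> \<Omega>"
    and F: "integrable (leb n) F" and d: "0 < \<delta>" "\<And>x y. x \<in> K \<Longrightarrow> y \<in> ccube n x \<delta> \<Longrightarrow> F y = f y"
    and e: "0 < e"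
  shows "\<forall>\<^sub>F k in sequentially. \<forall>x\<in>K. \<bar>cv n k F x - f x\<bar> \<le> e"
proof -
  obtain \<epsilon> where eps: "0 < \<epsilon>" "\<And>x y. x \<in> K \<Longrightarrow> y \<in> ccube n x \<epsilon> \<Longrightarrow> y \<in> \<Omega> \<and> \<bar>f y - f x\<bar> < e"
    by (rule C_on_uniformly_continuous[OF f \<Omega> K e]) blast
  obtain N :: nat where N: "1 / (real N + 1) < min \<epsilon> \<delta>"
    using reals_Archimedean[of "min \<epsilon> \<delta>"] eps(1) d(1) by (auto simp: inverse_eq_divide add.commute)
  show ?thesis
  proof (rule eventually_sequentiallyI[of N], intro ballI)
    fix k x assume k: "N \<le> k" and x: "x \<in> K"
    let ?m = "mker n k (\<lambda>_. 0) x"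
    have "1 / (real k + 1) \<le> 1 / (real N + 1)" using k by (intro divide_left_mono) auto
    then have k': "1 / (real k + 1) \<le> min \<epsilon> \<delta>" using N by linarith
    have i: "integrable (leb n) (\<lambda>y. F y * ?m y - f x * ?m y)"
      by (intro Bochner_Integration.integrable_diff Bochner_Integration.integrable_mult_right
          integrable_mker integrable_leb_times_mker F)
    have "cv n k F x - f x = (\<integral>y. F y * ?m y \<partial>leb n) - f x * (\<integral>y. ?m y \<partial>leb n)"
      by (simp add: smooth_int_def integral_mker)
    also have "\<dots> = (\<integral>y. F y * ?m y - f x * ?m y \<partial>leb n)"
      by (subst Bochner_Integration.integral_diff)
        (auto intro: integrable_mker integrable_leb_times_mker F)
    finally have eq: "cv n k F x - f x = (\<integral>y. F y * ?m y - f x * ?m y \<partial>leb n)" .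
    have "\<bar>cv n k F x - f x\<bar> \<le> (\<integral>y. \<bar>F y * ?m y - f x * ?m y\<bar> \<partial>leb n)"
      unfolding eq by (rule integral_abs_bound)
    also have "\<dots> \<le> (\<integral>y. e * ?m y \<partial>leb n)"
    proof (rule integral_mono)
      show "integrable (leb n) (\<lambda>y. \<bar>F y * ?m y - f x * ?m y\<bar>)" by (rule integrable_abs[OF i])
      show "integrable (leb n) (\<lambda>y. e * ?m y)" by (intro Bochner_Integration.integrable_mult_right integrable_mker)
      fix y assume "y \<in> space (leb n)"
      then have y: "y \<in> topspace (Rn n)" by (simp only: space_leb)
      show "\<bar>F y * ?m y - f x * ?m y\<bar> \<le> e * ?m y"
      proof (cases "y \<in> ccube n x (1 / (real k + 1))")
        case True
        have "ccube n x (1 / (real k + 1)) \<subseteq> ccube n x \<epsilon>" "ccube n x (1 / (real k + 1)) \<subseteq> ccube n x \<delta>"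
          using k' by (intro ccube_mono; simp)+
        then have "\<bar>F y - f x\<bar> \<le> e" using True eps(2)[OF x, of y] d(2)[OF x, of y] by fastforce
        then have "\<bar>F y - f x\<bar> * ?m y \<le> e * ?m y" by (intro mult_right_mono mker_nonneg)
        then show ?thesis by (simp add: left_diff_distrib[symmetric] abs_mult mker_nonneg)
      next
        case False
        then show ?thesis using mker_zero_outside[OF y False] by simp
      qed
    qed
    also have "\<dots> = e" by (simp add: integral_mker)
    finally show "\<bar>cv n k F x - f x\<bar> \<le> e" .
  qed
qed

lemma cv_zero_outside:
  assumes "\<And>y. y \<in> ccube n x (1 / (real k + 1)) \<Longrightarrow> f y = 0"
  shows "smooth_int n k (leb n) f \<alpha> x = 0"
proof -
  have "(\<integral>y. f y * mker n k \<alpha> x y \<partial>leb n) = (\<integral>y. 0 \<partial>leb n)"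
  proof (rule Bochner_Integration.integral_cong)
    fix y assume "y \<in> space (leb n)"
    then have "y \<in> topspace (Rn n)" by (simp only: space_leb)
    then show "f y * mker n k \<alpha> x y = 0"
      using assms mker_zero_outside by (cases "y \<in> ccube n x (1 / (real k + 1))") auto
  qed simp
  then show ?thesis by (simp add: smooth_int_def)
qed

subsection \<open>Convergence in the mean\<close>

text \<open>The predicate for the induction on functions. It is closed under sums, multiples and
  dominated limits, and it includes integrability so that each closure step can use it.\<close>

definition cv_converges :: "nat \<Rightarrow> (point \<Rightarrow> real) \<Rightarrow> bool" where
  "cv_converges n f \<longleftrightarrow> integrable (leb n) f \<and> (\<lambda>k. \<integral>x. \<bar>cv n k f x - f x\<bar> \<partial>leb n) \<longlonglongrightarrow> 0"

text \<open>A three-term estimate. Replacing \<open>f\<close> by \<open>h\<close> costs no more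
  after mollification than before, because mollification contracts L^1.\<close>

lemma cv_convergesI_approx:
  assumes f: "integrable (leb n) f"
    and approx: "\<And>e. 0 < e \<Longrightarrow> \<exists>h. cv_converges n h \<and> (\<integral>x. \<bar>f x - h x\<bar> \<partial>leb n) < e"
  shows "cv_converges n f"
  unfolding cv_converges_def
proof (intro conjI f LIMSEQ_I)
  fix r :: real assume "0 < r"
  then obtain h where h: "cv_converges n h" "(\<integral>x. \<bar>f x - h x\<bar> \<partial>leb n) < r / 3"
    using approx[of "r/3"] by auto
  have ih: "integrable (leb n) h" using h(1) unfolding cv_converges_def by simp
  obtain N where N: "\<And>k. N \<le> k \<Longrightarrow> (\<integral>x. \<bar>cv n k h x - h x\<bar> \<partial>leb n) < r / 3"
    using LIMSEQ_D[of "\<lambda>k. \<integral>x. \<bar>cv n k h x - h x\<bar> \<partial>leb n" 0 "r/3"] h(1) \<open>0 < r\<close>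
    unfolding cv_converges_def by (auto simp: integral_nonneg_AE)
  show "\<exists>no. \<forall>k\<ge>no. norm ((\<integral>x. \<bar>cv n k f x - f x\<bar> \<partial>leb n) - 0) < r"
  proof (intro exI[of _ N] allI impI)
    fix k assume "N \<le> k"
    have ifh: "integrable (leb n) (\<lambda>x. f x - h x)" using f ih by simp
    note i = integrable_cv[OF f] integrable_cv[OF ih] integrable_cv[OF ifh] f ih
    have "(\<integral>x. \<bar>cv n k f x - f x\<bar> \<partial>leb n) \<le>
        (\<integral>x. \<bar>cv n k (\<lambda>x. f x - h x) x\<bar> + \<bar>cv n k h x - h x\<bar> + \<bar>f x - h x\<bar> \<partial>leb n)"
    proof (rule integral_mono)
      fix x
      have "cv n k f x - f x = cv n k (\<lambda>x. f x - h x) x + (cv n k h x - h x) - (f x - h x)"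
        by (simp add: cv_diff[OF f ih])
      then show "\<bar>cv n k f x - f x\<bar> \<le> \<bar>cv n k (\<lambda>x. f x - h x) x\<bar> + \<bar>cv n k h x - h x\<bar> + \<bar>f x - h x\<bar>"
        by linarith
    qed (use i in auto)
    also have "\<dots> = (\<integral>x. \<bar>cv n k (\<lambda>x. f x - h x) x\<bar> \<partial>leb n) + (\<integral>x. \<bar>cv n k h x - h x\<bar> \<partial>leb n) +
        (\<integral>x. \<bar>f x - h x\<bar> \<partial>leb n)"
      using i by (simp add: Bochner_Integration.integral_add)
    also have "\<dots> < r / 3 + r / 3 + r / 3"
      using integral_abs_cv_le[OF ifh, of k] h(2) N[OF \<open>N \<le> k\<close>] by linarith
    finally show "norm ((\<integral>x. \<bar>cv n k f x - f x\<bar> \<partial>leb n) - 0) < r"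
      by (simp add: integral_nonneg_AE)
  qed
qed

lemma cv_converges_limit:
  assumes s: "\<And>m. cv_converges n (s m)" and w: "integrable (leb n) w"
    and lim: "\<And>x. x \<in> space (leb n) \<Longrightarrow> (\<lambda>m. s m x) \<longlonglongrightarrow> f x"
    and bound: "\<And>m x. x \<in> space (leb n) \<Longrightarrow> \<bar>s m x\<bar> \<le> w x"
  shows "cv_converges n f"
proof -
  have si: "integrable (leb n) (s m)" for m using s unfolding cv_converges_def by simp
  have fm: "f \<in> borel_measurable (leb n)"
    by (rule borel_measurable_LIMSEQ_real[OF lim]) (use si in auto)
  have fb: "\<bar>f x\<bar> \<le> w x" if "x \<in> space (leb n)" for x
    by (rule LIMSEQ_le_const2[OF tendsto_rabs[OF lim[OF that]]]) (use bound that in auto)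
  have fi: "integrable (leb n) f"
  proof (rule Bochner_Integration.integrable_bound[OF w fm])
    show "AE x in leb n. norm (f x) \<le> norm (w x)"
      using fb by (intro AE_I2) (fastforce intro: order_trans)
  qed
  have "(\<lambda>m. \<integral>x. \<bar>f x - s m x\<bar> \<partial>leb n) \<longlonglongrightarrow> (\<integral>x. 0 \<partial>leb n)"
  proof (rule integral_dominated_convergence[where w="\<lambda>x. 2 * w x"])
    show "AE x in leb n. (\<lambda>m. \<bar>f x - s m x\<bar>) \<longlonglongrightarrow> 0"
    proof (rule AE_I2)
      fix x assume "x \<in> space (leb n)"
      then have "(\<lambda>m. \<bar>f x - s m x\<bar>) \<longlonglongrightarrow> \<bar>f x - f x\<bar>" by (intro tendsto_intros lim)
      then show "(\<lambda>m. \<bar>f x - s m x\<bar>) \<longlonglongrightarrow> 0" by simp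
    qed
    show "AE x in leb n. norm \<bar>f x - s m x\<bar> \<le> 2 * w x" for m
    proof (rule AE_I2)
      fix x assume "x \<in> space (leb n)"
      then have "\<bar>f x\<bar> \<le> w x" "\<bar>s m x\<bar> \<le> w x" using fb bound by auto
      then show "norm \<bar>f x - s m x\<bar> \<le> 2 * w x" by simp
    qed
  qed (use w fm si in auto)
  then have lim0: "(\<lambda>m. \<integral>x. \<bar>f x - s m x\<bar> \<partial>leb n) \<longlonglongrightarrow> 0" by simp
  show ?thesis
  proof (rule cv_convergesI_approx[OF fi])
    fix e :: real assume "0 < e"
    then have "\<forall>\<^sub>F m in sequentially. (\<integral>x. \<bar>f x - s m x\<bar> \<partial>leb n) < e"
      using order_tendstoD(2)[OF lim0] by blast
    then obtain m where "(\<integral>x. \<bar>f x - s m x\<bar> \<partial>leb n) < e" using eventually_happens'[OF sequentially_bot] by blast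
    then show "\<exists>h. cv_converges n h \<and> (\<integral>x. \<bar>f x - h x\<bar> \<partial>leb n) < e" using s by blast
  qed
qed

lemma cv_converges_add:
  assumes "cv_converges n f" "cv_converges n g"
  shows "cv_converges n (\<lambda>x. f x + g x)"
proof -
  have i: "integrable (leb n) f" "integrable (leb n) g"
    and l: "(\<lambda>k. \<integral>x. \<bar>cv n k f x - f x\<bar> \<partial>leb n) \<longlonglongrightarrow> 0" "(\<lambda>k. \<integral>x. \<bar>cv n k g x - g x\<bar> \<partial>leb n) \<longlonglongrightarrow> 0"
    using assms unfolding cv_converges_def by auto
  note ic = integrable_cv[OF i(1)] integrable_cv[OF i(2)] integrable_cv[OF Bochner_Integration.integrable_add[OF i]] i
  have "(\<lambda>k. \<integral>x. \<bar>cv n k (\<lambda>x. f x + g x) x - (f x + g x)\<bar> \<partial>leb n) \<longlonglongrightarrow> 0"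
  proof (rule tendsto_sandwich[OF _ _ tendsto_const tendsto_add_zero[OF l]])
    show "\<forall>\<^sub>F k in sequentially. (\<integral>x. \<bar>cv n k (\<lambda>x. f x + g x) x - (f x + g x)\<bar> \<partial>leb n) \<le>
        (\<integral>x. \<bar>cv n k f x - f x\<bar> \<partial>leb n) + (\<integral>x. \<bar>cv n k g x - g x\<bar> \<partial>leb n)"
    proof (intro always_eventually allI)
      fix k
      have "(\<integral>x. \<bar>cv n k (\<lambda>x. f x + g x) x - (f x + g x)\<bar> \<partial>leb n) \<le>
        (\<integral>x. \<bar>cv n k f x - f x\<bar> + \<bar>cv n k g x - g x\<bar> \<partial>leb n)"
        by (rule integral_mono) (use ic in \<open>auto simp: cv_add\<close>)
      then show "(\<integral>x. \<bar>cv n k (\<lambda>x. f x + g x) x - (f x + g x)\<bar> \<partial>leb n) \<le>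
        (\<integral>x. \<bar>cv n k f x - f x\<bar> \<partial>leb n) + (\<integral>x. \<bar>cv n k g x - g x\<bar> \<partial>leb n)"
        using ic by simp
    qed
  qed (auto simp: integral_nonneg_AE)
  then show ?thesis using i unfolding cv_converges_def by simp
qed

lemma cv_converges_cmult:
  assumes "cv_converges n f"
  shows "cv_converges n (\<lambda>x. c * f x)"
proof -
  have "(\<lambda>k. \<bar>c\<bar> * (\<integral>x. \<bar>cv n k f x - f x\<bar> \<partial>leb n)) \<longlonglongrightarrow> \<bar>c\<bar> * 0"
    using assms unfolding cv_converges_def by (intro tendsto_intros) simp
  then show ?thesis
    using assms unfolding cv_converges_def cv_cmult right_diff_distrib[symmetric] abs_mult by simp
qed

text \<open>Uniform convergence on a cube of finite measure gives convergence in L^1. All mollified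
  functions live in the cube of radius R + 1, since no kernel is wider than 1.\<close>

lemma cv_converges_continuous:
  assumes h: "h \<in> C_on n (topspace (Rn n))" and R: "0 < R" "\<And>x. x \<notin> ccube n (\<lambda>_. 0) R \<Longrightarrow> h x = 0"
  shows "cv_converges n h"
proof -
  let ?T = "topspace (Rn n)" and ?Q = "\<lambda>r. ccube n (\<lambda>_. 0) r"
  have T: "openin (Rn n) ?T" by (rule openin_topspace)
  have finQ: "emeasure (leb n) (?Q r) < \<infinity>" for r
    by (rule emeasure_compact_finite[OF compactin_ccube])
  have setQ: "?Q r \<in> sets (leb n)" for r by (intro sets_PL_leb ccube_sets)
  obtain B where B: "0 \<le> B" "\<And>x. x \<in> ?Q R \<Longrightarrow> \<bar>h x\<bar> \<le> B"
    using C_on_bounded_on_compact[OF h compactin_ccube ccube_subset_topspace] by blast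
  have "(\<lambda>x. indicator ?T x *\<^sub>R h x) \<in> borel_measurable (PL n)"
    using C_on_measurable[OF h T] openin_sets[OF T]
    by (subst (asm) borel_measurable_restrict_space_iff) (auto simp: space_PiM)
  then have "h \<in> borel_measurable (PL n)"
    by (rule measurable_cong[THEN iffD1, rotated]) (simp add: space_PiM)
  then have hm: "h \<in> borel_measurable (leb n)" by (rule measurable_leb)
  have hi: "integrable (leb n) h"
  proof (rule Bochner_Integration.integrable_bound[of _ "\<lambda>x. B * indicator (?Q R) x"])
    show "integrable (leb n) (\<lambda>x. B * indicator (?Q R) x)" using finQ setQ by simp
    show "AE x in leb n. norm (h x) \<le> norm (B * indicator (?Q R) x)"
      using B R by (intro AE_I2) (auto simp: indicator_def)
  qed fact
  have "(\<lambda>k. \<integral>x. \<bar>cv n k h x - h x\<bar> \<partial>leb n) \<longlonglongrightarrow> 0"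
  proof (rule LIMSEQ_I)
    fix r :: real assume "0 < r"
    define e where "e = r / (measure (leb n) (?Q (R + 1)) + 1)"
    have e: "0 < e" using \<open>0 < r\<close> by (auto simp: e_def intro!: divide_pos_pos add_nonneg_pos)
    have er: "e * measure (leb n) (?Q (R + 1)) < r"
    proof -
      have "e * (measure (leb n) (?Q (R + 1)) + 1) = r"
        using measure_nonneg[of "leb n" "?Q (R + 1)"] unfolding e_def by (simp add: add_nonneg_eq_0_iff)
      then show ?thesis using e by (simp add: algebra_simps)
    qed
    have "\<forall>\<^sub>F k in sequentially. \<forall>x\<in>?Q (R + 1). \<bar>cv n k h x - h x\<bar> \<le> e"
      by (rule cv_uniform_limit[OF h T compactin_ccube ccube_subset_topspace hi zero_less_one refl e])
    then obtain N where N: "\<And>k x. N \<le> k \<Longrightarrow> x \<in> ?Q (R + 1) \<Longrightarrow> \<bar>cv n k h x - h x\<bar> \<le> e"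
      unfolding eventually_sequentially by blast
    show "\<exists>no. \<forall>k\<ge>no. norm ((\<integral>x. \<bar>cv n k h x - h x\<bar> \<partial>leb n) - 0) < r"
    proof (intro exI[of _ N] allI impI)
      fix k assume k: "N \<le> k"
      have "(\<integral>x. \<bar>cv n k h x - h x\<bar> \<partial>leb n) \<le> (\<integral>x. e * indicator (?Q (R + 1)) x \<partial>leb n)"
      proof (rule integral_mono)
        show "integrable (leb n) (\<lambda>x. \<bar>cv n k h x - h x\<bar>)" using integrable_cv[OF hi] hi by simp
        show "integrable (leb n) (\<lambda>x. e * indicator (?Q (R + 1)) x)" using finQ setQ by simp
        fix x assume "x \<in> space (leb n)"
        then have xt: "x \<in> ?T" by (simp only: space_leb)
        show "\<bar>cv n k h x - h x\<bar> \<le> e * indicator (?Q (R + 1)) x"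
        proof (cases "x \<in> ?Q (R + 1)")
          case False
          have "x \<notin> ?Q R" using False ccube_mono[of R "R + 1"] by auto
          moreover have "cv n k h x = 0"
          proof (rule cv_zero_outside)
            fix y assume y: "y \<in> ccube n x (1 / (real k + 1))"
            have "y \<notin> ?Q R"
            proof
              assume "y \<in> ?Q R"
              then have "x \<in> ?Q (R + 1 / (real k + 1))"
                using ccube_triangle ccube_sym[OF y xt] by blast
              moreover have "?Q (R + 1 / (real k + 1)) \<subseteq> ?Q (R + 1)" by (rule ccube_mono) simp
              ultimately show False using False by blast
            qed
            then show "h y = 0" by (rule R(2))
          qed
          ultimately show ?thesis using R(2) False by simp
        qed (use N[OF k] in simp)
      qed
      also have "\<dots> = e * measure (leb n) (?Q (R + 1))" using setQ finQ by simp
      finally show "norm ((\<integral>x. \<bar>cv n k h x - h x\<bar> \<partial>leb n) - 0) < r"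
        using er by (simp add: integral_nonneg_AE)
    qed
  qed
  then show ?thesis unfolding cv_converges_def using hi by simp
qed

lemma C_on_projection: "j < n \<Longrightarrow> continuous_map (Rn n) euclideanreal (\<lambda>x. x j)"
  by (rule continuous_map_product_projection) simp

text \<open>\<open>d\<close> is the l^1 distance to the box, so the functions max 0 (1 - (m + 1) d)
  are continuous and decrease to the indicator of the closed box.\<close>

lemma cv_converges_box: "cv_converges n (indicator (\<Pi>\<^sub>E j\<in>{..<n}. {a j..b j}))"
proof -
  let ?B = "\<Pi>\<^sub>E j\<in>{..<n}. {a j..b j}"
  define d where "d x = (\<Sum>j<n. max 0 (a j - x j) + max 0 (x j - b j))" for x :: point
  \<comment> \<open>Off the space of extensional functions the value is set to 0, so that
    \<open>h m\<close> vanishes outside a cube as a total function.\<close>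
  define h where "h m x = (if x \<in> topspace (Rn n) then max 0 (1 - real (Suc m) * d x) else 0)" for m x
  \<comment> \<open>Outside the cube of this radius some coordinate is at least 1 away from the box,
    so d \<ge> 1 and every \<open>h m\<close> vanishes.\<close>
  define R where "R = (\<Sum>j<n. \<bar>a j\<bar> + \<bar>b j\<bar>) + 1"
  have R: "0 < R" unfolding R_def by (intro add_nonneg_pos sum_nonneg) auto
  have d0: "0 \<le> d x" for x unfolding d_def by (intro sum_nonneg) auto
  have dge: "max 0 (a j - x j) + max 0 (x j - b j) \<le> d x" if "j < n" for j x
    unfolding d_def using that by (intro member_le_sum[of j "{..<n}" "\<lambda>j. max 0 (a j - x j) + max 0 (x j - b j)"]) auto
  have "max 0 (s - t) + max 0 (t - r) = 0 \<longleftrightarrow> s \<le> t \<and> t \<le> r" for s t r :: real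
    by (auto simp: max_def)
  then have dzero: "d x = 0 \<longleftrightarrow> (\<forall>j<n. a j \<le> x j \<and> x j \<le> b j)" for x
    unfolding d_def by (subst sum_nonneg_eq_0_iff) auto
  have hz: "h m x = 0" if x: "x \<notin> ccube n (\<lambda>_. 0) R" for m x
  proof (cases "x \<in> topspace (Rn n)")
    case True
    then obtain j where j: "j < n" "R < \<bar>x j\<bar>" using x by (auto simp: mem_ccube simp del: topspace_product_topology)
    have "\<bar>a j\<bar> + \<bar>b j\<bar> \<le> (\<Sum>j<n. \<bar>a j\<bar> + \<bar>b j\<bar>)"
      using j(1) by (intro member_le_sum[of j "{..<n}" "\<lambda>j. \<bar>a j\<bar> + \<bar>b j\<bar>"]) auto
    then have "1 \<le> max 0 (a j - x j) + max 0 (x j - b j)" using j(2) unfolding R_def by linarith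
    then have "1 \<le> d x" using dge[OF j(1), of x] by linarith
    then have "1 * 1 \<le> real (Suc m) * d x" by (intro mult_mono) auto
    then show ?thesis by (simp add: h_def)
  qed (auto simp: h_def)
  have hc: "h m \<in> C_on n (topspace (Rn n))" for m
  proof -
    have "continuous_map (Rn n) euclideanreal (\<lambda>x. max 0 (1 - real (Suc m) * d x))"
      unfolding d_def by (intro continuous_intros continuous_map_sum C_on_projection) auto
    then have "continuous_map (Rn n) euclideanreal (h m)"
      by (rule continuous_map_eq) (simp add: h_def)
    then show ?thesis unfolding C_on_def by (auto intro: continuous_map_from_subtopology)
  qed
  show ?thesis
  proof (rule cv_converges_limit)
    show "cv_converges n (h m)" for m by (rule cv_converges_continuous[OF hc R hz])
    show "integrable (leb n) (indicator (ccube n (\<lambda>_. 0) R) :: _ \<Rightarrow> real)"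
      using emeasure_compact_finite[OF compactin_ccube] sets_PL_leb[OF ccube_sets] by auto
    show "\<bar>h m x\<bar> \<le> indicator (ccube n (\<lambda>_. 0) R) x" for m x
      using hz[of x m] d0[of x] by (cases "x \<in> ccube n (\<lambda>_. 0) R") (auto simp: h_def)
    fix x assume "x \<in> space (leb n)"
    then have xt: "x \<in> topspace (Rn n)" by (simp only: space_leb)
    show "(\<lambda>m. h m x) \<longlonglongrightarrow> indicator ?B x"
    proof (cases "x \<in> ?B")
      case True
      then have "d x = 0" unfolding dzero by (auto simp: PiE_iff)
      then show ?thesis using True xt by (simp add: h_def)
    next
      case False
      have "d x \<noteq> 0" using False xt unfolding dzero by (auto simp: PiE_iff)
      then have dp: "0 < d x" using d0[of x] by linarith
      obtain N :: nat where N: "1 / d x < real N" using reals_Archimedean2 by blast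
      have "\<forall>\<^sub>F m in sequentially. h m x = 0"
      proof (rule eventually_sequentiallyI[of N])
        fix m assume "N \<le> m"
        then have "1 / d x \<le> real (Suc m)" using N by linarith
        then have "1 \<le> real (Suc m) * d x" using dp by (simp add: field_simps)
        then show "h m x = 0" by (simp add: h_def)
      qed
      then show ?thesis using False by (simp add: tendsto_eventually)
    qed
  qed
qed

text \<open>Lower orthants are stable under intersection, as Dynkin's theorem requires. They
  generate because a half space in one coordinate is the countable union of orthants whose other
  bounds tend to infinity.\<close>

lemma sets_PL_boxes:
  "sets (PL n) = sigma_sets (space (PL n)) (range (\<lambda>c :: nat \<Rightarrow> real. \<Pi>\<^sub>E j\<in>{..<n}. {..c j}))" (is "_ = sigma_sets _ ?E")
proof
  have EP: "?E \<subseteq> sets (PL n)" by (auto intro!: sets_PiM_I_finite)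
  then show "sigma_sets (space (PL n)) ?E \<subseteq> sets (PL n)" by (intro sets.sigma_sets_subset)
  have EPow: "?E \<subseteq> Pow (space (PL n))" by (auto simp: space_PiM PiE_iff)
  define N where "N = sigma (space (PL n)) ?E"
  have sN: "space N = space (PL n)" unfolding N_def by (rule space_measure_of[OF EPow])
  have setsN: "sets N = sigma_sets (space (PL n)) ?E" unfolding N_def by (rule sets_measure_of[OF EPow])
  have coord: "(\<lambda>x. x i) \<in> borel_measurable N" if i: "i < n" for i
    unfolding borel_measurable_iff_le
  proof
    fix a
    have "{x \<in> space N. x i \<le> a} = (\<Union>m::nat. \<Pi>\<^sub>E j\<in>{..<n}. {..(if j = i then a else real m)})"
    proof (intro set_eqI iffI)
      fix x assume x: "x \<in> {x \<in> space N. x i \<le> a}"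
      obtain m :: nat where m: "(\<Sum>j<n. \<bar>x j\<bar>) < real m" using reals_Archimedean2 by blast
      have "x j \<le> real m" if "j < n" for j
        using member_le_sum[of j "{..<n}" "\<lambda>j. \<bar>x j\<bar>"] that m by simp
      then have "x \<in> (\<Pi>\<^sub>E j\<in>{..<n}. {..(if j = i then a else real m)})"
        using x by (auto simp: sN space_PiM PiE_iff)
      then show "x \<in> (\<Union>m::nat. \<Pi>\<^sub>E j\<in>{..<n}. {..(if j = i then a else real m)})" by blast
    next
      fix x assume "x \<in> (\<Union>m::nat. \<Pi>\<^sub>E j\<in>{..<n}. {..(if j = i then a else real m)})"
      then obtain m :: nat where x: "x \<in> (\<Pi>\<^sub>E j\<in>{..<n}. {..(if j = i then a else real m)})" by blast
      then have "x i \<le> a" using i PiE_mem[OF x, of i] by simp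
      then show "x \<in> {x \<in> space N. x i \<le> a}" using x by (auto simp: sN space_PiM PiE_iff)
    qed
    also have "\<dots> \<in> sets N"
    proof (intro sets.countable_UN subsetI)
      fix A assume "A \<in> range (\<lambda>m. \<Pi>\<^sub>E j\<in>{..<n}. {..if j = i then a else real m})"
      then show "A \<in> sets N" unfolding setsN by (auto intro!: sigma_sets.Basic)
    qed
    finally show "{x \<in> space N. x i \<le> a} \<in> sets N" .
  qed
  have "sets (PL n) \<subseteq> sets N"
  proof (rule sets_PiM_in_sets)
    show "space N = (\<Pi>\<^sub>E i\<in>{..<n}. space lborel)" by (simp add: sN space_PiM)
    fix i :: nat and A :: "real set" assume "i \<in> {..<n}" "A \<in> sets lborel"
    then have "(\<lambda>x. x i) -` A \<inter> space N \<in> sets N" using coord by (intro measurable_sets) auto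
    moreover have "(\<lambda>x. x i) -` A \<inter> space N = {x \<in> space N. x i \<in> A}" by auto
    ultimately show "{x \<in> space N. x i \<in> A} \<in> sets N" by simp
  qed
  then show "sets (PL n) \<subseteq> sigma_sets (space (PL n)) ?E" unfolding setsN .
qed

text \<open>Dynkin's argument, starting from orthants, which the cube cuts down to boxes.
  Intersecting with a fixed cube makes the complement step a subtraction of integrable functions and
  gives the partial unions a common integrable bound.\<close>

lemma cv_converges_indicator_inter_cube:
  assumes A: "A \<in> sets (PL n)"
  shows "cv_converges n (indicator (A \<inter> ccube n (\<lambda>_. 0) R))"
proof -
  let ?Q = "ccube n (\<lambda>_. 0) R"
  let ?E = "(range (\<lambda>c :: nat \<Rightarrow> real. \<Pi>\<^sub>E j\<in>{..<n}. {..c j}))"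
  have Int: "Int_stable ?E"
  proof (rule Int_stableI)
    fix a b assume "a \<in> ?E" "b \<in> ?E"
    then obtain c d :: "nat \<Rightarrow> real" where "a = (\<Pi>\<^sub>E j\<in>{..<n}. {..c j})" "b = (\<Pi>\<^sub>E j\<in>{..<n}. {..d j})" by auto
    then have eq: "a \<inter> b = (\<Pi>\<^sub>E j\<in>{..<n}. {..min (c j) (d j)})"
      by (simp only: PiE_Int Int_atMost)
    show "a \<inter> b \<in> ?E" unfolding eq by (rule range_eqI[where x="\<lambda>j. min (c j) (d j)"]) (rule refl)
  qed
  have Q: "cv_converges n (indicator ?Q)" unfolding ccube_def by (rule cv_converges_box)
  have Qi: "integrable (leb n) (indicator ?Q :: _ \<Rightarrow> real)" using Q unfolding cv_converges_def by simp
  have EPow: "?E \<subseteq> Pow (space (PL n))" by (auto simp: space_PiM PiE_iff)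
  have "A \<in> sigma_sets (space (PL n)) ?E" using A unfolding sets_PL_boxes .
  with Int EPow show ?thesis
  proof (induct rule: sigma_sets_induct_disjoint)
    case (basic A)
    then obtain c :: "nat \<Rightarrow> real" where "A = (\<Pi>\<^sub>E j\<in>{..<n}. {..c j})" by blast
    moreover have "{..c j} \<inter> {0 - R..0 + R} = {- R..min (c j) R}" for j by auto
    ultimately have "A \<inter> ?Q = (\<Pi>\<^sub>E j\<in>{..<n}. {- R..min (c j) R})"
      by (simp only: ccube_def PiE_Int)
    then show ?case by (simp only: cv_converges_box)
  next
    case empty
    show ?case using cv_converges_cmult[OF Q, of 0] by (simp add: indicator_def)
  next
    case (compl A)
    have "?Q \<subseteq> space (PL n)" using ccube_subset_topspace by (simp only: space_PL)
    then have eq: "(indicator ((space (PL n) - A) \<inter> ?Q) :: _ \<Rightarrow> real) =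
        (\<lambda>x. indicator ?Q x + (-1) * indicator (A \<inter> ?Q) x)"
      by (auto simp: fun_eq_iff indicator_def)
    show ?case unfolding eq by (rule cv_converges_add[OF Q cv_converges_cmult[OF compl(2)]])
  next
    case (union A)
    let ?s = "\<lambda>m x. \<Sum>i<m. indicator (A i \<inter> ?Q) x :: real"
    show ?case
    proof (rule cv_converges_limit[OF _ Qi])
      show "cv_converges n (?s m)" for m
      proof (induction m)
        case 0
        show ?case using cv_converges_cmult[OF Q, of 0] by simp
      next
        case (Suc m)
        show ?case using cv_converges_add[OF Suc union(3)[of m]] by simp
      qed
      have eq: "?s m x = indicator ((\<Union>i<m. A i) \<inter> ?Q) x" for m x
      proof -
        have "disjoint_family_on (\<lambda>i. A i \<inter> ?Q) {..<m}"
          using union(1) by (auto simp: disjoint_family_on_def)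
        then have "indicator (\<Union>i\<in>{..<m}. A i \<inter> ?Q) x = ?s m x"
          by (intro indicator_UN_disjoint) auto
        moreover have "(\<Union>i\<in>{..<m}. A i \<inter> ?Q) = (\<Union>i<m. A i) \<inter> ?Q" by auto
        ultimately show ?thesis by simp
      qed
      show "\<bar>?s m x\<bar> \<le> indicator ?Q x" for m x unfolding eq by (auto simp: indicator_def)
      show "(\<lambda>m. ?s m x) \<longlonglongrightarrow> indicator (\<Union> (range A) \<inter> ?Q) x" for x
      proof (cases "x \<in> \<Union> (range A) \<inter> ?Q")
        case True
        then obtain i where i: "x \<in> A i" "x \<in> ?Q" by auto
        have "\<forall>\<^sub>F m in sequentially. ?s m x = 1"
          unfolding eq
          by (rule eventually_sequentiallyI[of "Suc i"]) (use i in \<open>auto simp: indicator_def intro!: bexI[of _ i]\<close>)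
        then show ?thesis using True by (simp add: tendsto_eventually)
      next
        case False
        then show ?thesis unfolding eq by (auto simp: indicator_def)
      qed
    qed
  qed
qed

text \<open>Sets of finite measure are exhausted by their intersections with growing cubes; from
  their indicators the usual induction over integrable functions leads to every integrable
  \<open>f\<close>.\<close>

lemma cv_tendsto_L1:
  assumes f: "integrable (leb n) f"
  shows "(\<lambda>k. \<integral>x. \<bar>cv n k f x - f x\<bar> \<partial>leb n) \<longlonglongrightarrow> 0"
proof -
  have ind: "cv_converges n (indicator A)" if A: "A \<in> sets (PL n)" "emeasure (PL n) A < \<infinity>" for A
  proof (rule cv_converges_limit)
    show "cv_converges n (indicator (A \<inter> ccube n (\<lambda>_. 0) (real m)))" for m
      by (rule cv_converges_indicator_inter_cube[OF A(1)])
    show "integrable (leb n) (indicator A :: _ \<Rightarrow> real)"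
      using A sets_PL_leb by (auto simp: emeasure_leb)
    show "\<bar>indicator (A \<inter> ccube n (\<lambda>_. 0) (real m)) x\<bar> \<le> (indicator A x :: real)" for m x
      by (auto simp: indicator_def)
    fix x assume "x \<in> space (leb n)"
    then have xt: "x \<in> topspace (Rn n)" by (simp only: space_leb)
    obtain N :: nat where N: "(\<Sum>j<n. \<bar>x j\<bar>) < real N" using reals_Archimedean2 by blast
    have "\<forall>\<^sub>F m in sequentially. indicator (A \<inter> ccube n (\<lambda>_. 0) (real m)) x = (indicator A x :: real)"
    proof (rule eventually_sequentiallyI[of N])
      fix m assume "N \<le> m"
      have "\<bar>x j - 0\<bar> \<le> real m" if "j < n" for j
        using member_le_sum[of j "{..<n}" "\<lambda>j. \<bar>x j\<bar>"] that N \<open>N \<le> m\<close> by simp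
      then have "x \<in> ccube n (\<lambda>_. 0) (real m)" using xt by (simp add: mem_ccube)
      then show "indicator (A \<inter> ccube n (\<lambda>_. 0) (real m)) x = (indicator A x :: real)" by (simp add: indicator_def)
    qed
    then show "(\<lambda>m. indicator (A \<inter> ccube n (\<lambda>_. 0) (real m)) x) \<longlonglongrightarrow> (indicator A x :: real)"
      by (rule tendsto_eventually)
  qed
  obtain g where g: "g \<in> borel_measurable (PL n)" and fg: "AE x in leb n. f x = g x"
    using ex_Borel_representative[OF borel_measurable_integrable[OF f]] .
  have gl: "g \<in> borel_measurable (leb n)" using g by (rule measurable_leb)
  have "integrable (PL n) g"
    using integrable_cong_AE[OF borel_measurable_integrable[OF f] gl fg] f g by (simp add: integrable_leb_iff)
  then have "cv_converges n g"
  proof (induct rule: integrable_induct)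
    case (base A c)
    then show ?case using cv_converges_cmult[OF ind[OF base], of c] by (simp add: mult.commute)
  next
    case (add f g)
    then show ?case by (intro cv_converges_add)
  next
    case (lim f s)
    show ?case
    proof (rule cv_converges_limit[OF lim(2)])
      show "integrable (leb n) (\<lambda>x. 2 * \<bar>f x\<bar>)"
        using lim(5) by (subst integrable_leb_iff) auto
      show "(\<lambda>m. s m x) \<longlonglongrightarrow> f x" if "x \<in> space (leb n)" for x
        using lim(3)[of x] that by (simp only: space_leb space_PL)
      show "\<bar>s m x\<bar> \<le> 2 * \<bar>f x\<bar>" if "x \<in> space (leb n)" for m x
        using lim(4)[of x m] that by (simp only: space_leb space_PL real_norm_def)
    qed
  qed
  then have "(\<lambda>k. \<integral>x. \<bar>cv n k g x - g x\<bar> \<partial>leb n) \<longlonglongrightarrow> 0" and ig: "integrable (leb n) g"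
    unfolding cv_converges_def by auto
  moreover have "(\<integral>x. \<bar>cv n k g x - g x\<bar> \<partial>leb n) = (\<integral>x. \<bar>cv n k f x - f x\<bar> \<partial>leb n)" for k
  proof -
    have "cv n k f = cv n k g"
      using borel_measurable_integrable[OF f] gl fg by (rule smooth_int_cong_AE)
    then show ?thesis
      using fg integrable_cv[OF ig, of k] ig f by (intro integral_cong_AE) auto
  qed
  ultimately show ?thesis by simp
qed

subsection \<open>Weak derivatives\<close>

lemma C_on_compose: "f \<in> C_on n \<Omega> \<Longrightarrow> continuous_on UNIV h \<Longrightarrow> (\<lambda>x. h (f x)) \<in> C_on n \<Omega>"
  using continuous_map_compose[of "subtopology (Rn n) \<Omega>" euclideanreal f euclideanreal h]
  by (simp add: C_on_def comp_def)

lemma C_on_mult: "f \<in> C_on n \<Omega> \<Longrightarrow> g \<in> C_on n \<Omega> \<Longrightarrow> (\<lambda>x. f x * g x) \<in> C_on n \<Omega>"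
  unfolding C_on_def by (simp add: continuous_map_real_mult)

lemma C_on_add: "f \<in> C_on n \<Omega> \<Longrightarrow> g \<in> C_on n \<Omega> \<Longrightarrow> (\<lambda>x. f x + g x) \<in> C_on n \<Omega>"
  unfolding C_on_def by (simp add: continuous_map_add)

lemma openin_sets_leb: "openin (Rn n) U \<Longrightarrow> U \<in> sets (leb n)"
  by (intro sets_PL_leb openin_sets)

lemma compactin_sets_leb: "compactin (Rn n) K \<Longrightarrow> K \<in> sets (leb n)"
  by (intro sets_PL_leb compactin_sets)

lemma measurable_restrict_leb:
  fixes f :: "point \<Rightarrow> real"
  assumes "\<Omega> \<in> sets (leb n)"
  shows "f \<in> borel_measurable (restrict_space (leb n) \<Omega>) \<longleftrightarrow>
    (\<lambda>x. indicator \<Omega> x * f x) \<in> borel_measurable (leb n)"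
  using assms sets.sets_into_space[OF assms]
  by (subst borel_measurable_restrict_space_iff) (auto simp: inf.absorb1)

lemma measurable_indicator_times_subset:
  fixes f :: "point \<Rightarrow> real"
  assumes "(\<lambda>x. indicator \<Omega> x * f x) \<in> borel_measurable (leb n)" "A \<in> sets (leb n)" "A \<subseteq> \<Omega>"
  shows "(\<lambda>x. indicator A x * f x) \<in> borel_measurable (leb n)"
proof -
  have "(\<lambda>x. indicator A x * (indicator \<Omega> x * f x)) \<in> borel_measurable (leb n)"
    using assms(2) by (intro borel_measurable_times[OF _ assms(1)]) auto
  moreover have "(\<lambda>x. indicator A x * (indicator \<Omega> x * f x)) = (\<lambda>x. indicator A x * f x)"
    using assms(3) by (auto simp: indicator_def fun_eq_iff)
  ultimately show ?thesis by simp
qed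

lemma C_on_measurable_leb:
  assumes "f \<in> C_on n \<Omega>" "openin (Rn n) \<Omega>"
  shows "(\<lambda>x. indicator \<Omega> x * f x) \<in> borel_measurable (PL n)"
  using C_on_measurable[OF assms] openin_sets[OF assms(2)] openin_subset[OF assms(2)]
  by (subst (asm) borel_measurable_restrict_space_iff) (auto simp: space_PiM inf.absorb1)

lemma integrable_indicator_compact:
  "compactin (Rn n) K \<Longrightarrow> integrable (leb n) (indicator K :: _ \<Rightarrow> real)"
  using emeasure_compact_finite compactin_sets_leb by auto

lemma integrable_indicator_mult_C_on:
  assumes \<Omega>: "openin (Rn n) \<Omega>" and K: "compactin (Rn n) K" "K \<subseteq> \<Omega>"
    and g: "integrable (leb n) (\<lambda>x. indicator K x * g x)" and \<phi>: "\<phi> \<in> C_on n \<Omega>"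
  shows "integrable (leb n) (\<lambda>x. indicator K x * (g x * \<phi> x))"
proof -
  obtain B where B: "0 \<le> B" "\<And>x. x \<in> K \<Longrightarrow> \<bar>\<phi> x\<bar> \<le> B"
    by (rule C_on_bounded_on_compact[OF \<phi> K]) blast
  have m: "(\<lambda>x. (indicator K x * g x) * (indicator \<Omega> x * \<phi> x)) \<in> borel_measurable (leb n)"
    by (rule borel_measurable_times[OF borel_measurable_integrable[OF g] measurable_leb[OF C_on_measurable_leb[OF \<phi> \<Omega>]]])
  have "integrable (leb n) (\<lambda>x. (indicator K x * g x) * (indicator \<Omega> x * \<phi> x))"
  proof (rule Bochner_Integration.integrable_bound[of _ "\<lambda>x. B * (indicator K x * g x)"])
    show "integrable (leb n) (\<lambda>x. B * (indicator K x * g x))" using g by (rule Bochner_Integration.integrable_mult_right)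
    show "AE x in leb n. norm ((indicator K x * g x) * (indicator \<Omega> x * \<phi> x)) \<le> norm (B * (indicator K x * g x))"
    proof (rule AE_I2)
      fix x
      show "norm ((indicator K x * g x) * (indicator \<Omega> x * \<phi> x)) \<le> norm (B * (indicator K x * g x))"
      proof (cases "x \<in> K")
        case True
        have "\<bar>g x\<bar> * \<bar>\<phi> x\<bar> \<le> \<bar>g x\<bar> * B" using B(2)[OF True] by (intro mult_left_mono) auto
        then show ?thesis using True K(2) B(1) by (auto simp: abs_mult mult.commute)
      qed simp
    qed
  qed (rule m)
  moreover have "(\<lambda>x. (indicator K x * g x) * (indicator \<Omega> x * \<phi> x)) = (\<lambda>x. indicator K x * (g x * \<phi> x))"
    using K(2) by (auto simp: indicator_def fun_eq_iff)
  ultimately show ?thesis by simp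
qed

lemma integrable_indicator_C_on:
  assumes \<Omega>: "openin (Rn n) \<Omega>" and K: "compactin (Rn n) K" "K \<subseteq> \<Omega>" and \<phi>: "\<phi> \<in> C_on n \<Omega>"
  shows "integrable (leb n) (\<lambda>x. indicator K x * \<phi> x)"
  using integrable_indicator_mult_C_on[OF \<Omega> K _ \<phi>, of "\<lambda>_. 1"] integrable_indicator_compact[OF K(1)] by simp

lemma Lp_loc_1_iff:
  assumes \<Omega>: "openin (Rn n) \<Omega>"
  shows "f \<in> Lp_loc n 1 \<Omega> \<longleftrightarrow> (\<lambda>x. indicator \<Omega> x * f x) \<in> borel_measurable (leb n) \<and>
    (\<forall>K. compactin (Rn n) K \<and> K \<subseteq> \<Omega> \<longrightarrow> integrable (leb n) (\<lambda>x. indicator K x * f x))"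
proof -
  have "set_integrable (leb n) K (\<lambda>x. \<bar>f x\<bar> powr 1) \<longleftrightarrow> integrable (leb n) (\<lambda>x. indicator K x * f x)"
    if K: "compactin (Rn n) K" "K \<subseteq> \<Omega>" and m: "(\<lambda>x. indicator \<Omega> x * f x) \<in> borel_measurable (leb n)" for K
  proof -
    have km: "(\<lambda>x. indicator K x * f x) \<in> borel_measurable (leb n)"
      by (rule measurable_indicator_times_subset[OF m compactin_sets_leb[OF K(1)] K(2)])
    have eq: "(\<lambda>x. indicator K x *\<^sub>R (\<bar>f x\<bar> powr 1)) = (\<lambda>x. \<bar>indicator K x * f x\<bar>)"
      by (auto simp: indicator_def fun_eq_iff)
    show ?thesis unfolding set_integrable_def eq using km by (rule integrable_abs_iff)
  qed
  then show ?thesis unfolding Lp_loc_def measurable_restrict_leb[OF openin_sets_leb[OF \<Omega>]] by blast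
qed

lemma C_on_Lp_loc_1: "openin (Rn n) \<Omega> \<Longrightarrow> f \<in> C_on n \<Omega> \<Longrightarrow> f \<in> Lp_loc n 1 \<Omega>"
  unfolding Lp_loc_1_iff
  using measurable_leb[OF C_on_measurable_leb] integrable_indicator_C_on by blast

lemma C_c_compact_support:
  assumes "\<phi> \<in> C_c n \<Omega>" and \<Omega>: "openin (Rn n) \<Omega>"
  obtains K where "compactin (Rn n) K" "K \<subseteq> \<Omega>" "\<And>x. x \<in> \<Omega> \<Longrightarrow> x \<notin> K \<Longrightarrow> \<phi> x = 0"
proof (rule that[of "Rn n closure_of {x \<in> \<Omega>. \<phi> x \<noteq> 0}"])
  have cc: "compactly_contained n {x \<in> \<Omega>. \<phi> x \<noteq> 0} \<Omega>" using assms unfolding C_c_def by simp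
  then show "compactin (Rn n) (Rn n closure_of {x \<in> \<Omega>. \<phi> x \<noteq> 0})" "Rn n closure_of {x \<in> \<Omega>. \<phi> x \<noteq> 0} \<subseteq> \<Omega>"
    unfolding compactly_contained_def by simp_all
  have "{x \<in> \<Omega>. \<phi> x \<noteq> 0} \<subseteq> topspace (Rn n)" using openin_subset[OF \<Omega>] by (auto simp del: topspace_product_topology)
  then have sub: "{x \<in> \<Omega>. \<phi> x \<noteq> 0} \<subseteq> Rn n closure_of {x \<in> \<Omega>. \<phi> x \<noteq> 0}"
    by (rule closure_of_subset)
  show "\<phi> x = 0" if "x \<in> \<Omega>" "x \<notin> Rn n closure_of {x \<in> \<Omega>. \<phi> x \<noteq> 0}" for x
    using subsetD[OF sub, of x] that by auto
qed

text \<open>The kernel sees \<open>f\<close> only on its cube, so cutting to \<open>L\<close>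
  changes nothing. This links the integrals over \<Omega> in the definition of weak derivatives with
  convolutions of functions integrable on the whole space.\<close>

lemma set_integral_mker:
  assumes "ccube n x (1 / (real k + 1)) \<subseteq> L" "L \<subseteq> \<Omega>"
  shows "(LINT y:\<Omega>|leb n. f y * mker n k \<alpha> x y) = smooth_int n k (leb n) (\<lambda>y. indicator L y * f y) \<alpha> x"
  unfolding set_lebesgue_integral_def smooth_int_def
proof (rule Bochner_Integration.integral_cong)
  fix y assume "y \<in> space (leb n)"
  then have y: "y \<in> topspace (Rn n)" by (simp only: space_leb)
  show "indicator \<Omega> y *\<^sub>R (f y * mker n k \<alpha> x y) = indicator L y * f y * mker n k \<alpha> x y"
    using mker_zero_outside[OF y, of x k \<alpha>] assms by (cases "y \<in> L") auto
qed simp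

text \<open>The translated kernel serves as test function: the derivative of the mollification is
  the mollification of the weak derivative, as long as the kernel cube stays in \<open>L\<close>.
  The two minus signs, from the test identity and from the antisymmetric kernel derivative,
  cancel.\<close>

lemma smooth_int_weak_pderiv:
  assumes w: "is_weak_pderiv n \<Omega> i f g" and i: "i < n" and \<Omega>: "openin (Rn n) \<Omega>"
    and x: "x \<in> topspace (Rn n)" and L: "ccube n x (1 / (real k + 1)) \<subseteq> L" "L \<subseteq> \<Omega>"
  shows "smooth_int n k (leb n) (\<lambda>y. indicator L y * f y) ((\<lambda>_. 0)(i := Suc 0)) x =
    cv n k (\<lambda>y. indicator L y * g y) x"
proof -
  let ?m = "mker n k (\<lambda>_. 0) x"
  have sub: "ccube n x (1 / (real k + 1)) \<subseteq> \<Omega>" using L by blast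
  note t = mker_test_function[OF x sub \<Omega>]
  have "(LINT y:\<Omega>|leb n. f y * pderiv_at i ?m y) = - (LINT y:\<Omega>|leb n. g y * ?m y)"
    using w t(1) unfolding is_weak_pderiv_def by blast
  then have "(LINT y:\<Omega>|leb n. - (f y * mker n k ((\<lambda>_. 0)(i := Suc 0)) x y)) = - (LINT y:\<Omega>|leb n. g y * ?m y)"
    unfolding t(2)[OF i] by simp
  then have "(LINT y:\<Omega>|leb n. f y * mker n k ((\<lambda>_. 0)(i := Suc 0)) x y) = (LINT y:\<Omega>|leb n. g y * ?m y)"
    unfolding set_lebesgue_integral_def by simp
  then show ?thesis unfolding set_integral_mker[OF L] .
qed

lemma eventually_cube_subset:
  assumes "0 < \<epsilon>" "\<And>y. y \<in> K \<Longrightarrow> ccube n y \<epsilon> \<subseteq> L"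
  shows "\<forall>\<^sub>F k in sequentially. \<forall>y\<in>K. ccube n y (1 / (real k + 1)) \<subseteq> L"
proof -
  obtain N :: nat where N: "1 / (real N + 1) < \<epsilon>"
    using reals_Archimedean[of \<epsilon>] assms(1) by (auto simp: inverse_eq_divide add.commute)
  show ?thesis
  proof (rule eventually_sequentiallyI[of N], intro ballI)
    fix k y assume "N \<le> k" "y \<in> K"
    then have "1 / (real k + 1) \<le> 1 / (real N + 1)" by (intro divide_left_mono) auto
    then have "ccube n y (1 / (real k + 1)) \<subseteq> ccube n y \<epsilon>" using N by (intro ccube_mono) linarith
    then show "ccube n y (1 / (real k + 1)) \<subseteq> L" using assms(2)[OF \<open>y \<in> K\<close>] by blast
  qed
qed

text \<open>The fundamental lemma of the calculus of variations, with mollifier kernels as the only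
  test functions: on \<open>K\<close> the mollifications of the cut-off function vanish eventually,
  yet they converge to it in L^1.\<close>

lemma mker_orthogonal_imp_AE_zero:
  assumes \<Omega>: "openin (Rn n) \<Omega>" and f: "f \<in> Lp_loc n 1 \<Omega>"
    and zero: "\<And>x k. x \<in> topspace (Rn n) \<Longrightarrow> ccube n x (1 / (real k + 1)) \<subseteq> \<Omega> \<Longrightarrow>
      (LINT y:\<Omega>|leb n. f y * mker n k (\<lambda>_. 0) x y) = 0"
  shows "AE x in leb n. x \<in> \<Omega> \<longrightarrow> f x = 0"
proof -
  have fi: "integrable (leb n) (\<lambda>x. indicator K x * f x)" if "compactin (Rn n) K" "K \<subseteq> \<Omega>" for K
    using f that unfolding Lp_loc_1_iff[OF \<Omega>] by simp
  have K0: "AE x in leb n. x \<in> K \<longrightarrow> f x = 0" if K: "compactin (Rn n) K" "K \<subseteq> \<Omega>" for K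
  proof -
    obtain L \<epsilon> where L: "compactin (Rn n) L" "L \<subseteq> \<Omega>" "0 < \<epsilon>" "\<And>y. y \<in> K \<Longrightarrow> ccube n y \<epsilon> \<subseteq> L"
      by (rule compact_neighbourhood[OF K(1) \<Omega> K(2)]) blast
    let ?F = "\<lambda>y. indicator L y * f y"
    have F: "integrable (leb n) ?F" by (rule fi[OF L(1,2)])
    have Ks: "K \<in> sets (leb n)" by (rule compactin_sets_leb[OF K(1)])
    have KL: "K \<subseteq> L"
      using L(3,4) centre_mem_cube[of _ n \<epsilon>] compactin_subset_topspace[OF K(1)] by blast
    have ik: "integrable (leb n) (\<lambda>x. \<bar>indicator K x * f x\<bar>)" by (rule integrable_abs[OF fi[OF K]])
    have ev: "\<forall>\<^sub>F k in sequentially. \<forall>y\<in>K. ccube n y (1 / (real k + 1)) \<subseteq> L"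
      by (rule eventually_cube_subset[OF L(3)]) (rule L(4))
    have "\<forall>\<^sub>F k in sequentially. (\<integral>x. \<bar>indicator K x * f x\<bar> \<partial>leb n) \<le> (\<integral>x. \<bar>cv n k ?F x - ?F x\<bar> \<partial>leb n)"
      using ev
    proof eventually_elim
      case (elim k)
      have cz: "cv n k ?F x = 0" if x: "x \<in> K" for x
      proof -
        have c: "ccube n x (1 / (real k + 1)) \<subseteq> L" using elim x by blast
        have xt: "x \<in> topspace (Rn n)" using compactin_subset_topspace[OF K(1)] x by blast
        show ?thesis
          using zero[OF xt order_trans[OF c L(2)]] set_integral_mker[OF c L(2), of f "\<lambda>_. 0"] by simp
      qed
      show ?case
      proof (rule integral_mono[OF ik])
        show "integrable (leb n) (\<lambda>x. \<bar>cv n k ?F x - ?F x\<bar>)"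
          by (intro integrable_abs Bochner_Integration.integrable_diff integrable_cv F)
        show "\<bar>indicator K x * f x\<bar> \<le> \<bar>cv n k ?F x - ?F x\<bar>" for x
          using cz[of x] KL by (cases "x \<in> K") auto
      qed
    qed
    \<comment> \<open>The L^1 error bounds the integral over \<open>K\<close> for all large k and
      tends to 0.\<close>
    then have "(\<integral>x. \<bar>indicator K x * f x\<bar> \<partial>leb n) \<le> 0"
      by (rule tendsto_lowerbound[OF cv_tendsto_L1[OF F]]) simp
    then have "(\<integral>x. \<bar>indicator K x * f x\<bar> \<partial>leb n) = 0"
      by (intro antisym integral_nonneg_AE) auto
    then have "AE x in leb n. \<bar>indicator K x * f x\<bar> = 0"
      by (subst (asm) integral_nonneg_eq_0_iff_AE[OF ik]) auto
    then show ?thesis by eventually_elim (auto simp: indicator_def split: if_splits)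
  qed
  obtain K :: "nat \<Rightarrow> point set" where K: "\<And>m. compactin (Rn n) (K m)" "\<And>m. K m \<subseteq> \<Omega>" "\<Omega> = (\<Union>m. K m)"
    by (rule open_countable_compact_union[OF \<Omega>]) blast
  have "AE x in leb n. \<forall>m. x \<in> K m \<longrightarrow> f x = 0"
    unfolding AE_all_countable using K0[OF K(1,2)] by blast
  then show ?thesis unfolding K(3) by eventually_elim blast
qed

lemma C_c_inf_C_c: "\<phi> \<in> C_c_inf n \<Omega> \<Longrightarrow> \<phi> \<in> C_c n \<Omega>"
  unfolding C_c_inf_def by simp

lemma C_c_C_on: "\<phi> \<in> C_c n \<Omega> \<Longrightarrow> \<phi> \<in> C_on n \<Omega>"
  unfolding C_c_def by simp

lemma set_integral_compact_support:
  assumes K: "K \<subseteq> \<Omega>" and z: "\<And>x. x \<in> \<Omega> \<Longrightarrow> x \<notin> K \<Longrightarrow> h x = 0"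
  shows "(\<lambda>x. indicator \<Omega> x *\<^sub>R h x) = (\<lambda>x. indicator K x * (h x :: real))"
  using K z by (auto simp: indicator_def fun_eq_iff)

lemma set_integrable_test:
  assumes \<Omega>: "openin (Rn n) \<Omega>" and f: "f \<in> Lp_loc n 1 \<Omega>" and \<phi>: "\<phi> \<in> C_c n \<Omega>"
  shows "set_integrable (leb n) \<Omega> (\<lambda>x. f x * \<phi> x)"
proof -
  obtain K where K: "compactin (Rn n) K" "K \<subseteq> \<Omega>" "\<And>x. x \<in> \<Omega> \<Longrightarrow> x \<notin> K \<Longrightarrow> \<phi> x = 0"
    by (rule C_c_compact_support[OF \<phi> \<Omega>]) blast
  have "integrable (leb n) (\<lambda>x. indicator K x * (f x * \<phi> x))"
    using f K(1,2) C_c_C_on[OF \<phi>] unfolding Lp_loc_1_iff[OF \<Omega>]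
    by (intro integrable_indicator_mult_C_on[OF \<Omega>]) auto
  then show ?thesis
    unfolding set_integrable_def by (subst set_integral_compact_support[OF K(2)]) (auto simp: K(3))
qed

lemma Lp_loc_1_diff:
  assumes \<Omega>: "openin (Rn n) \<Omega>" and f: "f \<in> Lp_loc n 1 \<Omega>" "g \<in> Lp_loc n 1 \<Omega>"
  shows "(\<lambda>x. f x - g x) \<in> Lp_loc n 1 \<Omega>"
  using f unfolding Lp_loc_1_iff[OF \<Omega>] right_diff_distrib
  by (auto intro: Bochner_Integration.integrable_diff borel_measurable_diff)

text \<open>Since \<open>weak_pderiv\<close> is an arbitrary choice, this is what allows a
  derivative found by calculation to replace it almost everywhere.\<close>

lemma is_weak_pderiv_unique:
  assumes \<Omega>: "openin (Rn n) \<Omega>" and g: "is_weak_pderiv n \<Omega> i f g" and h: "is_weak_pderiv n \<Omega> i f h"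
  shows "AE x in leb n. x \<in> \<Omega> \<longrightarrow> g x = h x"
proof -
  have gl: "g \<in> Lp_loc n 1 \<Omega>" "h \<in> Lp_loc n 1 \<Omega>" using g h unfolding is_weak_pderiv_def by auto
  have "AE x in leb n. x \<in> \<Omega> \<longrightarrow> g x - h x = 0"
  proof (rule mker_orthogonal_imp_AE_zero[OF \<Omega> Lp_loc_1_diff[OF \<Omega> gl]])
    fix x k assume x: "x \<in> topspace (Rn n)" "ccube n x (1 / (real k + 1)) \<subseteq> \<Omega>"
    let ?m = "mker n k (\<lambda>_. 0) x"
    have \<phi>: "?m \<in> C_c_inf n \<Omega>" by (rule mker_test_function(1)[OF x \<Omega>])
    have "(LINT x:\<Omega>|leb n. g x * ?m x) = (LINT x:\<Omega>|leb n. h x * ?m x)"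
      using g h \<phi> unfolding is_weak_pderiv_def by fastforce
    then show "(LINT x:\<Omega>|leb n. (g x - h x) * ?m x) = 0"
      unfolding left_diff_distrib
      by (subst set_integral_diff(2)) (auto intro: set_integrable_test[OF \<Omega> _ C_c_inf_C_c[OF \<phi>]] gl)
  qed
  then show ?thesis by simp
qed

lemma is_weak_pderiv_weak_pderiv:
  "is_weak_pderiv n \<Omega> i f g \<Longrightarrow> is_weak_pderiv n \<Omega> i f (weak_pderiv n \<Omega> i f)"
  unfolding weak_pderiv_def by (rule someI[of "is_weak_pderiv n \<Omega> i f"])

text \<open>Tested with kernels supported in \<open>A\<close>, the weak derivative only meets values
  of \<open>f\<close> on \<open>A\<close>. Applied to \<psi> off its support, this confines the
  integrals over \<Omega> to a compact set.\<close>

lemma weak_pderiv_zero_where_zero: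
  assumes \<Omega>: "openin (Rn n) \<Omega>" and i: "i < n" and w: "is_weak_pderiv n \<Omega> i f g"
    and A: "openin (Rn n) A" "A \<subseteq> \<Omega>" and f: "\<And>x. x \<in> A \<Longrightarrow> f x = 0"
  shows "AE x in leb n. x \<in> A \<longrightarrow> g x = 0"
proof (rule mker_orthogonal_imp_AE_zero[OF A(1)])
  have g: "g \<in> Lp_loc n 1 \<Omega>" using w unfolding is_weak_pderiv_def by simp
  show "g \<in> Lp_loc n 1 A"
    using g A measurable_indicator_times_subset[OF _ openin_sets_leb[OF A(1)] A(2)]
    unfolding Lp_loc_1_iff[OF \<Omega>] Lp_loc_1_iff[OF A(1)] by (blast intro: order_trans)
  fix x k assume x: "x \<in> topspace (Rn n)" and c: "ccube n x (1 / (real k + 1)) \<subseteq> A"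
  let ?L = "ccube n x (1 / (real k + 1))"
  have "(LINT y:A|leb n. g y * mker n k (\<lambda>_. 0) x y) = cv n k (\<lambda>y. indicator ?L y * g y) x"
    by (rule set_integral_mker[OF order_refl c])
  also have "\<dots> = smooth_int n k (leb n) (\<lambda>y. indicator ?L y * f y) ((\<lambda>_. 0)(i := Suc 0)) x"
    by (rule smooth_int_weak_pderiv[OF w i \<Omega> x order_refl order_trans[OF c A(2)], symmetric])
  also have "\<dots> = 0"
    by (rule cv_zero_outside) (use f c in auto)
  finally show "(LINT y:A|leb n. g y * mker n k (\<lambda>_. 0) x y) = 0" .
qed

section \<open>Translation invariance and integrals of partial derivatives\<close>

lemma translation_PL:
  assumes i: "i < n"
  shows "distr (PL n) (PL n) (\<lambda>x. x(i := x i + h)) = PL n"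
    and "(\<lambda>x. x(i := x i + h)) \<in> measurable (PL n) (PL n)"
proof -
  show m: "(\<lambda>x. x(i := x i + h)) \<in> measurable (PL n) (PL n)"
  proof (rule measurable_PiM_single')
    fix j assume j: "j \<in> {..<n}"
    show "(\<lambda>x. (x(i := x i + h)) j) \<in> measurable (PL n) lborel"
      using coordinate_measurable_PL[of j n] coordinate_measurable_PL[OF i] j by (cases "j = i") auto
  qed (use i in \<open>auto simp: space_PiM PiE_iff extensional_def\<close>)
  show "distr (PL n) (PL n) (\<lambda>x. x(i := x i + h)) = PL n"
  proof (rule lborel_product.PiM_eqI)
    fix A :: "nat \<Rightarrow> real set" assume A: "\<And>j. j \<in> {..<n} \<Longrightarrow> A j \<in> sets lborel"
    define A' where "A' j = (if j = i then (\<lambda>t. t + h) -` A j else A j)" for j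
    have Ai: "A i \<in> sets borel" using A[of i] i by simp
    have A': "A' j \<in> sets lborel" if "j \<in> {..<n}" for j
      using A[OF that] measurable_sets[of "\<lambda>t. t + h" borel borel "A j"] by (auto simp: A'_def)
    have "(\<lambda>x. x(i := x i + h)) -` (Pi\<^sub>E {..<n} A) \<inter> space (PL n) = Pi\<^sub>E {..<n} A'"
    proof (rule set_eqI)
      fix x
      define z where "z = x(i := x i + h)"
      have "\<forall>j. z j \<in> A j \<longleftrightarrow> x j \<in> A' j" by (simp add: A'_def z_def)
      moreover have "x \<in> extensional {..<n} \<Longrightarrow> z \<in> extensional {..<n}"
        using i by (simp add: extensional_def z_def)
      ultimately show "x \<in> (\<lambda>x. x(i := x i + h)) -` (Pi\<^sub>E {..<n} A) \<inter> space (PL n) \<longleftrightarrow> x \<in> Pi\<^sub>E {..<n} A'"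
        by (auto simp: space_PiM PiE_iff simp flip: z_def)
    qed
    then have "emeasure (distr (PL n) (PL n) (\<lambda>x. x(i := x i + h))) (Pi\<^sub>E {..<n} A) = emeasure (PL n) (Pi\<^sub>E {..<n} A')"
      using A m by (subst emeasure_distr) (auto intro!: sets_PiM_I_finite)
    also have "\<dots> = (\<Prod>j\<in>{..<n}. emeasure lborel (A' j))"
      using A' by (intro lborel_product.emeasure_PiM) auto
    also have "\<dots> = (\<Prod>j\<in>{..<n}. emeasure lborel (A j))"
    proof (intro prod.cong refl)
      fix j assume "j \<in> {..<n}"
      show "emeasure lborel (A' j) = emeasure lborel (A j)"
      proof (cases "j = i")
        case True
        have "emeasure lborel (A i) = emeasure (distr lborel borel (\<lambda>t. h + t)) (A i)"
          by (simp add: lborel_distr_plus)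
        also have "\<dots> = emeasure lborel ((\<lambda>t. h + t) -` A i)"
          using Ai by (subst emeasure_distr) auto
        finally show ?thesis using True by (simp add: A'_def add.commute)
      qed (simp add: A'_def)
    qed
    finally show "emeasure (distr (PL n) (PL n) (\<lambda>x. x(i := x i + h))) (Pi\<^sub>E {..<n} A) = (\<Prod>j\<in>{..<n}. emeasure lborel (A j))" .
  qed auto
qed

text \<open>The difference quotients have integral zero by translation invariance.\<close>

lemma integral_pderiv_eq_0:
  assumes i: "i < n"
    and D: "\<And>x. x \<in> topspace (Rn n) \<Longrightarrow> ((\<lambda>t. w (x(i := t))) has_real_derivative D x) (at (x i))"
    and w: "w \<in> borel_measurable (PL n)" "integrable (leb n) w"
    and C: "\<And>x. x \<in> topspace (Rn n) \<Longrightarrow> \<bar>D x\<bar> \<le> C"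
    and R: "\<And>x. x \<in> topspace (Rn n) \<Longrightarrow> x \<notin> ccube n (\<lambda>_. 0) R \<Longrightarrow> w x = 0"
  shows "(\<integral>x. D x \<partial>leb n) = 0"
proof -
  define h :: "nat \<Rightarrow> real" where "h m = 1 / (real m + 1)" for m
  define T where "T m x = x(i := x i + h m)" for m and x :: point
  have h: "h m \<noteq> 0" "0 < h m" "h m \<le> 1" for m by (auto simp: h_def)
  have h0: "h \<longlonglongrightarrow> 0" unfolding h_def by real_asymp
  have Tm: "T m \<in> measurable (PL n) (PL n)" for m
    unfolding T_def by (rule translation_PL(2)[OF i])
  have wT: "(\<lambda>x. w (T m x)) \<in> borel_measurable (PL n)" for m
    by (rule measurable_compose[OF Tm w(1)])
  have wi: "integrable (PL n) w" using w by (simp add: integrable_leb_iff)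
  have iT: "integrable (PL n) (\<lambda>x. w (T m x))" "(\<integral>x. w (T m x) \<partial>PL n) = (\<integral>x. w x \<partial>PL n)" for m
  proof -
    have d: "distr (PL n) (PL n) (T m) = PL n" unfolding T_def by (rule translation_PL(1)[OF i])
    show "integrable (PL n) (\<lambda>x. w (T m x))"
      using integrable_distr[OF Tm, of m w] wi unfolding d by blast
    show "(\<integral>x. w (T m x) \<partial>PL n) = (\<integral>x. w x \<partial>PL n)"
      using integral_distr[OF Tm w(1), of m] unfolding d by simp
  qed
  let ?q = "\<lambda>m x. (w (T m x) - w x) / h m"
  have qm: "?q m \<in> borel_measurable (PL n)" for m
    using wT w(1) by (intro borel_measurable_divide borel_measurable_diff) auto
  have Tt: "x(i := t) \<in> topspace (Rn n)" if "x \<in> topspace (Rn n)" for x t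
    using that i by (auto simp: PiE_iff extensional_def)
  have ql: "(\<lambda>m. ?q m x) \<longlonglongrightarrow> D x" if x: "x \<in> topspace (Rn n)" for x
    using D[OF x] h h0 unfolding DERIV_def tendsto_at_iff_sequentially
    by (auto simp: comp_def T_def)
  have C0: "0 \<le> C" if "x \<in> topspace (Rn n)" for x using C[OF that] by linarith
  have qb: "\<bar>?q m x\<bar> \<le> C * indicator (ccube n (\<lambda>_. 0) (R + 1)) x" if x: "x \<in> topspace (Rn n)" for m x
  proof (cases "x \<in> ccube n (\<lambda>_. 0) (R + 1)")
    case True
    have "norm (w (x(i := x i + h m)) - w (x(i := x i))) \<le> C * norm (x i + h m - x i)"
    proof (rule field_differentiable_bound[where S=UNIV and f' = "\<lambda>t. D (x(i := t))"])
      fix t :: real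
      show "((\<lambda>t. w (x(i := t))) has_field_derivative D (x(i := t))) (at t within UNIV)"
        using D[OF Tt[OF x, of t]] by simp
      show "norm (D (x(i := t))) \<le> C" using C[OF Tt[OF x, of t]] by simp
    qed auto
    then have "\<bar>w (T m x) - w x\<bar> \<le> C * h m" using h(2)[of m] by (simp add: T_def)
    then show ?thesis using True h(2)[of m] by (simp add: abs_divide divide_le_eq)
  next
    case False
    have xR: "x \<notin> ccube n (\<lambda>_. 0) R" using False ccube_mono[of R "R + 1"] by auto
    have "T m x \<notin> ccube n (\<lambda>_. 0) R"
    proof
      assume a: "T m x \<in> ccube n (\<lambda>_. 0) R"
      have "\<bar>x j - 0\<bar> \<le> R + 1" if "j < n" for j
      proof -
        have "\<bar>T m x j - 0\<bar> \<le> R" using a that by (simp add: mem_ccube)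
        then show ?thesis using h(2,3)[of m] by (cases "j = i") (auto simp: T_def)
      qed
      then show False using False x by (simp add: mem_ccube)
    qed
    moreover have "T m x \<in> topspace (Rn n)" unfolding T_def by (rule Tt[OF x])
    ultimately show ?thesis using R xR x False by simp
  qed
  have ind: "integrable (PL n) (\<lambda>x. C * indicator (ccube n (\<lambda>_. 0) (R + 1)) x)"
    using emeasure_ccube_finite[of n "\<lambda>_. 0" "R + 1"] ccube_sets[of n "\<lambda>_. 0" "R + 1"] by simp
  have Dm: "D \<in> borel_measurable (PL n)"
    by (rule borel_measurable_LIMSEQ_real[of "PL n" ?q]) (use ql qm in \<open>auto simp only: space_PL\<close>)
  have "(\<lambda>m. \<integral>x. ?q m x \<partial>PL n) \<longlonglongrightarrow> (\<integral>x. D x \<partial>PL n)"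
  proof (rule integral_dominated_convergence[OF Dm qm ind])
    show "AE x in PL n. (\<lambda>m. ?q m x) \<longlonglongrightarrow> D x"
      using ql by (intro AE_I2) (simp only: space_PL)
    show "AE x in PL n. norm (?q m x) \<le> C * indicator (ccube n (\<lambda>_. 0) (R + 1)) x" for m
      using qb by (intro AE_I2) (simp only: space_PL real_norm_def)
  qed
  moreover have "(\<lambda>m. \<integral>x. ?q m x \<partial>PL n) = (\<lambda>_. 0)"
    using iT wi by simp
  ultimately have "(\<integral>x. D x \<partial>PL n) = 0" using LIMSEQ_unique[OF _ tendsto_const] by simp
  then show ?thesis using Dm by (simp add: integral_leb)
qed

text \<open>Writing a_k g_k - a' g' as a_k (g_k - g') + (a_k - a') g' pairs a uniform bound with L^1
  convergence and uniform convergence with an integrable factor.\<close>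

lemma tendsto_integral_uniform_L1:
  fixes a :: "nat \<Rightarrow> point \<Rightarrow> real" and g :: "nat \<Rightarrow> point \<Rightarrow> real" and a' g' :: "point \<Rightarrow> real"
  assumes K: "K \<in> sets (leb n)"
    and am: "\<And>k. (\<lambda>x. indicator K x * a k x) \<in> borel_measurable (leb n)"
    and a'm: "(\<lambda>x. indicator K x * a' x) \<in> borel_measurable (leb n)"
    and B: "\<And>x. x \<in> K \<Longrightarrow> \<bar>a' x\<bar> \<le> B"
    and unif: "\<And>e. 0 < e \<Longrightarrow> \<forall>\<^sub>F k in sequentially. \<forall>x\<in>K. \<bar>a k x - a' x\<bar> \<le> e"
    and g: "\<And>k. integrable (leb n) (g k)" "integrable (leb n) g'"
    and lim: "(\<lambda>k. \<integral>x. \<bar>g k x - g' x\<bar> \<partial>leb n) \<longlonglongrightarrow> 0"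
  shows "(\<lambda>k. \<integral>x. indicator K x * a k x * g k x \<partial>leb n) \<longlonglongrightarrow> (\<integral>x. indicator K x * a' x * g' x \<partial>leb n)"
proof -
  define B' where "B' = \<bar>B\<bar> + 1"
  define G where "G = (\<integral>x. \<bar>g' x\<bar> \<partial>leb n)"
  have int: "integrable (leb n) (\<lambda>x. indicator K x * b x * f x)"
    if "(\<lambda>x. indicator K x * b x) \<in> borel_measurable (leb n)" "\<And>x. x \<in> K \<Longrightarrow> \<bar>b x\<bar> \<le> c" "integrable (leb n) f"
    for b f :: "point \<Rightarrow> real" and c
  proof (rule Bochner_Integration.integrable_bound[of _ "\<lambda>x. c * f x"])
    show "integrable (leb n) (\<lambda>x. c * f x)" using that(3) by simp
    show "(\<lambda>x. indicator K x * b x * f x) \<in> borel_measurable (leb n)"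
      by (rule borel_measurable_times[OF that(1) borel_measurable_integrable[OF that(3)]])
    show "AE x in leb n. norm (indicator K x * b x * f x) \<le> norm (c * f x)"
    proof (rule AE_I2)
      fix x show "norm (indicator K x * b x * f x) \<le> norm (c * f x)"
        using that(2)[of x] by (cases "x \<in> K") (auto simp: abs_mult intro!: mult_right_mono)
    qed
  qed
  have ia': "integrable (leb n) (\<lambda>x. indicator K x * a' x * g' x)" by (rule int[OF a'm B g(2)])
  show ?thesis
  proof (rule LIMSEQ_I)
    fix r :: real assume r: "0 < r"
    \<comment> \<open>e \<le> 1 keeps |a_k| below B' = |B| + 1, and the other bound makes the term
      with g' smaller than r / 2. The summand 1 in G + 1 covers the case G = 0.\<close>
    define e where "e = min 1 (r / (2 * (G + 1)))"
    have G: "0 \<le> G" unfolding G_def by (intro integral_nonneg_AE) auto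
    have e: "0 < e" "e \<le> 1" "e * G < r / 2"
    proof -
      show "0 < e" "e \<le> 1" using r G by (auto simp: e_def)
      have "e * G \<le> r / (2 * (G + 1)) * G" using G by (intro mult_right_mono) (auto simp: e_def)
      also have "\<dots> < r / 2" using G r by (simp add: field_simps)
      finally show "e * G < r / 2" .
    qed
    have "\<forall>\<^sub>F k in sequentially. (\<integral>x. \<bar>g k x - g' x\<bar> \<partial>leb n) < r / (2 * B')"
      using r by (intro order_tendstoD(2)[OF lim]) (auto simp: B'_def intro!: divide_pos_pos add_nonneg_pos)
    then have "\<forall>\<^sub>F k in sequentially. norm ((\<integral>x. indicator K x * a k x * g k x \<partial>leb n) -
        (\<integral>x. indicator K x * a' x * g' x \<partial>leb n)) < r"
      using unif[OF e(1)]
    proof eventually_elim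
      case (elim k)
      have B'0: "0 < B'" by (auto simp: B'_def)
      have ab: "\<bar>a k x\<bar> \<le> B'" if "x \<in> K" for x
      proof -
        have "\<bar>a k x - a' x\<bar> \<le> 1" "\<bar>a' x\<bar> \<le> \<bar>B\<bar>" using elim(2) B[OF that] that e(2) by fastforce+
        then show ?thesis unfolding B'_def by linarith
      qed
      have ia: "integrable (leb n) (\<lambda>x. indicator K x * a k x * g k x)" by (rule int[OF am ab g(1)])
      have "\<bar>(\<integral>x. indicator K x * a k x * g k x \<partial>leb n) - (\<integral>x. indicator K x * a' x * g' x \<partial>leb n)\<bar> =
          \<bar>\<integral>x. indicator K x * a k x * g k x - indicator K x * a' x * g' x \<partial>leb n\<bar>"
        by (simp add: Bochner_Integration.integral_diff[OF ia ia'])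
      also have "\<dots> \<le> (\<integral>x. \<bar>indicator K x * a k x * g k x - indicator K x * a' x * g' x\<bar> \<partial>leb n)"
        by (rule integral_abs_bound)
      also have "\<dots> \<le> (\<integral>x. B' * \<bar>g k x - g' x\<bar> + e * \<bar>g' x\<bar> \<partial>leb n)"
      proof (rule integral_mono)
        show "integrable (leb n) (\<lambda>x. \<bar>indicator K x * a k x * g k x - indicator K x * a' x * g' x\<bar>)"
          by (intro integrable_abs Bochner_Integration.integrable_diff ia ia')
        show "integrable (leb n) (\<lambda>x. B' * \<bar>g k x - g' x\<bar> + e * \<bar>g' x\<bar>)" using g by simp
        fix x
        show "\<bar>indicator K x * a k x * g k x - indicator K x * a' x * g' x\<bar> \<le> B' * \<bar>g k x - g' x\<bar> + e * \<bar>g' x\<bar>"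
        proof (cases "x \<in> K")
          case True
          have "a k x * g k x - a' x * g' x = a k x * (g k x - g' x) + (a k x - a' x) * g' x"
            by (simp add: algebra_simps)
          then have "\<bar>a k x * g k x - a' x * g' x\<bar> \<le> \<bar>a k x\<bar> * \<bar>g k x - g' x\<bar> + \<bar>a k x - a' x\<bar> * \<bar>g' x\<bar>"
            unfolding abs_mult[symmetric] by (metis abs_triangle_ineq)
          also have "\<dots> \<le> B' * \<bar>g k x - g' x\<bar> + e * \<bar>g' x\<bar>"
            using ab[OF True] elim(2) True by (intro add_mono mult_right_mono) auto
          finally show ?thesis using True by simp
        next
          case False
          then show ?thesis using B'0 e(1) by simp
        qed
      qed
      also have "\<dots> = B' * (\<integral>x. \<bar>g k x - g' x\<bar> \<partial>leb n) + e * G" using g by (simp add: G_def)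
      also have "\<dots> < r / 2 + r / 2"
      proof (rule add_less_le_mono)
        show "B' * (\<integral>x. \<bar>g k x - g' x\<bar> \<partial>leb n) < r / 2" using elim(1) B'0 by (simp add: field_simps)
      qed (use e in simp)
      finally show ?case by simp
    qed
    then show "\<exists>no. \<forall>k\<ge>no. norm ((\<integral>x. indicator K x * a k x * g k x \<partial>leb n) -
        (\<integral>x. indicator K x * a' x * g' x \<partial>leb n)) < r"
      unfolding eventually_sequentially .
  qed
qed

section \<open>Extension of test functions by zero\<close>

lemma fun_upd_mem_topspace: "x \<in> topspace (Rn n) \<Longrightarrow> i < n \<Longrightarrow> x(i := t) \<in> topspace (Rn n)"
  by (auto simp: PiE_iff extensional_def)

lemma coordinate_line_derivative_local:
  assumes A: "openin (Rn n) A" "x \<in> A" and i: "i < n" and eq: "\<And>y. y \<in> A \<Longrightarrow> f y = g y"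
    and D: "((\<lambda>t. f (x(i := t))) has_real_derivative D) (at (x i))"
  shows "((\<lambda>t. g (x(i := t))) has_real_derivative D) (at (x i))"
proof -
  obtain r where r: "0 < r" "ccube n x r \<subseteq> A" using openin_contains_ccube[OF A] .
  have xt: "x \<in> topspace (Rn n)" using openin_subset[OF A(1)] A(2) by blast
  have "x(i := t) \<in> A" if "t \<in> ball (x i) r" for t
  proof -
    have "\<bar>(x(i := t)) j - x j\<bar> \<le> r" for j using that r(1) by (simp add: dist_real_def abs_minus_commute)
    then have "x(i := t) \<in> ccube n x r" using fun_upd_mem_topspace[OF xt i, of t] by (simp only: mem_ccube) blast
    then show ?thesis using r(2) by blast
  qed
  then show ?thesis
    using r(1) eq by (intro has_field_derivative_transform_within_open[OF D, of "ball (x i) r"]) auto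
qed

lemma openin_compl_compact: "compactin (Rn n) K \<Longrightarrow> openin (Rn n) (topspace (Rn n) - K)"
  using compactin_imp_closedin[of "Rn n" K] Hausdorff_space_product_topology[of "\<lambda>_. euclideanreal" "{..<n}"]
  by (simp add: closedin_def)

lemma test_function_derivative:
  assumes \<phi>: "\<phi> \<in> C_c_inf n \<Omega>" and i: "i < n"
  shows "pderiv_at i \<phi> \<in> C_on n \<Omega>"
    and "x \<in> \<Omega> \<Longrightarrow> ((\<lambda>t. \<phi> (x(i := t))) has_real_derivative pderiv_at i \<phi> x) (at (x i))"
proof -
  have "\<phi> \<in> C_k n (Suc 0) \<Omega>" using \<phi> unfolding C_c_inf_def by blast
  then have *: "pderiv_at i \<phi> \<in> C_on n \<Omega>" "\<forall>x\<in>\<Omega>. (\<lambda>t. \<phi> (x(i := t))) differentiable (at (x i))"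
    using i by auto
  show "pderiv_at i \<phi> \<in> C_on n \<Omega>" by (rule *(1))
  show "x \<in> \<Omega> \<Longrightarrow> ((\<lambda>t. \<phi> (x(i := t))) has_real_derivative pderiv_at i \<phi> x) (at (x i))"
    using *(2) unfolding pderiv_at_def by (simp add: DERIV_deriv_iff_real_differentiable)
qed

text \<open>The values of a test function off \<Omega> are arbitrary; after multiplication by the
  indicator it is differentiable along every coordinate line, because the open set \<Omega> and the
  open complement of \<open>K\<close> cover the whole space.\<close>

lemma test_function_extension:
  assumes \<phi>: "\<phi> \<in> C_c_inf n \<Omega>" and i: "i < n" and \<Omega>: "openin (Rn n) \<Omega>"
    and K: "compactin (Rn n) K" "K \<subseteq> \<Omega>" "\<forall>x\<in>\<Omega> - K. \<phi> x = 0"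
  shows "x \<in> topspace (Rn n) \<Longrightarrow>
      ((\<lambda>t. indicator \<Omega> (x(i := t)) * \<phi> (x(i := t))) has_real_derivative indicator \<Omega> x * pderiv_at i \<phi> x) (at (x i))"
    and "x \<in> \<Omega> \<Longrightarrow> x \<notin> K \<Longrightarrow> pderiv_at i \<phi> x = 0"
proof -
  let ?f = "\<lambda>x. indicator \<Omega> x * \<phi> x"
  have in\<Omega>: "((\<lambda>t. ?f (x(i := t))) has_real_derivative pderiv_at i \<phi> x) (at (x i))" if "x \<in> \<Omega>" for x
    by (rule coordinate_line_derivative_local[OF \<Omega> that i _ test_function_derivative(2)[OF \<phi> i that]]) simp
  have outK: "((\<lambda>t. ?f (x(i := t))) has_real_derivative 0) (at (x i))" if "x \<in> topspace (Rn n)" "x \<notin> K" for x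
  proof (rule coordinate_line_derivative_local[OF openin_compl_compact[OF K(1)] _ i])
    show "x \<in> topspace (Rn n) - K" using that by blast
    show "((\<lambda>t. (\<lambda>_. 0) (x(i := t))) has_real_derivative 0) (at (x i))" by simp
    show "0 = ?f y" if "y \<in> topspace (Rn n) - K" for y
      using that K(3) by (auto simp: indicator_def)
  qed
  show "((\<lambda>t. ?f (x(i := t))) has_real_derivative indicator \<Omega> x * pderiv_at i \<phi> x) (at (x i))" if "x \<in> topspace (Rn n)"
    using in\<Omega>[of x] outK[OF that] K(2) by (cases "x \<in> \<Omega>") auto
  show "pderiv_at i \<phi> x = 0" if x: "x \<in> \<Omega>" "x \<notin> K"
  proof -
    have "x \<in> topspace (Rn n)" using openin_subset[OF \<Omega>] x(1) by blast
    then show ?thesis using DERIV_unique[OF in\<Omega>[OF x(1)] outK] x(2) by blast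
  qed
qed

section \<open>Uniform limits under the integral sign\<close>

lemma cv_uniform_limit':
  assumes "f \<in> C_on n \<Omega>" "openin (Rn n) \<Omega>" "compactin (Rn n) K" "K \<subseteq> \<Omega>"
    and L: "integrable (leb n) (\<lambda>x. indicator L x * f x)" "0 < \<delta>" "\<And>y. y \<in> K \<Longrightarrow> ccube n y \<delta> \<subseteq> L"
  shows "uniform_limit K (\<lambda>k. cv n k (\<lambda>x. indicator L x * f x)) f sequentially"
  unfolding uniform_limit_iff dist_real_def
proof (intro allI impI)
  fix e :: real assume e: "0 < e"
  have "\<forall>\<^sub>F k in sequentially. \<forall>x\<in>K. \<bar>cv n k (\<lambda>x. indicator L x * f x) x - f x\<bar> \<le> e / 2"
  proof (rule cv_uniform_limit[OF assms(1-4) L(1,2)])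
    show "indicator L y * f y = f y" if "x \<in> K" "y \<in> ccube n x \<delta>" for x y
      using subsetD[OF L(3)[OF that(1)] that(2)] by simp
    show "0 < e / 2" using e by simp
  qed
  then show "\<forall>\<^sub>F k in sequentially. \<forall>x\<in>K. \<bar>cv n k (\<lambda>x. indicator L x * f x) x - f x\<bar> < e"
    by eventually_elim (use e in fastforce)
qed

text \<open>Boundedness of the limit confines almost all of the sequence to one compact interval, on
  which \<open>h\<close> is uniformly continuous.\<close>

lemma uniform_limit_continuous_compose:
  fixes h :: "real \<Rightarrow> real"
  assumes u: "uniform_limit K a a' sequentially" and B: "\<And>x. x \<in> K \<Longrightarrow> \<bar>a' x\<bar> \<le> B"
    and h: "continuous_on UNIV h"
  shows "uniform_limit K (\<lambda>k x. h (a k x)) (\<lambda>x. h (a' x)) sequentially"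
proof -
  have "uniform_limit K (\<lambda>k x. h (a k x)) (h \<circ> a') sequentially"
  proof (rule uniform_limit_compose[OF u])
    show "uniformly_continuous_on {- B - 1..B + 1} h"
      by (intro compact_uniformly_continuous continuous_on_subset[OF h]) auto
    show "\<forall>\<^sub>F k in sequentially. a k ` K \<subseteq> {- B - 1..B + 1}"
      using uniform_limitD[OF u zero_less_one]
    proof eventually_elim
      case (elim k)
      show ?case
      proof
        fix y assume "y \<in> a k ` K"
        then obtain x where x: "x \<in> K" "y = a k x" by blast
        have "\<bar>a k x - a' x\<bar> < 1" "\<bar>a' x\<bar> \<le> B" using elim B x by (auto simp: dist_real_def)
        then show "y \<in> {- B - 1..B + 1}" using x(2) by auto
      qed
    qed
    show "a' ` K \<subseteq> {- B - 1..B + 1}" using B by fastforce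
  qed
  then show ?thesis by (simp add: comp_def)
qed

lemma tendsto_integral_uniform_limit_L1:
  assumes \<Omega>: "openin (Rn n) \<Omega>" and K: "compactin (Rn n) K" "K \<subseteq> \<Omega>"
    and a: "\<And>k. a k \<in> C_on n \<Omega>" "a' \<in> C_on n \<Omega>"
    and unif: "uniform_limit K a a' sequentially"
    and g: "\<And>k. integrable (leb n) (g k)" "integrable (leb n) g'"
    and lim: "(\<lambda>k. \<integral>x. \<bar>g k x - g' x\<bar> \<partial>leb n) \<longlonglongrightarrow> 0"
  shows "(\<lambda>k. \<integral>x. indicator K x * a k x * g k x \<partial>leb n) \<longlonglongrightarrow> (\<integral>x. indicator K x * a' x * g' x \<partial>leb n)"
proof -
  obtain B where B: "0 \<le> B" "\<And>x. x \<in> K \<Longrightarrow> \<bar>a' x\<bar> \<le> B"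
    by (rule C_on_bounded_on_compact[OF a(2) K]) blast
  show ?thesis
  proof (rule tendsto_integral_uniform_L1[OF compactin_sets_leb[OF K(1)] _ _ B(2) _ g lim])
    show "(\<lambda>x. indicator K x * a k x) \<in> borel_measurable (leb n)" for k
      by (rule borel_measurable_integrable[OF integrable_indicator_C_on[OF \<Omega> K a(1)]])
    show "(\<lambda>x. indicator K x * a' x) \<in> borel_measurable (leb n)"
      by (rule borel_measurable_integrable[OF integrable_indicator_C_on[OF \<Omega> K a(2)]])
    show "\<forall>\<^sub>F k in sequentially. \<forall>x\<in>K. \<bar>a k x - a' x\<bar> \<le> e" if "0 < e" for e
      using uniform_limitD[OF unif that] by eventually_elim (auto simp: dist_real_def less_imp_le)
  qed
qed

lemma C_on_bounded_image:
  assumes "f \<in> C_on n \<Omega>" "compactin (Rn n) K" "K \<subseteq> \<Omega>"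
  shows "bounded (f ` K)"
proof -
  obtain B where "\<And>x. x \<in> K \<Longrightarrow> \<bar>f x\<bar> \<le> B" by (rule C_on_bounded_on_compact[OF assms]) blast
  then show ?thesis unfolding bounded_iff by auto
qed

text \<open>Integration by parts for a classically differentiable factor: the integrand is the
  derivative of v \<phi>, extended by 0 to a function with bounded derivative and compact
  support.\<close>

lemma integral_indicator_product_deriv_eq_0:
  assumes \<phi>: "\<phi> \<in> C_c_inf n \<Omega>" and i: "i < n" and \<Omega>: "openin (Rn n) \<Omega>"
    and K: "compactin (Rn n) K" "K \<subseteq> \<Omega>" "\<forall>x\<in>\<Omega> - K. \<phi> x = 0"
    and v: "v \<in> C_on n \<Omega>" "v' \<in> C_on n \<Omega>"
    and dv: "\<And>x. ((\<lambda>t. v (x(i := t))) has_real_derivative v' x) (at (x i))"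
  shows "(\<integral>x. indicator K x * (v' x * \<phi> x + v x * pderiv_at i \<phi> x) \<partial>leb n) = 0"
proof -
  note ext = test_function_extension[OF \<phi> i \<Omega> K]
  have \<phi>c: "\<phi> \<in> C_on n \<Omega>" using C_c_C_on[OF C_c_inf_C_c[OF \<phi>]] .
  define w where "w x = v x * (indicator \<Omega> x * \<phi> x)" for x
  define d where "d x = v' x * \<phi> x + v x * pderiv_at i \<phi> x" for x
  have dc: "d \<in> C_on n \<Omega>" unfolding d_def
    by (intro C_on_add C_on_mult v \<phi>c test_function_derivative(1)[OF \<phi> i])
  have dK: "indicator \<Omega> x * d x = indicator K x * d x" for x
    using K(2,3) ext(2)[of x] by (auto simp: indicator_def d_def)
  have wK: "w = (\<lambda>x. indicator K x * (v x * \<phi> x))"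
    using K(2,3) by (auto simp: indicator_def w_def fun_eq_iff)
  have w\<Omega>: "w = (\<lambda>x. indicator \<Omega> x * (v x * \<phi> x))"
    by (auto simp: w_def fun_eq_iff)
  obtain R where R: "0 < R" "K \<subseteq> ccube n (\<lambda>_. 0) R" by (rule compact_subset_ccube[OF K(1)]) blast
  obtain C where C: "0 \<le> C" "\<And>x. x \<in> K \<Longrightarrow> \<bar>d x\<bar> \<le> C"
    by (rule C_on_bounded_on_compact[OF dc K(1,2)]) blast
  have "(\<integral>x. indicator \<Omega> x * d x \<partial>leb n) = 0"
  proof (rule integral_pderiv_eq_0[OF i])
    fix x assume x: "x \<in> topspace (Rn n)"
    have "((\<lambda>t. v (x(i := t)) * (indicator \<Omega> (x(i := t)) * \<phi> (x(i := t)))) has_real_derivative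
        v' x * (indicator \<Omega> (x(i := x i)) * \<phi> (x(i := x i))) + indicator \<Omega> x * pderiv_at i \<phi> x * v (x(i := x i))) (at (x i))"
      by (rule DERIV_mult[OF dv[of x] ext(1)[OF x]])
    then show "((\<lambda>t. w (x(i := t))) has_real_derivative indicator \<Omega> x * d x) (at (x i))"
      unfolding w_def d_def by (simp add: algebra_simps)
    show "\<bar>indicator \<Omega> x * d x\<bar> \<le> C"
      using C unfolding dK by (auto simp: indicator_def)
    show "x \<notin> ccube n (\<lambda>_. 0) R \<Longrightarrow> w x = 0" using R(2) unfolding wK by (auto simp: indicator_def)
  next
    show "w \<in> borel_measurable (PL n)" unfolding w\<Omega>
      by (rule C_on_measurable_leb[OF C_on_mult[OF v(1) \<phi>c] \<Omega>])
    show "integrable (leb n) w" unfolding wK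
      by (rule integrable_indicator_C_on[OF \<Omega> K(1,2) C_on_mult[OF v(1) \<phi>c]])
  qed
  then have "(\<integral>x. indicator K x * d x \<partial>leb n) = 0" unfolding dK .
  then show ?thesis unfolding d_def .
qed

text \<open>Product and chain rule in one, covering u \<psi>^p as well as u \<psi>. The rule is
  classical for mollified functions. In the limit the functions and their images under h and h'
  converge uniformly on the support of the test function, the gradients merely in L^1; this is
  enough because no term contains two gradients.\<close>

lemma is_weak_pderiv_mult_comp:
  fixes h h' :: "real \<Rightarrow> real"
  assumes \<Omega>: "openin (Rn n) \<Omega>" and i: "i < n" and uc: "u \<in> C_on n \<Omega>" and pc: "\<psi> \<in> C_on n \<Omega>"
    and u: "is_weak_pderiv n \<Omega> i u gu" and p: "is_weak_pderiv n \<Omega> i \<psi> gp"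
    and h: "\<And>t. (h has_real_derivative h' t) (at t)" "continuous_on UNIV h'"
  shows "is_weak_pderiv n \<Omega> i (\<lambda>x. u x * h (\<psi> x)) (\<lambda>x. h (\<psi> x) * gu x + u x * h' (\<psi> x) * gp x)"
proof -
  have hc: "continuous_on UNIV h" by (intro continuous_at_imp_continuous_on ballI DERIV_isCont[OF h(1)])
  have gul: "gu \<in> Lp_loc n 1 \<Omega>" and gpl: "gp \<in> Lp_loc n 1 \<Omega>" using u p unfolding is_weak_pderiv_def by auto
  have uh: "(\<lambda>x. u x * h (\<psi> x)) \<in> C_on n \<Omega>" by (intro C_on_mult C_on_compose[OF pc] uc hc)
  have uh': "(\<lambda>x. u x * h' (\<psi> x)) \<in> C_on n \<Omega>" by (intro C_on_mult C_on_compose[OF pc] uc h)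
  have hp: "(\<lambda>x. h (\<psi> x)) \<in> C_on n \<Omega>" by (intro C_on_compose[OF pc] hc)
  have cutmult: "(\<lambda>x. indicator \<Omega> x * (c x * g x)) \<in> borel_measurable (leb n)"
    if "c \<in> C_on n \<Omega>" "g \<in> Lp_loc n 1 \<Omega>" for c g
  proof -
    have "(\<lambda>x. (indicator \<Omega> x * c x) * (indicator \<Omega> x * g x)) \<in> borel_measurable (leb n)"
      using that(2) unfolding Lp_loc_1_iff[OF \<Omega>]
      by (intro borel_measurable_times[OF measurable_leb[OF C_on_measurable_leb[OF that(1) \<Omega>]]]) simp
    moreover have "(\<lambda>x. (indicator \<Omega> x * c x) * (indicator \<Omega> x * g x)) = (\<lambda>x. indicator \<Omega> x * (c x * g x))"
      by (auto simp: indicator_def fun_eq_iff)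
    ultimately show ?thesis by simp
  qed
  have intmult: "integrable (leb n) (\<lambda>x. indicator K x * (c x * g x))"
    if "compactin (Rn n) K" "K \<subseteq> \<Omega>" "c \<in> C_on n \<Omega>" "g \<in> Lp_loc n 1 \<Omega>" for K c g
    using integrable_indicator_mult_C_on[OF \<Omega> that(1,2) _ that(3), of g] that unfolding Lp_loc_1_iff[OF \<Omega>]
    by (simp add: mult.commute)
  have l2: "(\<lambda>x. h (\<psi> x) * gu x + u x * h' (\<psi> x) * gp x) \<in> Lp_loc n 1 \<Omega>"
    unfolding Lp_loc_1_iff[OF \<Omega>] distrib_left
    using cutmult[OF hp gul] cutmult[OF uh' gpl] intmult[OF _ _ hp gul] intmult[OF _ _ uh' gpl] by auto
  show ?thesis
    unfolding is_weak_pderiv_def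
  proof (intro conjI ballI C_on_Lp_loc_1[OF \<Omega> uh] l2)
    fix \<phi> assume \<phi>: "\<phi> \<in> C_c_inf n \<Omega>"
    have \<phi>c: "\<phi> \<in> C_on n \<Omega>" using C_c_C_on[OF C_c_inf_C_c[OF \<phi>]] .
    let ?d = "pderiv_at i \<phi>"
    have dc: "?d \<in> C_on n \<Omega>" by (rule test_function_derivative(1)[OF \<phi> i])
    obtain K where K: "compactin (Rn n) K" "K \<subseteq> \<Omega>" "\<And>x. x \<in> \<Omega> \<Longrightarrow> x \<notin> K \<Longrightarrow> \<phi> x = 0"
      by (rule C_c_compact_support[OF C_c_inf_C_c[OF \<phi>] \<Omega>]) blast
    have K3: "\<forall>x\<in>\<Omega> - K. \<phi> x = 0" using K(3) by blast
    obtain L \<epsilon> where L: "compactin (Rn n) L" "L \<subseteq> \<Omega>" "0 < \<epsilon>" "\<And>y. y \<in> K \<Longrightarrow> ccube n y \<epsilon> \<subseteq> L"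
      by (rule compact_neighbourhood[OF K(1) \<Omega> K(2)]) blast
    \<comment> \<open>Mollification needs functions integrable on the whole space, so
      \<open>u\<close>, \<psi> and their derivatives are cut to a compact neighbourhood of the
      support of the test function.\<close>
    define cut where "cut f x = indicator L x * f x" for f :: "point \<Rightarrow> real" and x
    have cuti: "integrable (leb n) (cut f)" if "f \<in> Lp_loc n 1 \<Omega>" for f
      using that L(1,2) unfolding cut_def Lp_loc_1_iff[OF \<Omega>] by simp
    have ui: "integrable (leb n) (cut u)" and pi: "integrable (leb n) (cut \<psi>)"
      by (intro cuti C_on_Lp_loc_1[OF \<Omega>] uc pc)+
    note gi = cuti[OF gul] cuti[OF gpl]
    define U where "U k = cv n k (cut u)" for k
    define P where "P k = cv n k (cut \<psi>)" for k
    define U' where "U' k = smooth_int n k (leb n) (cut u) ((\<lambda>_. 0)(i := Suc 0))" for k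
    define P' where "P' k = smooth_int n k (leb n) (cut \<psi>) ((\<lambda>_. 0)(i := Suc 0))" for k
    have UC: "U k \<in> C_on n \<Omega>" "P k \<in> C_on n \<Omega>" "U' k \<in> C_on n \<Omega>" "P' k \<in> C_on n \<Omega>" for k
      unfolding U_def P_def U'_def P'_def
      by (intro smooth_int_C_on coordinate_measurable_leb ui pi; assumption)+
    have Ud: "((\<lambda>t. U k (x(i := t))) has_real_derivative U' k x) (at (x i))" for k x
      using smooth_int_deriv[OF coordinate_measurable_leb ui i, of k "\<lambda>_. 0" x] unfolding U_def U'_def by simp
    have Pd: "((\<lambda>t. P k (x(i := t))) has_real_derivative P' k x) (at (x i))" for k x
      using smooth_int_deriv[OF coordinate_measurable_leb pi i, of k "\<lambda>_. 0" x] unfolding P_def P'_def by simp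
    have hPd: "((\<lambda>t. h (P k (x(i := t)))) has_real_derivative h' (P k x) * P' k x) (at (x i))" for k x
      using DERIV_chain2[OF h(1) Pd, of k x] by simp
    define V where "V k x = U k x * h (P k x)" for k x
    define V' where "V' k x = U' k x * h (P k x) + h' (P k x) * P' k x * U k x" for k x
    have Vd: "((\<lambda>t. V k (x(i := t))) has_real_derivative V' k x) (at (x i))" for k x
      using DERIV_mult[OF Ud[of k x] hPd[of k x]] unfolding V_def V'_def by simp
    have VC: "V k \<in> C_on n \<Omega>" "V' k \<in> C_on n \<Omega>" for k
      unfolding V_def V'_def by (intro C_on_add C_on_mult C_on_compose[OF UC(2)] UC hc h)+
    have zero: "(\<integral>x. indicator K x * (V' k x * \<phi> x + V k x * ?d x) \<partial>leb n) = 0" for k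
      by (rule integral_indicator_product_deriv_eq_0[OF \<phi> i \<Omega> K(1,2) K3 VC Vd])
    define G where "G k = cv n k (cut gu)" for k
    define H where "H k = cv n k (cut gp)" for k
    have Gi: "integrable (leb n) (G k)" "integrable (leb n) (H k)" for k
      unfolding G_def H_def by (intro integrable_cv gi)+
    have Glim: "(\<lambda>k. \<integral>x. \<bar>G k x - cut gu x\<bar> \<partial>leb n) \<longlonglongrightarrow> 0" "(\<lambda>k. \<integral>x. \<bar>H k x - cut gp x\<bar> \<partial>leb n) \<longlonglongrightarrow> 0"
      unfolding G_def H_def by (intro cv_tendsto_L1 gi)+
    let ?dK = "\<lambda>x. indicator K x * ?d x"
    have dKi: "integrable (leb n) ?dK" by (rule integrable_indicator_C_on[OF \<Omega> K(1,2) dc])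
    have Ulim: "uniform_limit K U u sequentially"
      unfolding U_def cut_def
      by (rule cv_uniform_limit'[OF uc \<Omega> K(1,2) ui[unfolded cut_def] L(3)]) (rule L(4))
    have Plim: "uniform_limit K P \<psi> sequentially"
      unfolding P_def cut_def
      by (rule cv_uniform_limit'[OF pc \<Omega> K(1,2) pi[unfolded cut_def] L(3)]) (rule L(4))
    obtain B where B: "0 \<le> B" "\<And>x. x \<in> K \<Longrightarrow> \<bar>\<psi> x\<bar> \<le> B"
      by (rule C_on_bounded_on_compact[OF pc K(1,2)]) blast
    have hlim: "uniform_limit K (\<lambda>k x. h (P k x)) (\<lambda>x. h (\<psi> x)) sequentially"
      by (rule uniform_limit_continuous_compose[OF Plim _ hc]) (rule B(2))
    have h'lim: "uniform_limit K (\<lambda>k x. h' (P k x)) (\<lambda>x. h' (\<psi> x)) sequentially"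
      by (rule uniform_limit_continuous_compose[OF Plim _ h(2)]) (rule B(2))
    note bd = C_on_bounded_image[OF _ K(1,2)]
    have hp': "(\<lambda>x. h' (\<psi> x)) \<in> C_on n \<Omega>" by (intro C_on_compose[OF pc] h)
    have \<phi>lim: "uniform_limit K (\<lambda>_. \<phi>) \<phi> sequentially" by (rule uniform_limit_const)
    have t1: "(\<lambda>k. \<integral>x. indicator K x * (h (P k x) * \<phi> x) * G k x \<partial>leb n) \<longlonglongrightarrow>
        (\<integral>x. indicator K x * (h (\<psi> x) * \<phi> x) * cut gu x \<partial>leb n)"
      by (intro tendsto_integral_uniform_limit_L1[OF \<Omega> K(1,2)] C_on_mult C_on_compose[OF UC(2)] hc hp \<phi>c
          uniform_lim_mult[OF hlim \<phi>lim] bd Gi gi Glim)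
    have t2: "(\<lambda>k. \<integral>x. indicator K x * (U k x * h' (P k x) * \<phi> x) * H k x \<partial>leb n) \<longlonglongrightarrow>
        (\<integral>x. indicator K x * (u x * h' (\<psi> x) * \<phi> x) * cut gp x \<partial>leb n)"
      by (intro tendsto_integral_uniform_limit_L1[OF \<Omega> K(1,2)] C_on_mult C_on_compose[OF UC(2)] h hp' \<phi>c UC uc
          uniform_lim_mult[OF uniform_lim_mult[OF Ulim h'lim] \<phi>lim] bd Gi gi Glim)
    \<comment> \<open>No gradient of u or \<psi> occurs here; the fixed function \<open>?dK\<close>
      takes the role of the sequence converging in L^1.\<close>
    have t3: "(\<lambda>k. \<integral>x. indicator K x * (U k x * h (P k x)) * ?dK x \<partial>leb n) \<longlonglongrightarrow>
        (\<integral>x. indicator K x * (u x * h (\<psi> x)) * ?dK x \<partial>leb n)"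
      by (intro tendsto_integral_uniform_limit_L1[OF \<Omega> K(1,2)] C_on_mult C_on_compose[OF UC(2)] hc hp UC uc
          uniform_lim_mult[OF Ulim hlim] bd dKi) simp
    let ?a = "\<lambda>k x. indicator K x * (h (P k x) * \<phi> x) * G k x" and
      ?b = "\<lambda>k x. indicator K x * (U k x * h' (P k x) * \<phi> x) * H k x" and
      ?c = "\<lambda>k x. indicator K x * (U k x * h (P k x)) * ?dK x"
    have bmi: "integrable (leb n) (\<lambda>x. indicator K x * c x * f x)" if "c \<in> C_on n \<Omega>" "integrable (leb n) f" for c f
    proof -
      have "integrable (leb n) (\<lambda>x. indicator K x * f x)"
        using integrable_mult_indicator[OF compactin_sets_leb[OF K(1)] that(2)] by simp
      from integrable_indicator_mult_C_on[OF \<Omega> K(1,2) this that(1)] show ?thesis by (simp add: ac_simps)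
    qed
    have "\<forall>\<^sub>F k in sequentially. \<forall>y\<in>K. ccube n y (1 / (real k + 1)) \<subseteq> L"
      by (rule eventually_cube_subset[OF L(3)]) (rule L(4))
    then have "\<forall>\<^sub>F k in sequentially. (\<integral>x. ?a k x \<partial>leb n) + (\<integral>x. ?b k x \<partial>leb n) + (\<integral>x. ?c k x \<partial>leb n) = 0"
    proof eventually_elim
      case (elim k)
      have "indicator K x * (V' k x * \<phi> x + V k x * ?d x) = ?a k x + ?b k x + ?c k x" for x
      proof (cases "x \<in> K")
        case True
        have xt: "x \<in> topspace (Rn n)" using compactin_subset_topspace[OF K(1)] True by blast
        have c: "ccube n x (1 / (real k + 1)) \<subseteq> L" using elim True by blast
        \<comment> \<open>True only on \<open>K\<close> and for kernels narrow enough to stay in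
          \<open>L\<close>; elsewhere the jump of the cut-off would contribute to the derivative of
          the convolution.\<close>
        have "U' k x = G k x" "P' k x = H k x"
          unfolding U'_def P'_def G_def H_def cut_def
          by (intro smooth_int_weak_pderiv[OF u i \<Omega> xt c L(2)] smooth_int_weak_pderiv[OF p i \<Omega> xt c L(2)])+
        then show ?thesis using True unfolding V'_def V_def by (simp add: algebra_simps)
      qed simp
      then have "(\<integral>x. ?a k x + ?b k x + ?c k x \<partial>leb n) = 0" using zero[of k] by simp
      moreover have "integrable (leb n) (?a k)" "integrable (leb n) (?b k)" "integrable (leb n) (?c k)"
        by (intro bmi C_on_mult C_on_compose[OF UC(2)] hc h UC \<phi>c Gi dKi)+
      ultimately show ?case by (simp add: Bochner_Integration.integral_add)
    qed
    then have "(\<lambda>k. (\<integral>x. ?a k x \<partial>leb n) + (\<integral>x. ?b k x \<partial>leb n) + (\<integral>x. ?c k x \<partial>leb n)) \<longlonglongrightarrow> 0"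
      by (rule tendsto_eventually)
    then have sum0: "(\<integral>x. indicator K x * (h (\<psi> x) * \<phi> x) * cut gu x \<partial>leb n) +
        (\<integral>x. indicator K x * (u x * h' (\<psi> x) * \<phi> x) * cut gp x \<partial>leb n) +
        (\<integral>x. indicator K x * (u x * h (\<psi> x)) * ?dK x \<partial>leb n) = 0"
      using LIMSEQ_unique[OF tendsto_add[OF tendsto_add[OF t1 t2] t3]] by blast
    have KL: "K \<subseteq> L"
      using L(3,4) centre_mem_cube[of _ n \<epsilon>] compactin_subset_topspace[OF K(1)] by blast
    have "(LINT x:\<Omega>|leb n. (h (\<psi> x) * gu x + u x * h' (\<psi> x) * gp x) * \<phi> x) =
        (\<integral>x. indicator K x * (h (\<psi> x) * \<phi> x) * cut gu x + indicator K x * (u x * h' (\<psi> x) * \<phi> x) * cut gp x \<partial>leb n)"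
      unfolding set_lebesgue_integral_def
    proof (rule Bochner_Integration.integral_cong[OF refl])
      fix x
      show "indicator \<Omega> x *\<^sub>R ((h (\<psi> x) * gu x + u x * h' (\<psi> x) * gp x) * \<phi> x) =
        indicator K x * (h (\<psi> x) * \<phi> x) * cut gu x + indicator K x * (u x * h' (\<psi> x) * \<phi> x) * cut gp x"
      proof (cases "x \<in> K")
        case True
        then have "x \<in> \<Omega>" "x \<in> L" using K(2) KL by auto
        then show ?thesis using True by (simp add: cut_def algebra_simps)
      next
        case False
        then show ?thesis using K(3)[of x] by (cases "x \<in> \<Omega>") auto
      qed
    qed
    also have "\<dots> = (\<integral>x. indicator K x * (h (\<psi> x) * \<phi> x) * cut gu x \<partial>leb n) +
        (\<integral>x. indicator K x * (u x * h' (\<psi> x) * \<phi> x) * cut gp x \<partial>leb n)"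
      by (intro Bochner_Integration.integral_add bmi C_on_mult hp hp' uc \<phi>c gi)
    finally have A: "(LINT x:\<Omega>|leb n. (h (\<psi> x) * gu x + u x * h' (\<psi> x) * gp x) * \<phi> x) =
        (\<integral>x. indicator K x * (h (\<psi> x) * \<phi> x) * cut gu x \<partial>leb n) +
        (\<integral>x. indicator K x * (u x * h' (\<psi> x) * \<phi> x) * cut gp x \<partial>leb n)" .
    have "(LINT x:\<Omega>|leb n. u x * h (\<psi> x) * ?d x) = (\<integral>x. indicator K x * (u x * h (\<psi> x)) * ?dK x \<partial>leb n)"
      unfolding set_lebesgue_integral_def
    proof (rule Bochner_Integration.integral_cong[OF refl])
      fix x
      show "indicator \<Omega> x *\<^sub>R (u x * h (\<psi> x) * ?d x) = indicator K x * (u x * h (\<psi> x)) * ?dK x"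
        using K(2) test_function_extension(2)[OF \<phi> i \<Omega> K(1,2) K3, of x] by (auto simp: indicator_def)
    qed
    then show "(LINT x:\<Omega>|leb n. u x * h (\<psi> x) * ?d x) = - (LINT x:\<Omega>|leb n. (h (\<psi> x) * gu x + u x * h' (\<psi> x) * gp x) * \<phi> x)"
      unfolding A using sum0 by linarith
  qed
qed

subsection \<open>Duality and local bounds\<close>

lemma abs_add_powr_le:
  fixes a b p :: real
  assumes "0 \<le> p"
  shows "\<bar>a + b\<bar> powr p \<le> 2 powr p * (\<bar>a\<bar> powr p + \<bar>b\<bar> powr p)"
proof -
  have "\<bar>a + b\<bar> powr p \<le> (2 * max \<bar>a\<bar> \<bar>b\<bar>) powr p" using assms by (intro powr_mono2) auto
  also have "\<dots> = 2 powr p * max \<bar>a\<bar> \<bar>b\<bar> powr p" by (simp add: powr_mult)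
  also have "max \<bar>a\<bar> \<bar>b\<bar> powr p \<le> \<bar>a\<bar> powr p + \<bar>b\<bar> powr p" by (simp add: max_def)
  finally show ?thesis by simp
qed

text \<open>The parameter shifts weight between the two factors: for large s the L^p part is small
  at the price of a large coefficient on the dual part.\<close>

lemma Young_scaled:
  fixes p :: real
  assumes p: "1 < p" and s: "0 < s"
  shows "\<bar>x * y\<bar> \<le> s powr (p / (p - 1)) * \<bar>x\<bar> powr (p / (p - 1)) + s powr (- p) * \<bar>y\<bar> powr p"
proof -
  let ?q = "p / (p - 1)"
  have q: "1 < ?q" "1 / ?q + 1 / p = 1" using p by (auto simp: field_simps)
  have "\<bar>x * y\<bar> = (s * \<bar>x\<bar>) * (\<bar>y\<bar> / s)" using s by (simp add: abs_mult)
  also have "\<dots> \<le> (s * \<bar>x\<bar>) powr ?q / ?q + (\<bar>y\<bar> / s) powr p / p"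
    using s p q by (intro Youngs_inequality) auto
  also have "\<dots> \<le> (s * \<bar>x\<bar>) powr ?q + (\<bar>y\<bar> / s) powr p"
  proof (rule add_mono)
    show "(s * \<bar>x\<bar>) powr ?q / ?q \<le> (s * \<bar>x\<bar>) powr ?q"
      using q(1) divide_left_mono[of 1 ?q "(s * \<bar>x\<bar>) powr ?q"] by simp
    show "(\<bar>y\<bar> / s) powr p / p \<le> (\<bar>y\<bar> / s) powr p"
      using p divide_left_mono[of 1 p "(\<bar>y\<bar> / s) powr p"] by simp
  qed
  also have "\<dots> = s powr ?q * \<bar>x\<bar> powr ?q + s powr (- p) * \<bar>y\<bar> powr p"
    unfolding powr_mult powr_divide powr_minus_divide by simp
  finally show ?thesis .
qed

lemma integrable_mult_dual:
  fixes F g :: "'a \<Rightarrow> real" and p :: real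
  assumes p: "1 < p" and F: "F \<in> borel_measurable M" "integrable M (\<lambda>x. \<bar>F x\<bar> powr (p / (p - 1)))"
    and g: "g \<in> borel_measurable M" "integrable M (\<lambda>x. \<bar>g x\<bar> powr p)"
  shows "integrable M (\<lambda>x. F x * g x)"
proof (rule Bochner_Integration.integrable_bound[of M "\<lambda>x. \<bar>F x\<bar> powr (p / (p - 1)) + \<bar>g x\<bar> powr p"])
  show "AE x in M. norm (F x * g x) \<le> norm (\<bar>F x\<bar> powr (p / (p - 1)) + \<bar>g x\<bar> powr p)"
    using Young_scaled[OF p zero_less_one] by (intro AE_I2) simp
qed (use F g in auto)

text \<open>Truncating \<open>F\<close> reduces weak convergence against \<open>F\<close> to convergence in the mean.\<close>

lemma tendsto_integral_dual:
  fixes F :: "'a \<Rightarrow> real" and g :: "nat \<Rightarrow> 'a \<Rightarrow> real" and p :: real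
  assumes p: "1 < p" and F: "F \<in> borel_measurable M" "integrable M (\<lambda>x. \<bar>F x\<bar> powr (p / (p - 1)))"
    and g: "\<And>k. integrable M (g k)" "\<And>k. integrable M (\<lambda>x. \<bar>g k x\<bar> powr p)" "\<And>k. (\<integral>x. \<bar>g k x\<bar> powr p \<partial>M) \<le> A"
    and g': "integrable M g'" "integrable M (\<lambda>x. \<bar>g' x\<bar> powr p)" "(\<integral>x. \<bar>g' x\<bar> powr p \<partial>M) \<le> A"
    and lim: "(\<lambda>k. \<integral>x. \<bar>g k x - g' x\<bar> \<partial>M) \<longlonglongrightarrow> 0"
  shows "(\<lambda>k. \<integral>x. F x * g k x \<partial>M) \<longlonglongrightarrow> (\<integral>x. F x * g' x \<partial>M)"
proof (rule LIMSEQ_I)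
  fix r :: real assume r: "0 < r"
  \<comment> \<open>Order of choices: s large makes the part weighted by s^(-p) small uniformly in
    k; then m large makes the tail of \<open>F\<close> small in spite of the factor s^(p/(p-1));
    finally k large makes m times the L^1 distance small.\<close>
  let ?q = "p / (p - 1)"
  have A: "0 \<le> A" by (rule order_trans[OF integral_nonneg_AE g'(3)]) simp
  have "((\<lambda>s. s powr (- p) * (2 powr p * (A + A))) \<longlongrightarrow> 0) at_top" using p by real_asymp
  then have "\<forall>\<^sub>F s in at_top. s powr (- p) * (2 powr p * (A + A)) < r / 3"
    using r by (intro order_tendstoD) auto
  then have "\<forall>\<^sub>F s in at_top. 0 < s \<and> s powr (- p) * (2 powr p * (A + A)) < r / 3"
    using eventually_gt_at_top[of 0] by eventually_elim auto
  then obtain s where s: "0 < s" "s powr (- p) * (2 powr p * (A + A)) < r / 3"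
    using eventually_happens'[OF trivial_limit_at_top_linorder] by blast
  let ?t = "\<lambda>m x. if \<bar>F x\<bar> \<le> real m then 0 else \<bar>F x\<bar> powr ?q"
  have tm: "?t m \<in> borel_measurable M" for m using F(1) by measurable
  have ti: "integrable M (?t m)" for m
    by (rule Bochner_Integration.integrable_bound[OF F(2) tm]) auto
  have "(\<lambda>m. \<integral>x. ?t m x \<partial>M) \<longlonglongrightarrow> (\<integral>x. 0 \<partial>M)"
  proof (rule integral_dominated_convergence[OF _ tm F(2)])
    show "AE x in M. (\<lambda>m. ?t m x) \<longlonglongrightarrow> 0"
    proof (rule AE_I2)
      fix x
      obtain N :: nat where "\<bar>F x\<bar> < real N" using reals_Archimedean2 by blast
      then have "\<forall>\<^sub>F m in sequentially. ?t m x = 0" by (intro eventually_sequentiallyI[of N]) auto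
      then show "(\<lambda>m. ?t m x) \<longlonglongrightarrow> 0" by (rule tendsto_eventually)
    qed
  qed auto
  then have "(\<lambda>m. s powr ?q * (\<integral>x. ?t m x \<partial>M)) \<longlonglongrightarrow> s powr ?q * 0" by (intro tendsto_intros) simp
  then have "\<forall>\<^sub>F m in sequentially. s powr ?q * (\<integral>x. ?t m x \<partial>M) < r / 3"
    using r by (intro order_tendstoD) auto
  then obtain m where m: "s powr ?q * (\<integral>x. ?t m x \<partial>M) < r / 3"
    using eventually_happens'[OF sequentially_bot] by blast
  have "(\<lambda>k. real m * (\<integral>x. \<bar>g k x - g' x\<bar> \<partial>M)) \<longlonglongrightarrow> real m * 0" by (intro tendsto_intros lim)
  then have "\<forall>\<^sub>F k in sequentially. real m * (\<integral>x. \<bar>g k x - g' x\<bar> \<partial>M) < r / 3"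
    using r by (intro order_tendstoD) auto
  then have "\<forall>\<^sub>F k in sequentially. norm ((\<integral>x. F x * g k x \<partial>M) - (\<integral>x. F x * g' x \<partial>M)) < r"
  proof eventually_elim
    case (elim k)
    let ?d = "\<lambda>x. g k x - g' x"
    have i: "integrable M (\<lambda>x. F x * g k x)" "integrable M (\<lambda>x. F x * g' x)"
      using g g' by (auto intro!: integrable_mult_dual[OF p F])
    let ?b = "\<lambda>x. real m * \<bar>?d x\<bar> + s powr ?q * ?t m x + s powr (- p) * (2 powr p * (\<bar>g k x\<bar> powr p + \<bar>g' x\<bar> powr p))"
    have "\<bar>(\<integral>x. F x * g k x \<partial>M) - (\<integral>x. F x * g' x \<partial>M)\<bar> = \<bar>\<integral>x. F x * g k x - F x * g' x \<partial>M\<bar>"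
      by (simp add: Bochner_Integration.integral_diff[OF i])
    also have "\<dots> \<le> (\<integral>x. \<bar>F x * g k x - F x * g' x\<bar> \<partial>M)" by (rule integral_abs_bound)
    also have "\<dots> \<le> (\<integral>x. ?b x \<partial>M)"
    proof (rule integral_mono)
      show "integrable M (\<lambda>x. \<bar>F x * g k x - F x * g' x\<bar>)" using i by simp
      show "integrable M ?b" using g g' ti[of m] by simp
      fix x
      have eq: "\<bar>F x * g k x - F x * g' x\<bar> = \<bar>F x * ?d x\<bar>" by (simp add: right_diff_distrib)
      have n: "0 \<le> real m * \<bar>?d x\<bar>" "0 \<le> s powr ?q * ?t m x"
        "0 \<le> s powr (- p) * (2 powr p * (\<bar>g k x\<bar> powr p + \<bar>g' x\<bar> powr p))" by auto
      show "\<bar>F x * g k x - F x * g' x\<bar> \<le> ?b x"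
      proof (cases "\<bar>F x\<bar> \<le> real m")
        case True
        then have "\<bar>F x * ?d x\<bar> \<le> real m * \<bar>?d x\<bar>" unfolding abs_mult by (intro mult_right_mono) auto
        then show ?thesis unfolding eq using n by linarith
      next
        case False
        have "\<bar>?d x\<bar> powr p \<le> 2 powr p * (\<bar>g k x\<bar> powr p + \<bar>g' x\<bar> powr p)"
          using abs_add_powr_le[of p "g k x" "- g' x"] p by simp
        then have "s powr (- p) * \<bar>?d x\<bar> powr p \<le> s powr (- p) * (2 powr p * (\<bar>g k x\<bar> powr p + \<bar>g' x\<bar> powr p))"
          by (intro mult_left_mono) auto
        moreover have "\<bar>F x * ?d x\<bar> \<le> s powr ?q * ?t m x + s powr (- p) * \<bar>?d x\<bar> powr p"
          using Young_scaled[OF p s(1), of "F x" "?d x"] False by simp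
        ultimately show ?thesis unfolding eq using n(1) by linarith
      qed
    qed
    also have "\<dots> = real m * (\<integral>x. \<bar>?d x\<bar> \<partial>M) + s powr ?q * (\<integral>x. ?t m x \<partial>M) +
        s powr (- p) * (2 powr p * ((\<integral>x. \<bar>g k x\<bar> powr p \<partial>M) + (\<integral>x. \<bar>g' x\<bar> powr p \<partial>M)))"
      using g g' ti[of m] by (simp add: Bochner_Integration.integral_add)
    also have "\<dots> < r / 3 + r / 3 + r / 3"
    proof -
      have "s powr (- p) * (2 powr p * ((\<integral>x. \<bar>g k x\<bar> powr p \<partial>M) + (\<integral>x. \<bar>g' x\<bar> powr p \<partial>M))) \<le>
          s powr (- p) * (2 powr p * (A + A))"
        using g(3) g'(3) by (intro mult_left_mono add_mono) auto
      then show ?thesis using elim m s(2) by linarith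
    qed
    finally show ?case by simp
  qed
  then show "\<exists>no. \<forall>k\<ge>no. norm ((\<integral>x. F x * g k x \<partial>M) - (\<integral>x. F x * g' x \<partial>M)) < r"
    unfolding eventually_sequentially .
qed

section \<open>Local consequences of the hypotheses on V and on the weights\<close>

lemma ocube_domain:
  assumes "ccube n x r \<subseteq> \<Omega>" "x \<in> topspace (Rn n)" "0 < r"
  shows "is_domain n (ocube n x r)" "compactly_contained n (ocube n x r) \<Omega>"
  using openin_ocube connectedin_ocube centre_mem_cube[OF assms(2,3)]
    compactly_containedI[OF compactin_ccube assms(1) ocube_subset_ccube]
  unfolding is_domain_def by (blast, simp)

text \<open>The hypothesis is about connected sets, so \<open>K\<close> is covered by open cubes
  instead of being joined into one domain. For p \<le> n membership on an open cube gives
  integrability on its compact subsets, hence the passage to the closed cube of half the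
  size.\<close>

lemma morrey_loc_integrable:
  assumes V: "V \<in> morrey_loc n p q \<Omega>" and \<Omega>: "openin (Rn n) \<Omega>" and K: "compactin (Rn n) K" "K \<subseteq> \<Omega>"
  shows "integrable (leb n) (\<lambda>x. indicator K x * V x)"
proof -
  have loc: "\<exists>r>0. set_integrable (leb n) (ccube n x r) V" if x: "x \<in> K" for x
  proof -
    have xt: "x \<in> topspace (Rn n)" using compactin_subset_topspace[OF K(1)] x by blast
    obtain r where r: "0 < r" "ccube n x r \<subseteq> \<Omega>" by (rule openin_contains_ccube[OF \<Omega>]) (use x K in auto)
    let ?w = "ocube n x r"
    have c: "compactin (Rn n) (ccube n x (r / 2))" "ccube n x (r / 2) \<subseteq> ?w"
      using compactin_ccube ccube_subset_ocube[of "r / 2" r] r(1) by auto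
    have "V \<in> morrey n p q ?w"
      using V ocube_domain[OF r(2) xt r(1)] unfolding morrey_loc_def by blast
    then have "V \<in> Lp_loc n 1 ?w \<or> V \<in> Lp n 1 ?w" unfolding morrey_def by (auto split: if_splits)
    then have "integrable (leb n) (\<lambda>y. indicator (ccube n x (r / 2)) y * V y)"
    proof
      assume "V \<in> Lp_loc n 1 ?w"
      then show ?thesis using c unfolding Lp_loc_1_iff[OF openin_ocube] by blast
    next
      assume "V \<in> Lp n 1 ?w"
      note L = CollectD[OF this[unfolded Lp_def]]
      have m: "(\<lambda>y. indicator ?w y * V y) \<in> borel_measurable (leb n)"
        by (rule measurable_restrict_leb[OF openin_sets_leb[OF openin_ocube], THEN iffD1, OF conjunct1[OF L]])
      have eq: "(\<lambda>y. indicator ?w y *\<^sub>R (\<bar>V y\<bar> powr 1)) = (\<lambda>y. \<bar>indicator ?w y * V y\<bar>)"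
        by (auto simp: indicator_def fun_eq_iff)
      have "integrable (leb n) (\<lambda>y. \<bar>indicator ?w y * V y\<bar>)"
        by (rule conjunct2[OF L, unfolded set_integrable_def eq])
      then have "set_integrable (leb n) ?w V"
        unfolding set_integrable_def using m by (simp add: integrable_abs_iff)
      then have "set_integrable (leb n) (ccube n x (r / 2)) V"
        by (rule set_integrable_subset[OF _ compactin_sets_leb[OF c(1)] c(2)])
      then show ?thesis unfolding set_integrable_def by simp
    qed
    then show ?thesis using r(1) unfolding set_integrable_def by (intro exI[of _ "r / 2"]) simp
  qed
  then obtain r where r: "\<And>x. x \<in> K \<Longrightarrow> 0 < r x" "\<And>x. x \<in> K \<Longrightarrow> set_integrable (leb n) (ccube n x (r x)) V"
    by metis
  obtain S \<epsilon> where S: "finite S" "S \<subseteq> K" "0 < \<epsilon>" "\<And>y. y \<in> K \<Longrightarrow> \<exists>x\<in>S. ccube n y \<epsilon> \<subseteq> ccube n x (r x)"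
    by (rule finite_ccube_cover[OF K(1), of r]) (use r(1) in auto)
  have "set_integrable (leb n) (\<Union>x\<in>S. ccube n x (r x)) V"
    using S(1,2) r(2) by (intro set_integrable_UN sets_PL_leb ccube_sets) auto
  moreover have "K \<subseteq> (\<Union>x\<in>S. ccube n x (r x))"
  proof
    fix y assume y: "y \<in> K"
    have "y \<in> ccube n y \<epsilon>" using centre_mem_cube S(3) compactin_subset_topspace[OF K(1)] y by blast
    then show "y \<in> (\<Union>x\<in>S. ccube n x (r x))" using S(4)[OF y] by blast
  qed
  ultimately have "set_integrable (leb n) K V"
    by (rule set_integrable_subset[OF _ compactin_sets_leb[OF K(1)]])
  then show ?thesis unfolding set_integrable_def by simp
qed

text \<open>The same covering by cubes: finitely many local bounds hold simultaneously almost
  everywhere, and the sum of their absolute values is a common bound.\<close>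

lemma weight_vector_bounded:
  assumes a: "weight_vector n \<Omega> a" and \<Omega>: "openin (Rn n) \<Omega>" and K: "compactin (Rn n) K" "K \<subseteq> \<Omega>"
  obtains C where "0 \<le> C" "\<And>i. i < n \<Longrightarrow> AE x in leb n. x \<in> K \<longrightarrow> a i x \<le> C"
proof -
  have "\<exists>r>0. \<exists>C. \<forall>i<n. AE y in leb n. y \<in> ccube n x r \<longrightarrow> a i y \<le> C" if x: "x \<in> K" for x
  proof -
    have xt: "x \<in> topspace (Rn n)" using compactin_subset_topspace[OF K(1)] x by blast
    obtain r where r: "0 < r" "ccube n x r \<subseteq> \<Omega>" by (rule openin_contains_ccube[OF \<Omega>]) (use x K in auto)
    obtain C where C: "\<forall>i<n. AE y in leb n. y \<in> ocube n x r \<longrightarrow> a i y \<le> C"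
      using a ocube_domain[OF r(2) xt r(1)] unfolding weight_vector_def by fast
    have sub: "ccube n x (r / 2) \<subseteq> ocube n x r" using r(1) by (intro ccube_subset_ocube) simp
    have "AE y in leb n. y \<in> ccube n x (r / 2) \<longrightarrow> a i y \<le> C" if "i < n" for i
      using C[rule_format, OF that] by eventually_elim (use sub in blast)
    then show ?thesis using r(1) by (intro exI[of _ "r / 2"] conjI exI[of _ C]) auto
  qed
  then obtain r C where r: "\<And>x. x \<in> K \<Longrightarrow> 0 < r x"
    and C: "\<And>x i. x \<in> K \<Longrightarrow> i < n \<Longrightarrow> AE y in leb n. y \<in> ccube n x (r x) \<longrightarrow> a i y \<le> C x"
    by metis
  obtain S \<epsilon> where S: "finite S" "S \<subseteq> K" "0 < \<epsilon>" "\<And>y. y \<in> K \<Longrightarrow> \<exists>x\<in>S. ccube n y \<epsilon> \<subseteq> ccube n x (r x)"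
    by (rule finite_ccube_cover[OF K(1), of r]) (use r in auto)
  define B where "B = (\<Sum>x\<in>S. \<bar>C x\<bar>)"
  show thesis
  proof (rule that[of B])
    show "0 \<le> B" unfolding B_def by (intro sum_nonneg) auto
    fix i assume i: "i < n"
    have "AE y in leb n. \<forall>x\<in>S. y \<in> ccube n x (r x) \<longrightarrow> a i y \<le> C x"
      using S(1,2) C[OF _ i] by (intro AE_finite_allI) auto
    then show "AE y in leb n. y \<in> K \<longrightarrow> a i y \<le> B"
    proof eventually_elim
      case (elim y)
      show ?case
      proof
        assume y: "y \<in> K"
        obtain x where x: "x \<in> S" "ccube n y \<epsilon> \<subseteq> ccube n x (r x)" using S(4)[OF y] by blast
        have "y \<in> ccube n y \<epsilon>" using centre_mem_cube S(3) compactin_subset_topspace[OF K(1)] y by blast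
        then have "a i y \<le> C x" using elim x by blast
        also have "C x \<le> \<bar>C x\<bar>" by simp
        also have "\<dots> \<le> B" unfolding B_def using S(1) x(1) by (intro member_le_sum) auto
        finally show "a i y \<le> B" .
      qed
    qed
  qed
qed

section \<open>Mollified functions and weak derivatives in L^p\<close>

lemma borel_measurable_abs_powr:
  fixes f :: "'a \<Rightarrow> real"
  shows "f \<in> borel_measurable M \<Longrightarrow> (\<lambda>x. \<bar>f x\<bar> powr p) \<in> borel_measurable M"
  by measurable

text \<open>Jensen's inequality pointwise, followed by the L^1 contraction applied to |f|^p.\<close>

lemma cv_Lp:
  assumes p: "1 < p" and f: "integrable (leb n) f" "integrable (leb n) (\<lambda>x. \<bar>f x\<bar> powr p)"
  shows "integrable (leb n) (\<lambda>x. \<bar>cv n k f x\<bar> powr p)"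
    and "(\<integral>x. \<bar>cv n k f x\<bar> powr p \<partial>leb n) \<le> (\<integral>x. \<bar>f x\<bar> powr p \<partial>leb n)"
proof -
  let ?g = "\<lambda>x. \<bar>f x\<bar> powr p"
  note le = abs_cv_powr_le[OF p f, of k]
  show i: "integrable (leb n) (\<lambda>x. \<bar>cv n k f x\<bar> powr p)"
  proof (rule Bochner_Integration.integrable_bound[OF integrable_cv[OF f(2), of k]])
    show "(\<lambda>x. \<bar>cv n k f x\<bar> powr p) \<in> borel_measurable (leb n)"
      using borel_measurable_integrable[OF integrable_cv[OF f(1), of k]] by measurable
    show "AE x in leb n. norm (\<bar>cv n k f x\<bar> powr p) \<le> norm (cv n k ?g x)"
      using le by (intro AE_I2) (simp add: order_trans[OF _ abs_ge_self])
  qed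
  have "(\<integral>x. \<bar>cv n k f x\<bar> powr p \<partial>leb n) \<le> (\<integral>x. \<bar>cv n k ?g x\<bar> \<partial>leb n)"
    using le by (intro integral_mono i integrable_abs integrable_cv f(2)) (simp add: order_trans[OF _ abs_ge_self])
  also have "\<dots> \<le> (\<integral>x. \<bar>?g x\<bar> \<partial>leb n)" by (rule integral_abs_cv_le[OF f(2)])
  finally show "(\<integral>x. \<bar>cv n k f x\<bar> powr p \<partial>leb n) \<le> (\<integral>x. \<bar>f x\<bar> powr p \<partial>leb n)" by simp
qed

text \<open>For p < 2 the first factor is unbounded near 0. Separating the positive and the negative
  part of t leaves powers with the positive exponent p - 1.\<close>

lemma continuous_abs_powr_mult:
  fixes p :: real
  assumes "1 < p"
  shows "continuous_on UNIV (\<lambda>t::real. \<bar>t\<bar> powr (p - 2) * t)"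
proof -
  have "\<bar>t\<bar> powr (p - 2) * t = max 0 t powr (p - 1) - max 0 (- t) powr (p - 1)" for t
    using powr_mult_base[of "\<bar>t\<bar>" "p - 2"] by (cases "0 \<le> t") (auto simp: max_def mult.commute abs_if)
  moreover have "continuous_on UNIV (\<lambda>t::real. max 0 t powr (p - 1) - max 0 (- t) powr (p - 1))"
    using assms by (intro continuous_on_diff continuous_on_powr' continuous_on_max continuous_on_minus
        continuous_on_const continuous_on_id ballI) auto
  ultimately show ?thesis by simp
qed

lemma abs_powr_mult:
  fixes p t :: real
  shows "\<bar>\<bar>t\<bar> powr (p - 2) * t\<bar> = \<bar>t\<bar> powr (p - 1)"
  using powr_mult_base[of "\<bar>t\<bar>" "p - 2"] by (simp add: abs_mult mult.commute)

lemma Lp_loc_measurable: "f \<in> Lp_loc n p \<Omega> \<Longrightarrow> f \<in> borel_measurable (restrict_space (leb n) \<Omega>)"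
  unfolding Lp_loc_def by simp

lemma measurable_indicator_compact:
  assumes "f \<in> borel_measurable (restrict_space (leb n) \<Omega>)" "openin (Rn n) \<Omega>" "compactin (Rn n) K" "K \<subseteq> \<Omega>"
  shows "(\<lambda>x. indicator K x * (f x :: real)) \<in> borel_measurable (leb n)"
  using assms(1) unfolding measurable_restrict_leb[OF openin_sets_leb[OF assms(2)]]
  by (rule measurable_indicator_times_subset[OF _ compactin_sets_leb[OF assms(3)] assms(4)])

lemma W1p_subset_W1p_loc:
  assumes "openin (Rn n) \<Omega>"
  shows "W1p n p \<Omega> \<subseteq> W1p_loc n p \<Omega>"
proof -
  have "Lp n p \<Omega> \<subseteq> Lp_loc n p \<Omega>"
    unfolding Lp_def Lp_loc_def by (auto intro: set_integrable_subset compactin_sets_leb)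
  then show ?thesis unfolding W1p_def W1p_loc_def by blast
qed

text \<open>Membership in \<open>W1p_loc\<close> promises some p-integrable weak derivative;
  uniqueness almost everywhere transfers measurable bounds from it to the chosen
  representative.\<close>

lemma W1p_loc_weak_pderiv:
  assumes f: "f \<in> W1p_loc n p \<Omega>" and i: "i < n" and \<Omega>: "openin (Rn n) \<Omega>"
  shows "is_weak_pderiv n \<Omega> i f (weak_pderiv n \<Omega> i f)"
    and "weak_pderiv n \<Omega> i f \<in> borel_measurable (restrict_space (leb n) \<Omega>)"
    and "compactin (Rn n) K \<Longrightarrow> K \<subseteq> \<Omega> \<Longrightarrow>
      integrable (leb n) (\<lambda>x. indicator K x * \<bar>weak_pderiv n \<Omega> i f x\<bar> powr p)"
proof -
  let ?w = "weak_pderiv n \<Omega> i f"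
  obtain g where g: "g \<in> Lp_loc n p \<Omega>" "is_weak_pderiv n \<Omega> i f g" using f i unfolding W1p_loc_def by blast
  show w: "is_weak_pderiv n \<Omega> i f ?w" by (rule is_weak_pderiv_weak_pderiv[OF g(2)])
  then show wm: "?w \<in> borel_measurable (restrict_space (leb n) \<Omega>)"
    unfolding is_weak_pderiv_def using Lp_loc_measurable by blast
  assume K: "compactin (Rn n) K" "K \<subseteq> \<Omega>"
  have gi: "integrable (leb n) (\<lambda>x. indicator K x * \<bar>g x\<bar> powr p)"
    using g(1) K unfolding Lp_loc_def set_integrable_def by simp
  have "(\<lambda>x. \<bar>?w x\<bar> powr p) \<in> borel_measurable (restrict_space (leb n) \<Omega>)" using wm by measurable
  then have m: "(\<lambda>x. indicator K x * \<bar>?w x\<bar> powr p) \<in> borel_measurable (leb n)"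
    by (rule measurable_indicator_compact[OF _ \<Omega> K])
  have "AE x in leb n. indicator K x * \<bar>g x\<bar> powr p = indicator K x * \<bar>?w x\<bar> powr p"
    using is_weak_pderiv_unique[OF \<Omega> g(2) w] by eventually_elim (use K(2) in \<open>auto simp: indicator_def\<close>)
  then show "integrable (leb n) (\<lambda>x. indicator K x * \<bar>?w x\<bar> powr p)"
    using gi by (subst integrable_cong_AE[symmetric, OF borel_measurable_integrable[OF gi] m]) auto
qed

lemma integrable_powr_mult_C_on:
  assumes \<Omega>: "openin (Rn n) \<Omega>" and K: "compactin (Rn n) K" "K \<subseteq> \<Omega>" and p: "0 \<le> p"
    and g: "integrable (leb n) (\<lambda>x. indicator K x * \<bar>g x\<bar> powr p)" and c: "c \<in> C_on n \<Omega>"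
  shows "integrable (leb n) (\<lambda>x. indicator K x * \<bar>c x * g x\<bar> powr p)"
proof -
  obtain B where B: "0 \<le> B" "\<And>x. x \<in> K \<Longrightarrow> \<bar>c x\<bar> \<le> B" by (rule C_on_bounded_on_compact[OF c K]) blast
  have "(\<lambda>x. indicator K x * c x) \<in> borel_measurable (leb n)"
    by (rule borel_measurable_integrable[OF integrable_indicator_C_on[OF \<Omega> K c]])
  then have "(\<lambda>x. \<bar>indicator K x * c x\<bar> powr p * (indicator K x * \<bar>g x\<bar> powr p)) \<in> borel_measurable (leb n)"
    by (rule borel_measurable_times[OF borel_measurable_abs_powr borel_measurable_integrable[OF g]])
  moreover have "(\<lambda>x. \<bar>indicator K x * c x\<bar> powr p * (indicator K x * \<bar>g x\<bar> powr p)) = (\<lambda>x. indicator K x * \<bar>c x * g x\<bar> powr p)"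
    by (auto simp: indicator_def fun_eq_iff abs_mult powr_mult)
  ultimately have m: "(\<lambda>x. indicator K x * \<bar>c x * g x\<bar> powr p) \<in> borel_measurable (leb n)" by simp
  show ?thesis
  proof (rule Bochner_Integration.integrable_bound[of _ "\<lambda>x. B powr p * (indicator K x * \<bar>g x\<bar> powr p)"])
    show "integrable (leb n) (\<lambda>x. B powr p * (indicator K x * \<bar>g x\<bar> powr p))" using g by simp
    show "AE x in leb n. norm (indicator K x * \<bar>c x * g x\<bar> powr p) \<le> norm (B powr p * (indicator K x * \<bar>g x\<bar> powr p))"
    proof (rule AE_I2)
      fix x
      show "norm (indicator K x * \<bar>c x * g x\<bar> powr p) \<le> norm (B powr p * (indicator K x * \<bar>g x\<bar> powr p))"
      proof (cases "x \<in> K")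
        case True
        have "\<bar>c x\<bar> powr p * \<bar>g x\<bar> powr p \<le> B powr p * \<bar>g x\<bar> powr p"
          using B(2)[OF True] p by (intro mult_right_mono powr_mono2) auto
        then show ?thesis using True by (simp add: abs_mult powr_mult)
      qed simp
    qed
  qed (rule m)
qed

lemma integrable_powr_add:
  fixes f g :: "point \<Rightarrow> real" and p :: real
  assumes p: "0 \<le> p" and K: "K \<in> sets (leb n)"
    and f: "integrable (leb n) (\<lambda>x. indicator K x * \<bar>f x\<bar> powr p)"
    and g: "integrable (leb n) (\<lambda>x. indicator K x * \<bar>g x\<bar> powr p)"
    and m: "(\<lambda>x. indicator K x * (f x + g x)) \<in> borel_measurable (leb n)"
  shows "integrable (leb n) (\<lambda>x. indicator K x * \<bar>f x + g x\<bar> powr p)"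
proof (rule Bochner_Integration.integrable_bound[of _ "\<lambda>x. 2 powr p * (indicator K x * \<bar>f x\<bar> powr p + indicator K x * \<bar>g x\<bar> powr p)"])
  show "integrable (leb n) (\<lambda>x. 2 powr p * (indicator K x * \<bar>f x\<bar> powr p + indicator K x * \<bar>g x\<bar> powr p))"
    using f g by simp
  have "(\<lambda>x. indicator K x * \<bar>indicator K x * (f x + g x)\<bar> powr p) \<in> borel_measurable (leb n)"
    by (rule borel_measurable_times[OF borel_measurable_indicator[OF K] borel_measurable_abs_powr[OF m]])
  moreover have "(\<lambda>x. indicator K x * \<bar>indicator K x * (f x + g x)\<bar> powr p) = (\<lambda>x. indicator K x * \<bar>f x + g x\<bar> powr p)"
    by (auto simp: indicator_def fun_eq_iff)
  ultimately show "(\<lambda>x. indicator K x * \<bar>f x + g x\<bar> powr p) \<in> borel_measurable (leb n)" by simp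
  show "AE x in leb n. norm (indicator K x * \<bar>f x + g x\<bar> powr p) \<le>
      norm (2 powr p * (indicator K x * \<bar>f x\<bar> powr p + indicator K x * \<bar>g x\<bar> powr p))"
    using abs_add_powr_le[OF p] by (intro AE_I2) (auto simp: indicator_def)
qed

lemma integrable_weight_mult:
  assumes C: "0 \<le> C" "AE x in leb n. x \<in> K \<longrightarrow> b x \<le> C" and b0: "\<And>x. x \<in> K \<Longrightarrow> 0 \<le> b x"
    and bm: "(\<lambda>x. indicator K x * b x) \<in> borel_measurable (leb n)"
    and f: "integrable (leb n) (\<lambda>x. indicator K x * (f x :: real))"
  shows "integrable (leb n) (\<lambda>x. indicator K x * (b x * f x))"
proof (rule Bochner_Integration.integrable_bound[of _ "\<lambda>x. C * (indicator K x * f x)"])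
  show "integrable (leb n) (\<lambda>x. C * (indicator K x * f x))" using f by simp
  have "(\<lambda>x. (indicator K x * b x) * (indicator K x * f x)) \<in> borel_measurable (leb n)"
    by (rule borel_measurable_times[OF bm borel_measurable_integrable[OF f]])
  moreover have "(\<lambda>x. (indicator K x * b x) * (indicator K x * f x)) = (\<lambda>x. indicator K x * (b x * f x))"
    by (auto simp: indicator_def fun_eq_iff)
  ultimately show "(\<lambda>x. indicator K x * (b x * f x)) \<in> borel_measurable (leb n)" by simp
  show "AE x in leb n. norm (indicator K x * (b x * f x)) \<le> norm (C * (indicator K x * f x))"
    using C(2)
  proof eventually_elim
    case (elim x)
    then show ?case using b0[of x] C(1) by (cases "x \<in> K") (auto simp: abs_mult intro!: mult_right_mono)
  qed
qed

text \<open>A kernel cube around x either misses \<open>K\<close>, and then all mollified quantities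
  vanish at x, or it meets \<open>K\<close> in some z. With kernel radius below \<epsilon> / 2 it
  then lies in the \<epsilon>-cube around z, hence in \<open>L\<close>, where mollification commutes
  with differentiation.\<close>

lemma cv_compact_support_test_function:
  assumes \<Omega>: "openin (Rn n) \<Omega>" and f: "f \<in> C_on n \<Omega>" and K: "compactin (Rn n) K" "K \<subseteq> \<Omega>"
    and L: "compactin (Rn n) L" "L \<subseteq> \<Omega>" "0 < \<epsilon>" "\<And>y. y \<in> K \<Longrightarrow> ccube n y \<epsilon> \<subseteq> L"
    and fz: "\<And>x. x \<in> \<Omega> \<Longrightarrow> x \<notin> K \<Longrightarrow> f x = 0"
    and g: "\<And>i. i < n \<Longrightarrow> is_weak_pderiv n \<Omega> i f (g i)"
    and gz: "\<And>i x. i < n \<Longrightarrow> x \<in> \<Omega> \<Longrightarrow> x \<notin> K \<Longrightarrow> g i x = 0"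
  shows "\<forall>\<^sub>F k in sequentially. cv n k (\<lambda>x. indicator L x * f x) \<in> C_c_inf n \<Omega> \<and>
    (\<forall>x\<in>topspace (Rn n). (x \<notin> L \<longrightarrow> cv n k (\<lambda>x. indicator L x * f x) x = 0) \<and>
      (\<forall>i<n. pderiv_at i (cv n k (\<lambda>x. indicator L x * f x)) x = cv n k (\<lambda>x. indicator L x * g i x) x \<and>
        (x \<notin> L \<longrightarrow> cv n k (\<lambda>x. indicator L x * g i x) x = 0)))"
proof -
  let ?f = "\<lambda>x. indicator L x * f x"
  have fi: "integrable (leb n) ?f" by (rule integrable_indicator_C_on[OF \<Omega> L(1,2) f])
  have "\<forall>\<^sub>F k in sequentially. 1 / (real k + 1) < \<epsilon> / 2"
    using L(3) by real_asymp
  then show ?thesis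
  proof eventually_elim
    case (elim k)
    let ?c = "\<lambda>x. ccube n x (1 / (real k + 1))"
    have far: "smooth_int n k (leb n) (\<lambda>x. indicator L x * v x) \<alpha> x = 0"
      if "?c x \<inter> K = {}" "\<And>x. x \<in> \<Omega> \<Longrightarrow> x \<notin> K \<Longrightarrow> v x = 0" for x v \<alpha>
    proof (rule cv_zero_outside)
      fix y assume "y \<in> ?c x"
      then have "y \<notin> K" using that(1) by blast
      then show "indicator L y * v y = 0" using that(2)[of y] L(2) by (auto simp: indicator_def)
    qed
    have near: "x \<in> L \<and> ?c x \<subseteq> L" if x: "x \<in> topspace (Rn n)" and z: "?c x \<inter> K \<noteq> {}" for x
    proof -
      obtain z where z: "z \<in> ?c x" "z \<in> K" using z by blast
      have xz: "x \<in> ?c z" by (rule ccube_sym[OF z(1) x])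
      have "?c x \<subseteq> ccube n z (1 / (real k + 1) + 1 / (real k + 1))" by (rule ccube_triangle[OF xz])
      also have "\<dots> \<subseteq> ccube n z \<epsilon>" using elim by (intro ccube_mono) linarith
      also have "\<dots> \<subseteq> L" by (rule L(4)[OF z(2)])
      finally have "?c x \<subseteq> L" .
      moreover have "x \<in> ?c x" using centre_mem_cube[OF x, of "1 / (real k + 1)"] by simp
      ultimately show ?thesis by blast
    qed
    have pd: "pderiv_at i (cv n k ?f) x = smooth_int n k (leb n) ?f ((\<lambda>_. 0)(i := Suc 0)) x" if "i < n" for i x
      using pderiv_at_smooth_int[OF coordinate_measurable_leb fi that, of k "\<lambda>_. 0"] by simp
    have fout: "cv n k ?f x = 0" if "x \<in> topspace (Rn n)" "x \<notin> L" for x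
      using far[of x f] fz near[OF that(1)] that(2) by blast
    have gout: "cv n k (\<lambda>x. indicator L x * g i x) x = 0" if "x \<in> topspace (Rn n)" "x \<notin> L" "i < n" for x i
      using far[of x "g i"] gz[OF that(3)] near[OF that(1)] that(2) by blast
    have pdg: "pderiv_at i (cv n k ?f) x = cv n k (\<lambda>x. indicator L x * g i x) x" if x: "x \<in> topspace (Rn n)" and i: "i < n" for i x
    proof (cases "?c x \<inter> K = {}")
      case True
      then show ?thesis unfolding pd[OF i] using far[OF True, of f] fz far[OF True, of "g i"] gz[OF i] by simp
    next
      case False
      then have "?c x \<subseteq> L" using near[OF x] by blast
      then show ?thesis unfolding pd[OF i] by (rule smooth_int_weak_pderiv[OF g[OF i] i \<Omega> x _ L(2)])
    qed
    have "cv n k ?f \<in> C_k n m \<Omega>" for m by (rule smooth_int_C_k[OF coordinate_measurable_leb fi])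
    moreover have "cv n k ?f \<in> C_c n \<Omega>"
      unfolding C_c_def
    proof (intro CollectI conjI)
      show "cv n k ?f \<in> C_on n \<Omega>" by (rule smooth_int_C_on[OF coordinate_measurable_leb fi])
      have "{x \<in> \<Omega>. cv n k ?f x \<noteq> 0} \<subseteq> L" using fout openin_subset[OF \<Omega>] by blast
      then show "compactly_contained n {x \<in> \<Omega>. cv n k ?f x \<noteq> 0} \<Omega>" by (rule compactly_containedI[OF L(1,2)])
    qed
    ultimately have "cv n k ?f \<in> C_c_inf n \<Omega>" unfolding C_c_inf_def by blast
    then show ?case using fout gout pdg by blast
  qed
qed

subsection \<open>Testing the equation\<close>

lemma abs_powr_diff_2_mult_square:
  fixes p t :: real
  shows "\<bar>t\<bar> powr (p - 2) * t * t = \<bar>t\<bar> powr p"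
proof (cases "t = 0")
  case False
  then have "\<bar>t\<bar> powr (p - 2) * \<bar>t\<bar>\<^sup>2 = \<bar>t\<bar> powr p" by (simp add: powr_diff)
  then show ?thesis by (simp add: power2_eq_square mult.assoc)
qed simp

text \<open>The exponents match: |w|^(p-1) raised to the power p / (p - 1) is |w|^p, and on a
  compact set the weight is bounded almost everywhere.\<close>

lemma integrable_flux_dual:
  assumes p: "1 < p" and \<Omega>: "openin (Rn n) \<Omega>" and a: "weight_vector n \<Omega> a" and i: "i < n"
    and L: "compactin (Rn n) L" "L \<subseteq> \<Omega>"
    and wm: "w \<in> borel_measurable (restrict_space (leb n) \<Omega>)"
    and w: "integrable (leb n) (\<lambda>x. indicator L x * \<bar>w x\<bar> powr p)"
  shows "(\<lambda>x. indicator L x * (a i x * \<bar>w x\<bar> powr (p - 2) * w x)) \<in> borel_measurable (leb n)"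
    and "integrable (leb n) (\<lambda>x. \<bar>indicator L x * (a i x * \<bar>w x\<bar> powr (p - 2) * w x)\<bar> powr (p / (p - 1)))"
proof -
  have am: "a i \<in> borel_measurable (restrict_space (leb n) \<Omega>)" and apos: "\<And>x. x \<in> \<Omega> \<Longrightarrow> 0 < a i x"
    using a i unfolding weight_vector_def by blast+
  have "(\<lambda>x. a i x * \<bar>w x\<bar> powr (p - 2) * w x) \<in> borel_measurable (restrict_space (leb n) \<Omega>)"
    using am wm by measurable
  then show "(\<lambda>x. indicator L x * (a i x * \<bar>w x\<bar> powr (p - 2) * w x)) \<in> borel_measurable (leb n)"
    by (rule measurable_indicator_compact[OF _ \<Omega> L])
  obtain C where C: "0 \<le> C" "AE x in leb n. x \<in> L \<longrightarrow> a i x \<le> C"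
    by (rule weight_vector_bounded[OF a \<Omega> L]) (use i in blast)
  let ?q = "p / (p - 1)"
  have "integrable (leb n) (\<lambda>x. indicator L x * (a i x powr ?q * \<bar>w x\<bar> powr p))"
  proof (rule integrable_weight_mult[OF _ _ _ _ w])
    show "0 \<le> C powr ?q" by simp
    show "AE x in leb n. x \<in> L \<longrightarrow> a i x powr ?q \<le> C powr ?q"
      using C(2)
    proof eventually_elim
      case (elim x)
      show ?case
      proof
        assume "x \<in> L"
        then show "a i x powr ?q \<le> C powr ?q"
          using elim apos[of x] L(2) p by (intro powr_mono2) auto
      qed
    qed
    have "(\<lambda>x. a i x powr ?q) \<in> borel_measurable (restrict_space (leb n) \<Omega>)" using am by measurable
    then show "(\<lambda>x. indicator L x * a i x powr ?q) \<in> borel_measurable (leb n)"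
      by (rule measurable_indicator_compact[OF _ \<Omega> L])
  qed simp
  moreover have "\<bar>indicator L x * (a i x * \<bar>w x\<bar> powr (p - 2) * w x)\<bar> powr ?q =
      indicator L x * (a i x powr ?q * \<bar>w x\<bar> powr p)" for x
  proof (cases "x \<in> L")
    case True
    have "\<bar>a i x * \<bar>w x\<bar> powr (p - 2) * w x\<bar> = a i x * \<bar>w x\<bar> powr (p - 1)"
      using apos[of x] True L(2) abs_powr_mult[of "w x" p] by (auto simp: abs_mult mult.assoc)
    then show ?thesis using True p by (simp add: powr_mult powr_powr)
  qed simp
  ultimately show "integrable (leb n) (\<lambda>x. \<bar>indicator L x * (a i x * \<bar>w x\<bar> powr (p - 2) * w x)\<bar> powr ?q)"
    by simp
qed

text \<open>Each term of the equation is given a convergence it tolerates: V u^(p-1), integrable on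
  compact sets, is paired with uniformly convergent test functions, and the flux is paired with
  gradients through \<open>tendsto_integral_dual\<close>.\<close>

lemma positive_solution_test:
  fixes a :: "nat \<Rightarrow> point \<Rightarrow> real" and u :: "point \<Rightarrow> real"
  assumes p: "1 < p" and \<Omega>: "openin (Rn n) \<Omega>" and a: "weight_vector n \<Omega> a"
    and V: "\<And>K. compactin (Rn n) K \<Longrightarrow> K \<subseteq> \<Omega> \<Longrightarrow> integrable (leb n) (\<lambda>x. indicator K x * V x)"
    and sol: "positive_solution n \<Omega> p a V u" and uc: "u \<in> C_on n \<Omega>"
    and f: "f \<in> C_on n \<Omega>" and K: "compactin (Rn n) K" "K \<subseteq> \<Omega>"
    and fz: "\<And>x. x \<in> \<Omega> \<Longrightarrow> x \<notin> K \<Longrightarrow> f x = 0"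
    and g: "\<And>i. i < n \<Longrightarrow> is_weak_pderiv n \<Omega> i f (g i)"
    and gz: "\<And>i x. i < n \<Longrightarrow> x \<in> \<Omega> \<Longrightarrow> x \<notin> K \<Longrightarrow> g i x = 0"
    and gp: "\<And>i K. i < n \<Longrightarrow> compactin (Rn n) K \<Longrightarrow> K \<subseteq> \<Omega> \<Longrightarrow> integrable (leb n) (\<lambda>x. indicator K x * \<bar>g i x\<bar> powr p)"
  defines "F \<equiv> \<lambda>i x. a i x * \<bar>weak_pderiv n \<Omega> i u x\<bar> powr (p - 2) * weak_pderiv n \<Omega> i u x"
  shows "i < n \<Longrightarrow> integrable (leb n) (\<lambda>x. indicator K x * (F i x * g i x))"
    and "(\<Sum>i<n. \<integral>x. indicator K x * (F i x * g i x) \<partial>leb n) +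
      (\<integral>x. indicator K x * (V x * (\<bar>u x\<bar> powr (p - 2) * u x * f x)) \<partial>leb n) = 0"
proof -
  obtain L \<epsilon> where L: "compactin (Rn n) L" "L \<subseteq> \<Omega>" "0 < \<epsilon>" "\<And>y. y \<in> K \<Longrightarrow> ccube n y \<epsilon> \<subseteq> L"
    by (rule compact_neighbourhood[OF K(1) \<Omega> K(2)]) blast
  \<comment> \<open>The mollified functions are supported in \<open>L\<close>, so uniform
    convergence is required on all of \<open>L\<close>, and that needs a neighbourhood of
    \<open>L\<close> in turn.\<close>
  obtain M \<delta> where M: "compactin (Rn n) M" "M \<subseteq> \<Omega>" "0 < \<delta>" "\<And>y. y \<in> L \<Longrightarrow> ccube n y \<delta> \<subseteq> M"
    by (rule compact_neighbourhood[OF L(1) \<Omega> L(2)]) blast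
  have KL: "K \<subseteq> L"
    using L(3,4) centre_mem_cube[of _ n \<epsilon>] compactin_subset_topspace[OF K(1)] by blast
  have LM: "L \<subseteq> M"
    using M(3,4) centre_mem_cube[of _ n \<delta>] compactin_subset_topspace[OF L(1)] by blast
  define f' where "f' x = indicator L x * f x" for x
  define F' where "F' i x = indicator L x * F i x" for i x
  define g' where "g' i x = indicator L x * g i x" for i x
  define W where "W x = indicator L x * (V x * (\<bar>u x\<bar> powr (p - 2) * u x))" for x
  have uW: "u \<in> W1p_loc n p \<Omega>" using sol unfolding positive_solution_def by blast
  have F': "F' i \<in> borel_measurable (leb n)" "integrable (leb n) (\<lambda>x. \<bar>F' i x\<bar> powr (p / (p - 1)))" if i: "i < n" for i
    using integrable_flux_dual[OF p \<Omega> a i L(1,2) W1p_loc_weak_pderiv(2)[OF uW i \<Omega>] W1p_loc_weak_pderiv(3)[OF uW i \<Omega> L(1,2)]]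
    unfolding F'_def F_def by auto
  have g': "integrable (leb n) (g' i)" "integrable (leb n) (\<lambda>x. \<bar>g' i x\<bar> powr p)" if i: "i < n" for i
  proof -
    have "g i \<in> Lp_loc n 1 \<Omega>" using g[OF i] unfolding is_weak_pderiv_def by simp
    then show "integrable (leb n) (g' i)" using L(1,2) unfolding Lp_loc_1_iff[OF \<Omega>] g'_def by simp
    have "(\<lambda>x. \<bar>g' i x\<bar> powr p) = (\<lambda>x. indicator L x * \<bar>g i x\<bar> powr p)"
      by (auto simp: g'_def indicator_def fun_eq_iff)
    then show "integrable (leb n) (\<lambda>x. \<bar>g' i x\<bar> powr p)" using gp[OF i L(1,2)] by simp
  qed
  have uu: "(\<lambda>x. \<bar>u x\<bar> powr (p - 2) * u x) \<in> C_on n \<Omega>"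
    by (rule C_on_compose[OF uc continuous_abs_powr_mult[OF p]])
  have Wi: "integrable (leb n) W" unfolding W_def
    by (rule integrable_indicator_mult_C_on[OF \<Omega> L(1,2) V[OF L(1,2)] uu])
  have fi: "integrable (leb n) f'" unfolding f'_def by (rule integrable_indicator_C_on[OF \<Omega> L(1,2) f])
  have Fg: "(\<lambda>x. F' i x * g' i x) = (\<lambda>x. indicator K x * (F i x * g i x))" if i: "i < n" for i
    using gz[OF i] KL L(2) by (auto simp: F'_def g'_def indicator_def fun_eq_iff)
  show "integrable (leb n) (\<lambda>x. indicator K x * (F i x * g i x))" if i: "i < n"
    using integrable_mult_dual[OF p F'[OF i] borel_measurable_integrable[OF g'(1)[OF i]] g'(2)[OF i]] unfolding Fg[OF i] .
  have t1: "(\<lambda>k. \<integral>x. F' i x * cv n k (g' i) x \<partial>leb n) \<longlonglongrightarrow> (\<integral>x. F' i x * g' i x \<partial>leb n)" if i: "i < n" for i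
    by (rule tendsto_integral_dual[OF p F'[OF i] integrable_cv[OF g'(1)[OF i]] cv_Lp[OF p g'[OF i]] g'[OF i] order_refl
        cv_tendsto_L1[OF g'(1)[OF i]]])
  \<comment> \<open>Cutting at \<open>L\<close> or at \<open>M\<close> gives the same function
    because \<open>f\<close> vanishes off \<open>K\<close>; read as a cut at \<open>M\<close> it has
    uniformly convergent mollifications on \<open>L\<close>.\<close>
  have f'M: "f' = (\<lambda>x. indicator M x * f x)"
  proof
    fix x show "f' x = indicator M x * f x"
      using fz[of x] M(2) KL LM by (auto simp: f'_def indicator_def)
  qed
  have ul: "uniform_limit L (\<lambda>k. cv n k f') f sequentially"
    unfolding f'M by (rule cv_uniform_limit'[OF f \<Omega> L(1,2) fi[unfolded f'M] M(3)]) (rule M(4))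
  have t2: "(\<lambda>k. \<integral>x. indicator L x * cv n k f' x * W x \<partial>leb n) \<longlonglongrightarrow> (\<integral>x. indicator L x * f x * W x \<partial>leb n)"
    by (rule tendsto_integral_uniform_limit_L1[OF \<Omega> L(1,2) smooth_int_C_on[OF coordinate_measurable_leb fi] f ul Wi Wi]) simp_all
  have "\<forall>\<^sub>F k in sequentially. cv n k f' \<in> C_c_inf n \<Omega> \<and>
    (\<forall>x\<in>topspace (Rn n). (x \<notin> L \<longrightarrow> cv n k f' x = 0) \<and>
      (\<forall>i<n. pderiv_at i (cv n k f') x = cv n k (g' i) x \<and> (x \<notin> L \<longrightarrow> cv n k (g' i) x = 0)))"
    unfolding f'_def[abs_def] g'_def[abs_def]
    by (rule cv_compact_support_test_function[OF \<Omega> f K L(1-3)]) (rule L(4) fz g gz; assumption)+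
  then have "\<forall>\<^sub>F k in sequentially. (\<Sum>i<n. \<integral>x. F' i x * cv n k (g' i) x \<partial>leb n) + (\<integral>x. indicator L x * cv n k f' x * W x \<partial>leb n) = 0"
  proof eventually_elim
    case (elim k)
    let ?\<phi> = "cv n k f'"
    have A: "?\<phi> \<in> C_c_inf n \<Omega>" using elim by blast
    have B: "\<And>x. x \<in> topspace (Rn n) \<Longrightarrow> x \<notin> L \<Longrightarrow> ?\<phi> x = 0"
      "\<And>x i. x \<in> topspace (Rn n) \<Longrightarrow> i < n \<Longrightarrow> pderiv_at i ?\<phi> x = cv n k (g' i) x"
      "\<And>x i. x \<in> topspace (Rn n) \<Longrightarrow> x \<notin> L \<Longrightarrow> i < n \<Longrightarrow> cv n k (g' i) x = 0"
      using elim by blast+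
    have "(LINT x:\<Omega>|leb n. \<Sum>i<n. F i x * pderiv_at i ?\<phi> x) = (\<integral>x. (\<Sum>i<n. F' i x * cv n k (g' i) x) \<partial>leb n)"
      unfolding set_lebesgue_integral_def
    proof (rule Bochner_Integration.integral_cong[OF refl])
      fix x assume "x \<in> space (leb n)"
      then have x: "x \<in> topspace (Rn n)" by (simp only: space_leb)
      show "indicator \<Omega> x *\<^sub>R (\<Sum>i<n. F i x * pderiv_at i ?\<phi> x) = (\<Sum>i<n. F' i x * cv n k (g' i) x)"
      proof (cases "x \<in> L")
        case True
        then have "x \<in> \<Omega>" using L(2) by blast
        then show ?thesis using True B(2)[OF x] by (simp add: F'_def)
      next
        case False
        then show ?thesis using B(2)[OF x] B(3)[OF x False] by simp
      qed
    qed
    also have "\<dots> = (\<Sum>i<n. \<integral>x. F' i x * cv n k (g' i) x \<partial>leb n)"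
      using integrable_cv[OF g'(1)] cv_Lp(1)[OF p g']
      by (intro Bochner_Integration.integral_sum integrable_mult_dual[OF p F'] borel_measurable_integrable) auto
    finally have 1: "(LINT x:\<Omega>|leb n. \<Sum>i<n. F i x * pderiv_at i ?\<phi> x) = (\<Sum>i<n. \<integral>x. F' i x * cv n k (g' i) x \<partial>leb n)" .
    have 2: "(LINT x:\<Omega>|leb n. V x * \<bar>u x\<bar> powr (p - 2) * u x * ?\<phi> x) = (\<integral>x. indicator L x * ?\<phi> x * W x \<partial>leb n)"
      unfolding set_lebesgue_integral_def
    proof (rule Bochner_Integration.integral_cong[OF refl])
      fix x assume "x \<in> space (leb n)"
      then have x: "x \<in> topspace (Rn n)" by (simp only: space_leb)
      show "indicator \<Omega> x *\<^sub>R (V x * \<bar>u x\<bar> powr (p - 2) * u x * ?\<phi> x) = indicator L x * ?\<phi> x * W x"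
        using B(1)[OF x] L(2) by (cases "x \<in> L") (auto simp: W_def)
    qed
    show ?case using sol A unfolding positive_solution_def F_def[symmetric] 1[symmetric] 2[symmetric]
      unfolding F_def by blast
  qed
  then have "(\<lambda>k. (\<Sum>i<n. \<integral>x. F' i x * cv n k (g' i) x \<partial>leb n) + (\<integral>x. indicator L x * cv n k f' x * W x \<partial>leb n)) \<longlonglongrightarrow> 0"
    by (rule tendsto_eventually)
  moreover have "(\<lambda>k. (\<Sum>i<n. \<integral>x. F' i x * cv n k (g' i) x \<partial>leb n) + (\<integral>x. indicator L x * cv n k f' x * W x \<partial>leb n)) \<longlonglongrightarrow>
      (\<Sum>i<n. \<integral>x. F' i x * g' i x \<partial>leb n) + (\<integral>x. indicator L x * f x * W x \<partial>leb n)"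
    by (intro tendsto_add tendsto_sum t1 t2) simp
  ultimately have "(\<Sum>i<n. \<integral>x. F' i x * g' i x \<partial>leb n) + (\<integral>x. indicator L x * f x * W x \<partial>leb n) = 0"
    using LIMSEQ_unique by blast
  moreover have "(\<lambda>x. indicator L x * f x * W x) = (\<lambda>x. indicator K x * (V x * (\<bar>u x\<bar> powr (p - 2) * u x * f x)))"
  proof
    fix x show "indicator L x * f x * W x = indicator K x * (V x * (\<bar>u x\<bar> powr (p - 2) * u x * f x))"
      using fz[of x] KL L(2) by (auto simp: W_def indicator_def)
  qed
  ultimately show "(\<Sum>i<n. \<integral>x. indicator K x * (F i x * g i x) \<partial>leb n) +
      (\<integral>x. indicator K x * (V x * (\<bar>u x\<bar> powr (p - 2) * u x * f x)) \<partial>leb n) = 0"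
    using Fg by simp
qed

text \<open>Picone's identity in one coordinate, with s and t for the partial derivatives of u and
  \<psi>. The cross term has total degree p in the common factor a^(1/p), which therefore comes out
  as a; the subtracted term on the left is the flux of u paired with the derivative of u
  \<psi>^p.\<close>

lemma weighted_Picone_remainder:
  fixes a p u \<psi> s t :: real
  assumes "0 < a" "1 < p"
  defines "A \<equiv> a powr (1 / p) * (\<psi> * s)" and "B \<equiv> a powr (1 / p) * (u * t)"
  shows "a * \<bar>\<psi> * s + u * t\<bar> powr p -
      a * \<bar>s\<bar> powr (p - 2) * s * (\<bar>\<psi>\<bar> powr p * s + u * (p * (\<bar>\<psi>\<bar> powr (p - 2) * \<psi>)) * t) =
    \<bar>A + B\<bar> powr p - \<bar>A\<bar> powr p - p * \<bar>A\<bar> powr (p - 2) * A * B"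
proof -
  define b where "b = a powr (1 / p)"
  have b: "0 < b" "b powr p = a" using assms(1,2) by (auto simp: b_def powr_powr)
  have bp: "b powr (p - 2) * b * b = a" using abs_powr_diff_2_mult_square[of b p] b by simp
  have 1: "\<bar>A + B\<bar> powr p = a * \<bar>\<psi> * s + u * t\<bar> powr p"
  proof -
    have "A + B = b * (\<psi> * s + u * t)" by (simp add: A_def B_def b_def distrib_left)
    then show ?thesis using b by (simp add: abs_mult powr_mult)
  qed
  have 2: "\<bar>A\<bar> powr p = a * (\<bar>\<psi>\<bar> powr p * (\<bar>s\<bar> powr (p - 2) * s * s))"
    unfolding abs_powr_diff_2_mult_square A_def b_def[symmetric] using b by (simp add: abs_mult powr_mult)
  have 3: "\<bar>A\<bar> powr (p - 2) * A * B = (b powr (p - 2) * b * b) * ((\<bar>\<psi>\<bar> powr (p - 2) * \<psi>) * (\<bar>s\<bar> powr (p - 2) * s) * (u * t))"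
    unfolding A_def B_def b_def[symmetric] using b by (simp add: abs_mult powr_mult)
  show ?thesis
    unfolding 1 2 mult.assoc[of p] mult.assoc[of _ A B] using 3 unfolding bp by (simp add: algebra_simps)
qed

text \<open>The remainder inequality is integrated coordinate by coordinate. Its constants enter
  from outside, so they cannot depend on the domain, the coefficients or the solution.\<close>

lemma ground_state_transform:
  fixes p c C :: real
  assumes p: "1 < p" and c: "0 < c" "c \<le> C"
    and lower: "\<And>A B. c * (B\<^sup>2 * (\<bar>A\<bar> + \<bar>B\<bar>) powr (p - 2)) \<le>
      \<bar>A + B\<bar> powr p - \<bar>A\<bar> powr p - p * \<bar>A\<bar> powr (p - 2) * A * B"
    and upper: "\<And>A B. \<bar>A + B\<bar> powr p - \<bar>A\<bar> powr p - p * \<bar>A\<bar> powr (p - 2) * A * B \<le>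
      C * (B\<^sup>2 * (\<bar>A\<bar> + \<bar>B\<bar>) powr (p - 2))"
    and \<Omega>: "openin (Rn n) \<Omega>" and a: "weight_vector n \<Omega> a"
    and V: "V \<in> morrey_loc n p q \<Omega>" and sol: "positive_solution n \<Omega> p a V u" and uc: "u \<in> C_on n \<Omega>"
    and \<psi>: "\<psi> \<in> W1p n p \<Omega>" "\<psi> \<in> C_c n \<Omega>" "\<And>x. x \<in> \<Omega> \<Longrightarrow> 0 \<le> \<psi> x"
  shows "c * E_fun n \<Omega> p a u \<psi> \<le> Q_fun n \<Omega> p a V (\<lambda>x. u x * \<psi> x) \<and>
    Q_fun n \<Omega> p a V (\<lambda>x. u x * \<psi> x) \<le> C * E_fun n \<Omega> p a u \<psi>"
proof -
  have \<psi>c: "\<psi> \<in> C_on n \<Omega>" by (rule C_c_C_on[OF \<psi>(2)])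
  obtain K where K: "compactin (Rn n) K" "K \<subseteq> \<Omega>" "\<And>x. x \<in> \<Omega> \<Longrightarrow> x \<notin> K \<Longrightarrow> \<psi> x = 0"
    by (rule C_c_compact_support[OF \<psi>(2) \<Omega>]) blast
  note Vi = morrey_loc_integrable[OF V \<Omega>]
  have uW: "u \<in> W1p_loc n p \<Omega>" and upos: "\<And>x. x \<in> \<Omega> \<Longrightarrow> 0 < u x"
    using sol unfolding positive_solution_def by blast+
  have \<psi>W: "\<psi> \<in> W1p_loc n p \<Omega>" using W1p_subset_W1p_loc[OF \<Omega>] \<psi>(1) by blast
  define s where "s i = weak_pderiv n \<Omega> i u" for i
  define t where "t i = weak_pderiv n \<Omega> i \<psi>" for i
  note su = W1p_loc_weak_pderiv[OF uW _ \<Omega>, folded s_def] and tp = W1p_loc_weak_pderiv[OF \<psi>W _ \<Omega>, folded t_def]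
  let ?RS = "restrict_space (leb n) \<Omega>"
  have am: "a i \<in> borel_measurable ?RS" and apos: "\<And>x. x \<in> \<Omega> \<Longrightarrow> 0 < a i x" if "i < n" for i
    using a that unfolding weight_vector_def by blast+
  have C_on_RS: "v \<in> borel_measurable ?RS" if "v \<in> C_on n \<Omega>" for v
    unfolding measurable_restrict_leb[OF openin_sets_leb[OF \<Omega>]] by (rule measurable_leb[OF C_on_measurable_leb[OF that \<Omega>]])
  note um = C_on_RS[OF uc] and \<psi>m = C_on_RS[OF \<psi>c]
  \<comment> \<open>|t|^p is continuously differentiable on the whole line as p > 1, so the rule for
    u h(\<psi>) applies although \<psi> is nonnegative on \<Omega> only.\<close>
  let ?h = "\<lambda>t::real. \<bar>t\<bar> powr p" and ?h' = "\<lambda>t::real. p * (\<bar>t\<bar> powr (p - 2) * t)"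
  have hd: "(?h has_real_derivative ?h' r) (at r)" for r
    using has_real_derivative_abs_powr[OF p, of r] by (simp add: mult.assoc)
  have h'c: "continuous_on UNIV ?h'" by (intro continuous_on_mult continuous_on_const continuous_abs_powr_mult[OF p])
  have hc: "continuous_on UNIV ?h" by (intro continuous_at_imp_continuous_on ballI DERIV_isCont[OF hd])
  \<comment> \<open>With this f the product |u|^(p-2) u f equals |u \<psi>|^p, so the potential term
    of the tested equation is the one occurring in Q.\<close>
  define f where "f x = u x * \<bar>\<psi> x\<bar> powr p" for x
  define g where "g i x = \<bar>\<psi> x\<bar> powr p * s i x + u x * (p * (\<bar>\<psi> x\<bar> powr (p - 2) * \<psi> x)) * t i x" for i x
  have c1: "(\<lambda>x. \<bar>\<psi> x\<bar> powr p) \<in> C_on n \<Omega>" by (rule C_on_compose[OF \<psi>c hc])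
  have c2: "(\<lambda>x. u x * (p * (\<bar>\<psi> x\<bar> powr (p - 2) * \<psi> x))) \<in> C_on n \<Omega>" by (rule C_on_mult[OF uc C_on_compose[OF \<psi>c h'c]])
  have fc: "f \<in> C_on n \<Omega>" unfolding f_def by (rule C_on_mult[OF uc c1])
  have fg: "is_weak_pderiv n \<Omega> i f (g i)" if i: "i < n" for i
    unfolding f_def g_def by (rule is_weak_pderiv_mult_comp[OF \<Omega> i uc \<psi>c su(1)[OF i] tp(1)[OF i] hd h'c])
  have gp: "integrable (leb n) (\<lambda>x. indicator K x * \<bar>g i x\<bar> powr p)" if i: "i < n" and K: "compactin (Rn n) K" "K \<subseteq> \<Omega>" for i K
    unfolding g_def
  proof (rule integrable_powr_add[OF _ compactin_sets_leb[OF K(1)]])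
    show "0 \<le> p" using p by simp
    show "integrable (leb n) (\<lambda>x. indicator K x * \<bar>\<bar>\<psi> x\<bar> powr p * s i x\<bar> powr p)"
      using p by (intro integrable_powr_mult_C_on[OF \<Omega> K _ su(3)[OF i K] c1]) simp
    show "integrable (leb n) (\<lambda>x. indicator K x * \<bar>u x * (p * (\<bar>\<psi> x\<bar> powr (p - 2) * \<psi> x)) * t i x\<bar> powr p)"
      using p by (intro integrable_powr_mult_C_on[OF \<Omega> K _ tp(3)[OF i K] c2]) simp
    have "g i \<in> borel_measurable ?RS" using fg[OF i] unfolding is_weak_pderiv_def using Lp_loc_measurable by blast
    then show "(\<lambda>x. indicator K x * (\<bar>\<psi> x\<bar> powr p * s i x + u x * (p * (\<bar>\<psi> x\<bar> powr (p - 2) * \<psi> x)) * t i x)) \<in> borel_measurable (leb n)"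
      unfolding g_def[symmetric] by (rule measurable_indicator_compact[OF _ \<Omega> K])
  qed
  define F where "F i x = a i x * \<bar>s i x\<bar> powr (p - 2) * s i x" for i x
  \<comment> \<open>Off \<open>K\<close> the function \<open>g\<close> vanishes at every point and
    not just almost everywhere, since its summands carry the factors |\<psi>|^p and |\<psi>|^(p-2)
    \<psi>. The test lemma relies on the pointwise form.\<close>
  have fz: "\<And>x. x \<in> \<Omega> \<Longrightarrow> x \<notin> K \<Longrightarrow> f x = 0" and gz: "\<And>i x. x \<in> \<Omega> \<Longrightarrow> x \<notin> K \<Longrightarrow> g i x = 0"
    using K(3) p by (auto simp: f_def g_def)
  have test1: "integrable (leb n) (\<lambda>x. indicator K x * (F i x * g i x))" if i: "i < n" for i
    unfolding F_def s_def
    by (rule positive_solution_test(1)[OF p \<Omega> a _ sol uc fc K(1,2)]) (rule Vi fz fg gz gp i; assumption)+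
  have test2: "(\<Sum>i<n. \<integral>x. indicator K x * (F i x * g i x) \<partial>leb n) +
      (\<integral>x. indicator K x * (V x * (\<bar>u x\<bar> powr (p - 2) * u x * f x)) \<partial>leb n) = 0"
    unfolding F_def s_def
    by (rule positive_solution_test(2)[OF p \<Omega> a _ sol uc fc K(1,2)]) (rule Vi fz fg gz gp; assumption)+
  define D where "D i x = \<psi> x * s i x + u x * t i x" for i x
  have Dw: "is_weak_pderiv n \<Omega> i (\<lambda>x. u x * \<psi> x) (D i)" if i: "i < n" for i
    using is_weak_pderiv_mult_comp[OF \<Omega> i uc \<psi>c su(1)[OF i] tp(1)[OF i], of "\<lambda>t. t" "\<lambda>_. 1"]
    unfolding D_def by simp
  define w where "w i = weak_pderiv n \<Omega> i (\<lambda>x. u x * \<psi> x)" for i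
  \<comment> \<open>Q is written with a chosen representative of the derivative of u \<psi>; the
    product rule determines it almost everywhere.\<close>
  have wD: "AE x in leb n. x \<in> \<Omega> \<longrightarrow> w i x = D i x" if i: "i < n" for i
    unfolding w_def by (rule is_weak_pderiv_unique[OF \<Omega> is_weak_pderiv_weak_pderiv[OF Dw[OF i]] Dw[OF i]])
  have wm: "w i \<in> borel_measurable ?RS" if i: "i < n" for i
    using is_weak_pderiv_weak_pderiv[OF Dw[OF i]] unfolding is_weak_pderiv_def w_def using Lp_loc_measurable by blast
  \<comment> \<open>The chosen derivative of \<psi> may be nonzero on a null set off
    \<open>K\<close>, so the integrals over \<Omega> agree with those over \<open>K\<close> by an
    almost everywhere argument only.\<close>
  have t0: "AE x in leb n. x \<in> \<Omega> - K \<longrightarrow> t i x = 0" if i: "i < n" for i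
  proof (rule weak_pderiv_zero_where_zero[OF \<Omega> i tp(1)[OF i]])
    have "\<Omega> \<inter> (topspace (Rn n) - K) = \<Omega> - K" using openin_subset[OF \<Omega>] by blast
    then show "openin (Rn n) (\<Omega> - K)" using openin_Int[OF \<Omega> openin_compl_compact[OF K(1)]] by simp
  qed (use K(3) in auto)
  define T where "T i x = indicator K x * (a i x * \<bar>D i x\<bar> powr p)" for i x
  define P where "P x = indicator K x * (V x * (\<bar>u x\<bar> powr (p - 2) * u x * f x))" for x
  have Ti: "integrable (leb n) (T i)" if i: "i < n" for i
  proof -
    have "integrable (leb n) (\<lambda>x. indicator K x * \<bar>D i x\<bar> powr p)"
      unfolding D_def
    proof (rule integrable_powr_add[OF _ compactin_sets_leb[OF K(1)]])
      show "0 \<le> p" using p by simp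
      show "integrable (leb n) (\<lambda>x. indicator K x * \<bar>\<psi> x * s i x\<bar> powr p)"
        using p by (intro integrable_powr_mult_C_on[OF \<Omega> K(1,2) _ su(3)[OF i K(1,2)] \<psi>c]) simp
      show "integrable (leb n) (\<lambda>x. indicator K x * \<bar>u x * t i x\<bar> powr p)"
        using p by (intro integrable_powr_mult_C_on[OF \<Omega> K(1,2) _ tp(3)[OF i K(1,2)] uc]) simp
      have "(\<lambda>x. \<psi> x * s i x + u x * t i x) \<in> borel_measurable ?RS"
        using um \<psi>m su(2)[OF i] tp(2)[OF i] by measurable
      then show "(\<lambda>x. indicator K x * (\<psi> x * s i x + u x * t i x)) \<in> borel_measurable (leb n)"
        by (rule measurable_indicator_compact[OF _ \<Omega> K(1,2)])
    qed
    moreover obtain B where "0 \<le> B" "AE x in leb n. x \<in> K \<longrightarrow> a i x \<le> B"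
      by (rule weight_vector_bounded[OF a \<Omega> K(1,2)]) (use i in blast)
    ultimately show ?thesis
      unfolding T_def using apos[OF i] K(2) measurable_indicator_compact[OF am[OF i] \<Omega> K(1,2)]
      by (intro integrable_weight_mult) (auto intro: less_imp_le)
  qed
  have Pi: "integrable (leb n) P"
    unfolding P_def by (rule integrable_indicator_mult_C_on[OF \<Omega> K(1,2) Vi[OF K(1,2)]
        C_on_mult[OF C_on_compose[OF uc continuous_abs_powr_mult[OF p]] fc]])
  have Q: "Q_fun n \<Omega> p a V (\<lambda>x. u x * \<psi> x) = (\<Sum>i<n. \<integral>x. T i x \<partial>leb n) + (\<integral>x. P x \<partial>leb n)"
  proof -
    have "Q_fun n \<Omega> p a V (\<lambda>x. u x * \<psi> x) = (\<integral>x. indicator \<Omega> x * (\<Sum>i<n. a i x * \<bar>w i x\<bar> powr p) + P x \<partial>leb n)"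
      unfolding Q_fun_def set_lebesgue_integral_def w_def[symmetric]
    proof (rule Bochner_Integration.integral_cong[OF refl])
      fix x
      show "indicator \<Omega> x *\<^sub>R (weighted_norm n p a x (\<lambda>i. w i x) powr p + V x * \<bar>u x * \<psi> x\<bar> powr p) =
          indicator \<Omega> x * (\<Sum>i<n. a i x * \<bar>w i x\<bar> powr p) + P x"
      proof (cases "x \<in> \<Omega>")
        case True
        have "0 \<le> (\<Sum>i<n. a i x * \<bar>w i x\<bar> powr p)"
          using apos True by (intro sum_nonneg mult_nonneg_nonneg) (auto intro: less_imp_le)
        then have 1: "weighted_norm n p a x (\<lambda>i. w i x) powr p = (\<Sum>i<n. a i x * \<bar>w i x\<bar> powr p)"
          using p unfolding weighted_norm_def by (simp add: powr_powr)
        have 2: "V x * \<bar>u x * \<psi> x\<bar> powr p = P x"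
        proof (cases "x \<in> K")
          case True
          have "\<bar>u x\<bar> powr (p - 2) * u x * f x = (\<bar>u x\<bar> powr (p - 2) * u x * u x) * \<bar>\<psi> x\<bar> powr p"
            unfolding f_def by (simp only: mult.assoc)
          also have "\<dots> = \<bar>u x\<bar> powr p * \<bar>\<psi> x\<bar> powr p"
            by (simp only: abs_powr_diff_2_mult_square)
          finally have "\<bar>u x\<bar> powr (p - 2) * u x * f x = \<bar>u x\<bar> powr p * \<bar>\<psi> x\<bar> powr p" .
          then show ?thesis using True by (simp add: P_def abs_mult powr_mult)
        next
          case False
          then show ?thesis using K(3)[OF \<open>x \<in> \<Omega>\<close>] p by (simp add: P_def)
        qed
        show ?thesis unfolding 1 2 using True by simp
      next
        case False
        then have "x \<notin> K" using K(2) by blast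
        then show ?thesis using False by (simp add: P_def)
      qed
    qed
    also have "\<dots> = (\<integral>x. (\<Sum>i<n. T i x) + P x \<partial>leb n)"
    proof (rule integral_cong_AE)
      have "(\<lambda>x. \<Sum>i<n. a i x * \<bar>w i x\<bar> powr p) \<in> borel_measurable ?RS"
        using am wm by (intro borel_measurable_sum borel_measurable_times borel_measurable_abs_powr) auto
      then show "(\<lambda>x. indicator \<Omega> x * (\<Sum>i<n. a i x * \<bar>w i x\<bar> powr p) + P x) \<in> borel_measurable (leb n)"
        unfolding measurable_restrict_leb[OF openin_sets_leb[OF \<Omega>]]
        by (rule borel_measurable_add[OF _ borel_measurable_integrable[OF Pi]])
      show "(\<lambda>x. (\<Sum>i<n. T i x) + P x) \<in> borel_measurable (leb n)"
        using Ti Pi by (intro borel_measurable_add borel_measurable_sum) auto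
      have "AE x in leb n. \<forall>i\<in>{..<n}. x \<in> \<Omega> \<longrightarrow> w i x = D i x" using wD by (intro AE_finite_allI) auto
      moreover have "AE x in leb n. \<forall>i\<in>{..<n}. x \<in> \<Omega> - K \<longrightarrow> t i x = 0" using t0 by (intro AE_finite_allI) auto
      ultimately show "AE x in leb n. indicator \<Omega> x * (\<Sum>i<n. a i x * \<bar>w i x\<bar> powr p) + P x = (\<Sum>i<n. T i x) + P x"
      proof eventually_elim
        case (elim x)
        have "indicator \<Omega> x * (\<Sum>i<n. a i x * \<bar>w i x\<bar> powr p) = (\<Sum>i<n. T i x)"
          unfolding sum_distrib_left
        proof (rule sum.cong[OF refl])
          fix i assume "i \<in> {..<n}"
          then show "indicator \<Omega> x * (a i x * \<bar>w i x\<bar> powr p) = T i x"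
            using elim K(2) K(3)[of x] p by (cases "x \<in> K"; cases "x \<in> \<Omega>") (auto simp: T_def D_def)
        qed
        then show ?case by simp
      qed
    qed
    also have "\<dots> = (\<Sum>i<n. \<integral>x. T i x \<partial>leb n) + (\<integral>x. P x \<partial>leb n)"
      using Ti Pi by (subst Bochner_Integration.integral_add) (auto simp: Bochner_Integration.integral_sum)
    finally show ?thesis .
  qed
  \<comment> \<open>Subtracting the tested equation removes the potential and leaves the Picone
    remainder, summed over the coordinates.\<close>
  define R where "R i x = T i x - indicator K x * (F i x * g i x)" for i x
  have Ri: "integrable (leb n) (R i)" if "i < n" for i
    unfolding R_def using Ti[OF that] test1[OF that] by simp
  have QR: "Q_fun n \<Omega> p a V (\<lambda>x. u x * \<psi> x) = (\<Sum>i<n. \<integral>x. R i x \<partial>leb n)"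
  proof -
    have "(\<Sum>i<n. \<integral>x. R i x \<partial>leb n) = (\<Sum>i<n. \<integral>x. T i x \<partial>leb n) - (\<Sum>i<n. \<integral>x. indicator K x * (F i x * g i x) \<partial>leb n)"
      unfolding R_def sum_subtractf[symmetric] using Ti test1 by (intro sum.cong) auto
    then show ?thesis using Q test2 unfolding P_def by linarith
  qed
  define e where "e i x = (u x)\<^sup>2 * \<bar>weighted_pderiv n \<Omega> p a i \<psi> x\<bar>\<^sup>2 *
     (\<psi> x * \<bar>weighted_pderiv n \<Omega> p a i u x\<bar> + u x * \<bar>weighted_pderiv n \<Omega> p a i \<psi> x\<bar>) powr (p - 2)" for i x
  define e' where "e' i x = indicator K x * e i x" for i x
  have e_m: "e i \<in> borel_measurable ?RS" if i: "i < n" for i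
    unfolding e_def weighted_pderiv_def s_def[symmetric] t_def[symmetric]
    using am[OF i] um \<psi>m su(2)[OF i] tp(2)[OF i] by measurable
  have e'm: "e' i \<in> borel_measurable (leb n)" if i: "i < n" for i
    unfolding e'_def by (rule measurable_indicator_compact[OF e_m[OF i] \<Omega> K(1,2)])
  have e0: "0 \<le> e' i x" for i x by (simp add: e'_def e_def)
  have cRC: "c * e' i x \<le> R i x \<and> R i x \<le> C * e' i x" if i: "i < n" for i x
  proof (cases "x \<in> K")
    case True
    then have x: "x \<in> \<Omega>" using K(2) by blast
    let ?A = "a i x powr (1 / p) * (\<psi> x * s i x)" and ?B = "a i x powr (1 / p) * (u x * t i x)"
    have "R i x = \<bar>?A + ?B\<bar> powr p - \<bar>?A\<bar> powr p - p * \<bar>?A\<bar> powr (p - 2) * ?A * ?B"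
      using weighted_Picone_remainder[OF apos[OF i x] p, of "\<psi> x" "s i x" "u x" "t i x"] True
      unfolding R_def T_def D_def F_def g_def by simp
    \<comment> \<open>Here the signs enter: nonnegative \<psi> and positive u leave the absolute
      values, so |A| + |B| becomes the base of the power in E.\<close>
    moreover have "e' i x = ?B\<^sup>2 * (\<bar>?A\<bar> + \<bar>?B\<bar>) powr (p - 2)"
    proof -
      have "\<bar>?A\<bar> = \<psi> x * \<bar>a i x powr (1 / p) * s i x\<bar>" "\<bar>?B\<bar> = u x * \<bar>a i x powr (1 / p) * t i x\<bar>"
        using \<psi>(3)[OF x] upos[OF x] by (simp_all add: abs_mult)
      moreover have "?B\<^sup>2 = (u x)\<^sup>2 * \<bar>a i x powr (1 / p) * t i x\<bar>\<^sup>2"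
        by (simp add: power_mult_distrib)
      ultimately show ?thesis using True
        unfolding e'_def e_def weighted_pderiv_def s_def[symmetric] t_def[symmetric] by simp
    qed
    ultimately show ?thesis using lower[where A="?A" and B="?B"] upper[where A="?A" and B="?B"] by simp
  next
    case False
    then show ?thesis by (simp add: e'_def R_def T_def)
  qed
  \<comment> \<open>Integrability of the energy density is read off the lower bound e' \<le> R / c,
    for every p at once. Without it the integrals could not be compared.\<close>
  have e'i: "integrable (leb n) (e' i)" if i: "i < n" for i
  proof (rule Bochner_Integration.integrable_bound[of _ "\<lambda>x. R i x / c"])
    show "integrable (leb n) (\<lambda>x. R i x / c)" using Ri[OF i] by simp
    show "AE x in leb n. norm (e' i x) \<le> norm (R i x / c)"
    proof (rule AE_I2)
      fix x
      have "e' i x \<le> R i x / c" using cRC[OF i, of x] c(1) by (simp add: field_simps)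
      then show "norm (e' i x) \<le> norm (R i x / c)"
        using e0[of i x] unfolding real_norm_def by linarith
    qed
  qed (rule e'm[OF i])
  have E: "E_fun n \<Omega> p a u \<psi> = (\<Sum>i<n. \<integral>x. e' i x \<partial>leb n)"
  proof -
    have "E_fun n \<Omega> p a u \<psi> = (\<integral>x. indicator \<Omega> x * (\<Sum>i<n. e i x) \<partial>leb n)"
      unfolding E_fun_def set_lebesgue_integral_def e_def by simp
    also have "\<dots> = (\<integral>x. (\<Sum>i<n. e' i x) \<partial>leb n)"
    proof (rule integral_cong_AE)
      have "(\<lambda>x. \<Sum>i<n. e i x) \<in> borel_measurable ?RS" using e_m by (intro borel_measurable_sum) auto
      then show "(\<lambda>x. indicator \<Omega> x * (\<Sum>i<n. e i x)) \<in> borel_measurable (leb n)"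
        unfolding measurable_restrict_leb[OF openin_sets_leb[OF \<Omega>]] .
      show "(\<lambda>x. \<Sum>i<n. e' i x) \<in> borel_measurable (leb n)" using e'm by (intro borel_measurable_sum) auto
      have "AE x in leb n. \<forall>i\<in>{..<n}. x \<in> \<Omega> - K \<longrightarrow> t i x = 0" using t0 by (intro AE_finite_allI) auto
      then show "AE x in leb n. indicator \<Omega> x * (\<Sum>i<n. e i x) = (\<Sum>i<n. e' i x)"
      proof eventually_elim
        case (elim x)
        show ?case unfolding sum_distrib_left
        proof (rule sum.cong[OF refl])
          fix i assume "i \<in> {..<n}"
          then show "indicator \<Omega> x * e i x = e' i x"
            using elim K(2) by (cases "x \<in> K"; cases "x \<in> \<Omega>")
              (auto simp: e'_def e_def weighted_pderiv_def simp flip: t_def)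
        qed
      qed
    qed
    also have "\<dots> = (\<Sum>i<n. \<integral>x. e' i x \<partial>leb n)" using e'i by (intro Bochner_Integration.integral_sum) auto
    finally show ?thesis .
  qed
  have "c * (\<integral>x. e' i x \<partial>leb n) \<le> (\<integral>x. R i x \<partial>leb n) \<and> (\<integral>x. R i x \<partial>leb n) \<le> C * (\<integral>x. e' i x \<partial>leb n)"
    if i: "i < n" for i
  proof -
    have "(\<integral>x. c * e' i x \<partial>leb n) \<le> (\<integral>x. R i x \<partial>leb n)"
      by (rule integral_mono) (use cRC[OF i] e'i[OF i] Ri[OF i] in auto)
    moreover have "(\<integral>x. R i x \<partial>leb n) \<le> (\<integral>x. C * e' i x \<partial>leb n)"
      by (rule integral_mono) (use cRC[OF i] e'i[OF i] Ri[OF i] in auto)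
    ultimately show ?thesis by simp
  qed
  then show ?thesis unfolding QR E sum_distrib_left by (auto intro: sum_mono)
qed

theorem lemma3p18:
  fixes p :: real
  assumes "1 < p"
  shows "\<exists>c C. 0 < c \<and> c \<le> C \<and>
    (\<forall>(n::nat) (q::real) \<Omega> a V u.
      2 \<le> n \<and> is_domain n \<Omega> \<and> weight_vector n \<Omega> a \<and>
      morrey_exponent n p q \<and> V \<in> morrey_loc n p q \<Omega> \<and>
      (\<forall>\<phi>\<in>C_c_inf n \<Omega>. 0 \<le> Q_fun n \<Omega> p a V \<phi>) \<and>
      positive_solution n \<Omega> p a V u \<and> u \<in> C_on n \<Omega> \<longrightarrow>
      (\<forall>\<psi> \<in> W1p n p \<Omega> \<inter> C_c n \<Omega>. (\<forall>x\<in>\<Omega>. 0 \<le> \<psi> x) \<longrightarrow>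
        c * E_fun n \<Omega> p a u \<psi> \<le> Q_fun n \<Omega> p a V (\<lambda>x. u x * \<psi> x) \<and>
        Q_fun n \<Omega> p a V (\<lambda>x. u x * \<psi> x) \<le> C * E_fun n \<Omega> p a u \<psi>))"
proof -
  \<comment> \<open>The constants are fixed before dimension, domain and coefficients are
    introduced, hence depend on p alone.\<close>
  obtain c C where c: "0 < c" "c \<le> C"
    and lower: "\<And>A B. c * (B\<^sup>2 * (\<bar>A\<bar> + \<bar>B\<bar>) powr (p - 2)) \<le>
      \<bar>A + B\<bar> powr p - \<bar>A\<bar> powr p - p * \<bar>A\<bar> powr (p - 2) * A * B"
    and upper: "\<And>A B. \<bar>A + B\<bar> powr p - \<bar>A\<bar> powr p - p * \<bar>A\<bar> powr (p - 2) * A * B \<le>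
      C * (B\<^sup>2 * (\<bar>A\<bar> + \<bar>B\<bar>) powr (p - 2))"
    by (rule convex_remainder_bounds[OF assms]) blast
  show ?thesis
  proof (rule exI[of _ c], rule exI[of _ C], intro conjI c allI impI ballI)
    fix n q \<Omega> a V u \<psi>
    assume H: "2 \<le> n \<and> is_domain n \<Omega> \<and> weight_vector n \<Omega> a \<and>
      morrey_exponent n p q \<and> V \<in> morrey_loc n p q \<Omega> \<and>
      (\<forall>\<phi>\<in>C_c_inf n \<Omega>. 0 \<le> Q_fun n \<Omega> p a V \<phi>) \<and>
      positive_solution n \<Omega> p a V u \<and> u \<in> C_on n \<Omega>"
      and \<psi>: "\<psi> \<in> W1p n p \<Omega> \<inter> C_c n \<Omega>" "\<forall>x\<in>\<Omega>. 0 \<le> \<psi> x"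
    have \<Omega>: "openin (Rn n) \<Omega>" using H unfolding is_domain_def by blast
    have "c * E_fun n \<Omega> p a u \<psi> \<le> Q_fun n \<Omega> p a V (\<lambda>x. u x * \<psi> x) \<and>
        Q_fun n \<Omega> p a V (\<lambda>x. u x * \<psi> x) \<le> C * E_fun n \<Omega> p a u \<psi>"
      by (rule ground_state_transform[OF assms c lower upper \<Omega>]) (use H \<psi> in auto)
    then show "c * E_fun n \<Omega> p a u \<psi> \<le> Q_fun n \<Omega> p a V (\<lambda>x. u x * \<psi> x)"
      "Q_fun n \<Omega> p a V (\<lambda>x. u x * \<psi> x) \<le> C * E_fun n \<Omega> p a u \<psi>" by blast+
  qed
qed

end
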